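(* Let $\Omega=\mathbb{R}^d$ or $\mathbb{T}^d$ ($d\ge1$), $0<t_*\le\infty$, and $q\ge1$. Let $u,\varrho,\mathbf{v}\in L^\infty(\Omega\times(0,t_* ))$ be any weak (distributional) solution on $\Omega\times(0,t_* )$ of the compressible Euler system $$\partial_t\varrho+\nabla_x\cdot(\varrho\mathbf{v})=0,\quad \partial_t(\varrho\mathbf{v})+\nabla_x\cdot(\varrho\mathbf{v}\otimes\mathbf{v}+p\mathbf{I})=0,\quad \partial_tE+\nabla_x\cdot((p+E)\mathbf{v})=0,$$ with $E=\frac12\varrho|\mathbf{v}|^2+u$ and smooth equation of state $p=p(u,\varrho)$ (as specified in the context), satisfying $\varrho\ge\varrho_0>0$ together with $$u\in L^\infty((0,t_* );B^{\sigma^u_q,\infty}_{q,loc}(\Omega)),\quad \varrho\in L^\infty((0,t_* );B^{\sigma^\varrho_q,\infty}_{q,loc}(\Omega)),\quad \mathbf{v}\in L^\infty((0,t_* );B^{\sigma^v_q,\infty}_{q,loc}(\Omega)),$$ for Besov exponents $0\le\sigma^u_q,\sigma^\varrho_q,\sigma^v_q\le1$. Then the solution is also Besov regular locally in space-time: $$u\in B_{q,loc}^{\min\{\sigma^\varrho_q,\sigma^v_q,\sigma^u_q\},\infty}(\Omega\times(0,t_* )),$$ $$\varrho\in B_{q,loc}^{\min\{\sigma^\varrho_q,\sigma^v_q\},\infty}(\Omega\times(0,t_* )),$$ $$\mathbf{v}\in B_{q,loc}^{\min\{\sigma^\varrho_q,\sigma^v_q,\sigma^u_q\},\infty}(\Omega\times(0,t_*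 )).$$
   Context: Equation of state: the pressure $p(u,\varrho)$ is a $C^M$ function, $M\ge2$, on an open set $U\subset\mathbb{R}^2$ containing the closed convex hull of the essential range of $(u,\varrho)$ over $\Omega\times(0,t_* )$. Besov spaces. For a domain $D$ ($D=\Omega$ or $D=\Omega\times(0,t_* )$), $O\subset\subset D$ means $\bar O$ is compact and $\bar O\subset D$. For open $O\subset\subset D$, $$\|f\|_{B^{\sigma,\infty}_q(O)}=\|f\|_{L^q(O)}+\sup_{|h|<h_O}\frac{\|f(\cdot+h)-f\|_{L^q(O)}}{|h|^\sigma},\qquad h_O=\mathrm{dist}(O,\partial D)$$ (with $h_O=\infty$ if $\partial D=\emptyset$), where $h$ ranges over nonzero vectors of $\mathbb{R}^{\dim D}$. $B^{\sigma,\infty}_{q,loc}(D)$ is the set of measurable $f$ on $D$ for which this norm is finite for every open $O\subset\subset D$. $L^\infty((0,t_* );B^{\sigma,\infty}_{q,loc}(\Omega))$ is the set of measurable $f$ on $\Omega\times(0,t_* )$ with $\sup_{t\in(0,t_* )}\|f(\cdot,t)\|_{B^{\sigma,\infty}_q(O)}<\infty$ for every open $O\subset\subset\Omega$. The definition is used, with the same formula, for $0\le\sigma\le1$. *)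

theory Defs
  imports "HOL-Analysis.Analysis"
begin

section \<open>Domains in Euclidean space and on the torus\<close>

text \<open>
  A domain is an open set \<open>region\<close> of a Euclidean space, taken modulo a group of translations
  \<open>periods\<close> with measurable fundamental domain \<open>cell\<close>.  For the trivial group the cell is everything.
  A function on the torus is thus a periodic function, an open subset of the torus is a periodic open
  set, and the measure of a subset of the torus is the Lebesgue measure of its trace on the cell.
\<close>

record 'a flat_domain =
  region :: "'a set"
  periods :: "'a set"
  cell :: "'a set"

definition whole_space :: "(real ^ 'n) flat_domain" where
  "whole_space = \<lparr>region = UNIV, periods = {0}, cell = UNIV\<rparr>"

definition torus :: "(real ^ 'n) flat_domain" where
  "torus = \<lparr>region = UNIV,
            periods = {k. \<forall>i. k $ i \<in> \<int>},
            cell = {x. \<forall>i. 0 \<le> x $ i \<and> x $ i < 1}\<rparr>"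

definition spacetime :: "'a::euclidean_space flat_domain \<Rightarrow> ereal \<Rightarrow> ('a \<times> real) flat_domain" where
  "spacetime \<Omega> T = \<lparr>region = region \<Omega> \<times> {t. 0 < t \<and> ereal t < T},
                    periods = periods \<Omega> \<times> {0},
                    cell = cell \<Omega> \<times> UNIV\<rparr>"

definition periodic_set :: "'a::euclidean_space set \<Rightarrow> 'a set \<Rightarrow> bool" where
  "periodic_set P S \<longleftrightarrow> (\<forall>x. \<forall>k\<in>P. x \<in> S \<longleftrightarrow> x + k \<in> S)"

text \<open>
  The closure of an open subset of the quotient is compact iff the trace of its periodic lift on the
  (bounded, or trivial) cell has compact closure.
\<close>

definition compactly_in :: "'a::euclidean_space flat_domain \<Rightarrow> 'a set \<Rightarrow> bool" where
  "compactly_in D O' \<longleftrightarrow>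
     open O' \<and> periodic_set (periods D) O' \<and>
     compact (closure (O' \<inter> cell D)) \<and> closure O' \<subseteq> region D"

definition measurable_fun :: "'a::euclidean_space flat_domain \<Rightarrow> ('a \<Rightarrow> 'b::euclidean_space) \<Rightarrow> bool"
  where
  "measurable_fun D f \<longleftrightarrow>
     f \<in> borel_measurable (lebesgue_on (region D)) \<and>
     (\<forall>x\<in>region D. \<forall>k\<in>periods D. f (x + k) = f x)"

definition Linfty :: "'a::euclidean_space flat_domain \<Rightarrow> ('a \<Rightarrow> 'b::euclidean_space) set" where
  "Linfty D = {f. measurable_fun D f \<and>
                  (\<exists>C::real. AE x in lebesgue_on (region D). norm (f x) \<le> C)}"

definition ess_range :: "'a::euclidean_space flat_domain \<Rightarrow> ('a \<Rightarrow> 'b::euclidean_space) \<Rightarrow> 'b set"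
  where
  "ess_range D f =
     {y. \<forall>\<epsilon>>0. emeasure lebesgue {x \<in> region D. dist (f x) y < \<epsilon>} > 0}"


section \<open>Besov spaces\<close>

definition Lq_norm ::
  "'a::euclidean_space flat_domain \<Rightarrow> real \<Rightarrow> 'a set \<Rightarrow> ('a \<Rightarrow> 'b::euclidean_space) \<Rightarrow> ennreal" where
  "Lq_norm D q O' f =
     (let I = (\<integral>\<^sup>+ x \<in> O' \<inter> cell D. ennreal (norm (f x) powr q) \<partial>lebesgue)
      in if I = \<infinity> then \<infinity> else ennreal (enn2real I powr (1 / q)))"

text \<open>
  The library sets the distance to the empty set to \<open>0\<close>, so the case of an empty boundary, where the
  admissible shifts are unrestricted, is listed separately.
\<close>

definition admissible_shifts :: "'a::euclidean_space flat_domain \<Rightarrow> 'a set \<Rightarrow> 'a set" where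
  "admissible_shifts D O' =
     {h. h \<noteq> 0 \<and>
         (frontier (region D) = {} \<or> norm h < setdist O' (frontier (region D)))}"

definition besov_norm ::
  "'a::euclidean_space flat_domain \<Rightarrow> real \<Rightarrow> real \<Rightarrow> 'a set \<Rightarrow> ('a \<Rightarrow> 'b::euclidean_space) \<Rightarrow> ennreal"
  where
  "besov_norm D \<sigma> q O' f =
     Lq_norm D q O' f +
     (SUP h\<in>admissible_shifts D O'.
        Lq_norm D q O' (\<lambda>x. f (x + h) - f x) / ennreal (norm h powr \<sigma>))"

definition besov_loc ::
  "'a::euclidean_space flat_domain \<Rightarrow> real \<Rightarrow> real \<Rightarrow> ('a \<Rightarrow> 'b::euclidean_space) set" where
  "besov_loc D \<sigma> q =
     {f. measurable_fun D f \<and> (\<forall>O'. compactly_in D O' \<longrightarrow> besov_norm D \<sigma> q O' f < \<infinity>)}"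

definition Linfty_besov_loc ::
  "'a::euclidean_space flat_domain \<Rightarrow> ereal \<Rightarrow> real \<Rightarrow> real \<Rightarrow> ('a \<times> real \<Rightarrow> 'b::euclidean_space) set"
  where
  "Linfty_besov_loc \<Omega> T \<sigma> q =
     {f. measurable_fun (spacetime \<Omega> T) f \<and>
         (\<forall>O'. compactly_in \<Omega> O' \<longrightarrow>
            (SUP t\<in>{t. 0 < t \<and> ereal t < T}. besov_norm \<Omega> \<sigma> q O' (\<lambda>x. f (x, t))) < \<infinity>)}"


section \<open>Distributional solutions of the compressible Euler system\<close>

text \<open>
  \<open>Ck_on k U f\<close> is meant for open \<open>U\<close> in a finite-dimensional space: \<open>f\<close> is differentiable on
  \<open>U\<close> and all its directional derivatives are of class \<open>C\<close> of order \<open>k - 1\<close>.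
\<close>

primrec Ck_on ::
  "nat \<Rightarrow> 'a::euclidean_space set \<Rightarrow> ('a \<Rightarrow> 'b::euclidean_space) \<Rightarrow> bool" where
  "Ck_on 0 U f \<longleftrightarrow> continuous_on U f"
| "Ck_on (Suc k) U f \<longleftrightarrow>
     (\<exists>f'. (\<forall>x\<in>U. (f has_derivative f' x) (at x)) \<and> (\<forall>h. Ck_on k U (\<lambda>x. f' x h)))"

definition test_functions :: "'a::euclidean_space flat_domain \<Rightarrow> ('a \<Rightarrow> real) set" where
  "test_functions D =
     {\<phi>. (\<forall>k. Ck_on k UNIV \<phi>) \<and>
         (\<forall>x. \<forall>k\<in>periods D. \<phi> (x + k) = \<phi> x) \<and>
         compactly_in D {x. \<phi> x \<noteq> 0}}"

text \<open>
  \<open>\<partial>\<^sub>t w + \<nabla>\<^sub>x \<cdot> F = 0\<close> in the sense of distributions.  With \<open>D\<phi>\<close> the space-time derivative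
  of the test function, \<open>\<partial>\<^sub>t \<phi> = D\<phi> (0, 1)\<close> and \<open>F \<cdot> \<nabla>\<^sub>x \<phi> = D\<phi> (F, 0)\<close>.
\<close>

definition weak_balance ::
  "'a::euclidean_space flat_domain \<Rightarrow> ereal \<Rightarrow> ('a \<times> real \<Rightarrow> real) \<Rightarrow> ('a \<times> real \<Rightarrow> 'a) \<Rightarrow> bool"
  where
  "weak_balance \<Omega> T w F \<longleftrightarrow>
     (\<forall>\<phi>\<in>test_functions (spacetime \<Omega> T).
        (LINT z : region (spacetime \<Omega> T) \<inter> cell (spacetime \<Omega> T) | lebesgue.
           w z * frechet_derivative \<phi> (at z) (0, 1) + frechet_derivative \<phi> (at z) (F z, 0)) = 0)"

definition total_energy ::
  "('z \<Rightarrow> real) \<Rightarrow> ('z \<Rightarrow> real) \<Rightarrow> ('z \<Rightarrow> real ^ 'n) \<Rightarrow> 'z \<Rightarrow> real" where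
  "total_energy u \<rho> v z = 1 / 2 * \<rho> z * (norm (v z))\<^sup>2 + u z"

text \<open>
  In the \<open>i\<close>-th momentum equation the flux is the \<open>i\<close>-th row of \<open>\<rho> v \<otimes> v + p I\<close>, that is,
  \<open>\<rho> v\<^sub>i v + p e\<^sub>i\<close>.
\<close>

definition weak_euler_solution ::
  "(real ^ 'n) flat_domain \<Rightarrow> ereal \<Rightarrow> (real \<times> real \<Rightarrow> real) \<Rightarrow>
   ((real ^ 'n) \<times> real \<Rightarrow> real) \<Rightarrow> ((real ^ 'n) \<times> real \<Rightarrow> real) \<Rightarrow>
   ((real ^ 'n) \<times> real \<Rightarrow> real ^ 'n) \<Rightarrow> bool" where
  "weak_euler_solution \<Omega> T p u \<rho> v \<longleftrightarrow>
     weak_balance \<Omega> T \<rho> (\<lambda>z. \<rho> z *\<^sub>R v z) \<and>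
     (\<forall>i. weak_balance \<Omega> T (\<lambda>z. \<rho> z * v z $ i)
            (\<lambda>z. (\<rho> z * v z $ i) *\<^sub>R v z + p (u z, \<rho> z) *\<^sub>R axis i 1)) \<and>
     weak_balance \<Omega> T (total_energy u \<rho> v)
       (\<lambda>z. (p (u z, \<rho> z) + total_energy u \<rho> v z) *\<^sub>R v z)"

end

theory Submission
  imports Defs
begin

text \<open>
  The time increment over \<open>\<tau>\<close> of a conserved density \<open>w\<close> with flux \<open>F\<close> is split by mollifying in space
  at scale \<open>\<bar>\<tau>\<bar>\<close>.  The distance of \<open>w\<close> to its mollification is of order \<open>\<bar>\<tau>\<bar> powr \<sigma>\<close> by
  spatial regularity, and the mollified density changes by the time integral of the divergence of the
  mollified flux, which is of order \<open>\<bar>\<tau>\<bar> * \<bar>\<tau>\<bar> powr (\<sigma> - 1)\<close>.  Bounded Besov functions are stable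
  under Lipschitz maps, so every flux inherits the regularity of the state in space, and the velocity
  and the internal energy, as Lipschitz functions of density, momentum and total energy, inherit
  that of the conserved densities in time.  The mass flux does not involve the internal energy, hence
  the better exponent of the density.
\<close>


section \<open>Smooth test functions\<close>

text \<open>The equations hold only as distributions and the state is fixed only up to null sets.
  For a fixed centre \<open>x\<close> the mollified density has a bounded weak time derivative, so
  its increment is the integral of that derivative, but only for times off a null set that depends
  on \<open>x\<close>. This does no harm: the space-time norm asks for time increments integrated
  over \<open>x\<close> and \<open>t\<close> together, and Tonelli allows integrating in
  \<open>t\<close> first. The width of the mollifier is forced. For width \<epsilon> the two errors
  are of order \<open>\<epsilon> powr \<sigma>\<close> and
  \<open>\<bar>\<tau>\<bar> * \<epsilon> powr (\<sigma> - 1)\<close>, and they balance at \<epsilon>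
  = |\<tau>|. On the torus the kernels of different widths are not rescalings of one profile, so
  scaling arguments give way to explicit bounds: the mass from below, the gradient from above. Their
  ratio leaves constants free of \<tau>. Two hypotheses enter through Lipschitz bounds on a fixed
  set of states: a density bounded below makes momentum over density Lipschitz, and the convex hull
  in the domain of the pressure admits the mean value inequality.\<close>

definition flat :: "nat \<Rightarrow> real \<Rightarrow> real" where
  "flat n x = (if x \<le> 0 then 0 else exp (- 1 / x) / x ^ n)"

text \<open>A single term of the exponential series at \<open>1 / x\<close>, the one of order
  \<open>n + 2\<close>, already dominates. The two surplus powers leave the factor
  \<open>x\<^sup>2\<close>, which makes the difference quotient at the origin vanish; for
  \<open>n = 2\<close> the constant is 4! = 24 and enters the bound on \<open>bump'\<close>.\<close>

lemma flat_bound: "\<bar>flat n x\<bar> \<le> fact (n + 2) * x\<^sup>2"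
proof (cases "x \<le> 0")
  case False
  then have x: "x > 0" by simp
  have "(1 / x) ^ (n + 2) / fact (n + 2) \<le> exp (1 / x)"
  proof -
    have "(1 / x) ^ (n + 2) / fact (n + 2) = (\<Sum>k\<in>{n + 2}. (1 / x) ^ k /\<^sub>R fact k)"
      by (simp add: divide_inverse mult.commute)
    also have "\<dots> \<le> (\<Sum>k. (1 / x) ^ k /\<^sub>R fact k)"
      using x by (intro sum_le_suminf summable_exp_generic) auto
    finally show ?thesis by (simp add: exp_def)
  qed
  then have "exp (- (1 / x)) * ((1 / x) ^ (n + 2) / fact (n + 2)) \<le> exp (- (1 / x)) * exp (1 / x)"
    by (intro mult_left_mono) auto
  also have "\<dots> = 1" by (simp add: exp_minus)
  finally have *: "exp (- (1 / x)) * ((1 / x) ^ (n + 2) / fact (n + 2)) \<le> 1" .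
  have "(fact (n + 2) * x\<^sup>2) * (exp (- (1 / x)) * ((1 / x) ^ (n + 2) / fact (n + 2))) = exp (- (1 / x)) / x ^ n"
    using x by (simp add: power_add power_divide power2_eq_square del: fact_Suc)
  moreover have "(fact (n + 2) * x\<^sup>2) * (exp (- (1 / x)) * ((1 / x) ^ (n + 2) / fact (n + 2))) \<le> fact (n + 2) * x\<^sup>2 * 1"
    using * by (intro mult_left_mono) auto
  ultimately have "exp (- (1 / x)) / x ^ n \<le> fact (n + 2) * x\<^sup>2" by simp
  then show ?thesis using False by (auto simp: flat_def)
qed (auto simp: flat_def)

text \<open>The powers of \<open>1 / x\<close> are carried along in \<open>flat n\<close> because
  differentiating \<open>exp (- 1 / x)\<close> produces them: the family is closed under derivatives
  up to linear combinations, so no higher derivative ever has to be computed.\<close>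

lemma flat_deriv: "(flat n has_real_derivative flat (n + 2) x - real n * flat (n + 1) x) (at x)"
proof -
  consider "x < 0" | "x > 0" | "x = 0" by linarith
  then show ?thesis
  proof cases
    case 1
    have "((\<lambda>x. 0::real) has_real_derivative 0) (at x)" by simp
    then have "(flat n has_real_derivative 0) (at x)"
      by (rule has_field_derivative_transform_within_open[of _ _ _ "{..<0}"])
        (use 1 in \<open>auto simp: flat_def\<close>)
    then show ?thesis using 1 by (simp add: flat_def)
  next
    case 2
    have e: "exp (- 1 / x) * (1 / x\<^sup>2) / x ^ n - exp (- 1 / x) * (real n * x ^ (n - 1)) / (x ^ n)\<^sup>2
        = flat (n + 2) x - real n * flat (n + 1) x"
    \<comment> \<open>The exponent \<open>n - 1\<close> is truncated at \<open>n = 0\<close>, where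
      the factor \<open>real n\<close> removes the term.\<close>
    proof (cases n)
      case 0 then show ?thesis using 2 by (simp add: flat_def power2_eq_square)
    next
      case (Suc m)
      then show ?thesis using 2 by (simp add: flat_def field_simps power2_eq_square power_add)
    qed
    have "((\<lambda>x. exp (- 1 / x) / x ^ n) has_real_derivative
        exp (- 1 / x) * (1 / x\<^sup>2) / x ^ n - exp (- 1 / x) * (real n * x ^ (n - 1)) / (x ^ n)\<^sup>2) (at x)"
      using 2 by (auto intro!: derivative_eq_intros simp: field_simps power2_eq_square)
    then have "(flat n has_real_derivative
        exp (- 1 / x) * (1 / x\<^sup>2) / x ^ n - exp (- 1 / x) * (real n * x ^ (n - 1)) / (x ^ n)\<^sup>2) (at x)"
      by (rule has_field_derivative_transform_within_open[of _ _ _ "{0<..}"])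
        (use 2 in \<open>auto simp: flat_def\<close>)
    then show ?thesis unfolding e .
  next
    case 3
    have "((\<lambda>h. flat n h / h) \<longlongrightarrow> 0) (at 0)"
    proof (rule Lim_null_comparison)
      have "\<bar>flat n h / h\<bar> \<le> fact (n + 2) * \<bar>h\<bar>" for h
        using flat_bound[of n h] mult_left_mono[OF flat_bound[of n h], of "1 / \<bar>h\<bar>"]
        by (cases "h = 0") (auto simp: abs_divide power2_eq_square abs_mult_self_eq[of h, symmetric] mult.assoc simp del: fact_Suc abs_mult_self_eq)
      then show "\<forall>\<^sub>F h in at 0. norm (flat n h / h) \<le> fact (n + 2) * \<bar>h\<bar>" by simp
      have "((\<lambda>h::real. fact (n + 2) * \<bar>h\<bar>) \<longlongrightarrow> fact (n + 2) * \<bar>0\<bar>) (at 0)"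
        by (intro tendsto_intros)
      then show "((\<lambda>h::real. fact (n + 2) * \<bar>h\<bar>) \<longlongrightarrow> 0) (at 0)" by simp
    qed
    then have "(flat n has_real_derivative 0) (at 0)"
      by (simp add: has_field_derivative_iff flat_def)
    then show ?thesis using 3 by (simp add: flat_def)
  qed
qed

text \<open>
  The directional derivatives of functions in this class stay in the class, so its members are of
  class \<open>C\<close> of every order; it is rich enough for all test functions needed below.
\<close>

inductive smooth :: "('a::euclidean_space \<Rightarrow> real) \<Rightarrow> bool" where
  smooth_const: "smooth (\<lambda>x. c)"
| smooth_linear: "bounded_linear l \<Longrightarrow> smooth l"
| smooth_add: "smooth f \<Longrightarrow> smooth g \<Longrightarrow> smooth (\<lambda>x. f x + g x)"
| smooth_mult: "smooth f \<Longrightarrow> smooth g \<Longrightarrow> smooth (\<lambda>x. f x * g x)"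
| smooth_flat: "smooth f \<Longrightarrow> smooth (\<lambda>x. flat n (f x))"
| smooth_sin: "smooth f \<Longrightarrow> smooth (\<lambda>x. sin (f x))"

section \<open>Closure properties of the smooth class\<close>

lemma smooth_cmult: "smooth f \<Longrightarrow> smooth (\<lambda>x. c * f x)"
  by (intro smooth_mult smooth_const)

lemma smooth_diff:
  assumes "smooth f" "smooth g" shows "smooth (\<lambda>x. f x - g x)"
proof -
  have "smooth (\<lambda>x. f x + (- 1) * g x)" by (intro smooth_add smooth_cmult assms)
  then show ?thesis by simp
qed

lemma smooth_power: "smooth f \<Longrightarrow> smooth (\<lambda>x. f x ^ n)"
  by (induction n) (auto intro: smooth_mult smooth_const)

lemma smooth_divide: "smooth f \<Longrightarrow> smooth (\<lambda>x. f x / c)"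
  using smooth_cmult[of f "1 / c"] by simp

lemma smooth_prod: "finite I \<Longrightarrow> (\<And>i. i \<in> I \<Longrightarrow> smooth (f i)) \<Longrightarrow> smooth (\<lambda>x. \<Prod>i\<in>I. f i x)"
  by (induction I rule: finite_induct) (auto intro: smooth_mult smooth_const)

lemma smooth_compose_linear:
  assumes "smooth f" "bounded_linear L" shows "smooth (\<lambda>x. f (L x + a))"
  using assms(1)
proof induction
  case (smooth_linear l)
  then have "smooth (\<lambda>x. l (L x) + l a)"
    by (intro smooth.intros bounded_linear_compose[OF _ assms(2)])
  moreover have "l (L x + a) = l (L x) + l a" for x
    using smooth_linear by (simp add: linear_simps)
  ultimately show ?case by simp
qed (auto intro: smooth.intros)

lemma smooth_derivative:
  assumes "smooth f"
  shows "\<exists>f'. (\<forall>x. (f has_derivative f' x) (at x)) \<and> (\<forall>h. smooth (\<lambda>x. f' x h))"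
  using assms
proof induction
  case (smooth_const c)
  show ?case by (intro exI[of _ "\<lambda>x h. 0"]) (auto intro: smooth.intros)
next
  case (smooth_linear l)
  then show ?case
    by (intro exI[of _ "\<lambda>x. l"]) (auto intro: smooth.intros bounded_linear_imp_has_derivative)
next
  case (smooth_add f g)
  then obtain f' g' where "\<forall>x. (f has_derivative f' x) (at x)" "\<forall>h. smooth (\<lambda>x. f' x h)"
    "\<forall>x. (g has_derivative g' x) (at x)" "\<forall>h. smooth (\<lambda>x. g' x h)" by blast
  then show ?case
    by (intro exI[of _ "\<lambda>x h. f' x h + g' x h"])
      (simp add: smooth.smooth_add has_derivative_add)
next
  case (smooth_mult f g)
  then obtain f' g' where "\<forall>x. (f has_derivative f' x) (at x)" "\<forall>h. smooth (\<lambda>x. f' x h)"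
    "\<forall>x. (g has_derivative g' x) (at x)" "\<forall>h. smooth (\<lambda>x. g' x h)" by blast
  with smooth_mult.hyps show ?case
    by (intro exI[of _ "\<lambda>x h. f x * g' x h + f' x h * g x"])
      (simp add: smooth.smooth_add smooth.smooth_mult has_derivative_mult)
next
  case (smooth_flat f n)
  then obtain f' where f': "\<forall>x. (f has_derivative f' x) (at x)" "\<forall>h. smooth (\<lambda>x. f' x h)" by blast
  have "((\<lambda>x. flat n (f x)) has_derivative
      (\<lambda>h. f' x h * (flat (n + 2) (f x) - real n * flat (n + 1) (f x)))) (at x)" for x
    using f' by (intro DERIV_compose_FDERIV flat_deriv) auto
  with f' smooth_flat.hyps show ?case
    by (intro exI[of _ "\<lambda>x h. f' x h * (flat (n + 2) (f x) - real n * flat (n + 1) (f x))"])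
      (auto intro!: smooth.smooth_mult smooth_diff smooth.smooth_flat smooth.smooth_const)
next
  case (smooth_sin f)
  then obtain f' where f': "\<forall>x. (f has_derivative f' x) (at x)" "\<forall>h. smooth (\<lambda>x. f' x h)" by blast
  \<comment> \<open>The cosine is written as a shifted sine, so that the derivative stays inside the
    inductive class.\<close>
  have "((\<lambda>x. sin (f x)) has_derivative (\<lambda>h. f' x h * sin (f x + pi / 2))) (at x)" for x
    using f' by (auto intro!: derivative_eq_intros simp: sin_add)
  with f' smooth_sin.hyps show ?case
    by (intro exI[of _ "\<lambda>x h. f' x h * sin (f x + pi / 2)"])
      (simp add: smooth.smooth_add smooth.smooth_mult smooth.smooth_sin smooth.smooth_const)
qed

lemma smooth_continuous: "smooth f \<Longrightarrow> continuous_on UNIV f"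
  by (meson smooth_derivative has_derivative_at_withinI has_derivative_continuous_on)

lemma smooth_Ck_on: "smooth f \<Longrightarrow> Ck_on k UNIV f"
proof (induction k arbitrary: f)
  case (Suc k)
  then show ?case using smooth_derivative[OF Suc.prems] by (simp, blast)
qed (simp add: smooth_continuous)

lemma smooth_real_derivative:
  assumes "smooth (f :: real \<Rightarrow> real)"
  obtains f' where "\<And>x. (f has_real_derivative f' x) (at x)" "smooth f'"
proof -
  obtain f' where f': "\<forall>x. (f has_derivative f' x) (at x)" "\<forall>h. smooth (\<lambda>x. f' x h)"
    using smooth_derivative[OF assms] by blast
  have "(f has_real_derivative f' x 1) (at x)" for x
  proof -
    have "f' x h = f' x 1 * h" for h
      using f'(1) has_derivative_bounded_linear[of f "f' x" "at x"]
        linear_simps(5)[of "f' x" h 1] by (simp add: mult.commute)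
    then have "f' x = (\<lambda>h. f' x 1 * h)" by blast
    with f'(1) show ?thesis unfolding has_field_derivative_def by metis
  qed
  moreover have "smooth (\<lambda>x. f' x 1)" using f'(2) by blast
  ultimately show ?thesis by (rule that)
qed


section \<open>Integrals of periodic functions\<close>

definition fundamental :: "'a::euclidean_space set \<Rightarrow> 'a set \<Rightarrow> bool" where
  "fundamental P C \<longleftrightarrow> C \<in> sets borel \<and> (\<forall>x. \<exists>!k. k \<in> P \<and> x + k \<in> C)"

text \<open>Exactly one translate of each point lies in \<open>C2\<close>, so the integral over
  \<open>C1\<close> may be multiplied by the sum over \<open>k\<close> of the indicators of
  \<open>C2\<close> at \<open>x + k\<close>. Exchanging sum and integral, translating by
  \<open>k\<close> and using the periodicity of \<open>g\<close> leaves the sum of the indicators of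
  \<open>C1\<close> at \<open>x - k\<close>, which is again 1.\<close>

lemma nn_integral_fundamental:
  fixes g :: "'a::euclidean_space \<Rightarrow> ennreal"
  assumes P: "countable P" "\<And>k. k \<in> P \<Longrightarrow> - k \<in> P"
    and C: "fundamental P C1" "fundamental P C2"
    and g: "g \<in> borel_measurable borel" "\<And>x k. k \<in> P \<Longrightarrow> g (x + k) = g x"
  shows "(\<integral>\<^sup>+x\<in>C1. g x \<partial>lborel) = (\<integral>\<^sup>+x\<in>C2. g x \<partial>lborel)"
proof -
  have C': "C1 \<in> sets borel" "C2 \<in> sets borel" using C by (auto simp: fundamental_def)
  note [measurable] = g(1) C'
  have one: "(\<integral>\<^sup>+k. indicator C (x + k) \<partial>count_space P) = (1::ennreal)"
    "(\<integral>\<^sup>+k. indicator C (x - k) \<partial>count_space P) = (1::ennreal)" if "fundamental P C" for C x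
  proof -
    have "\<exists>!k. k \<in> P \<and> x + k \<in> C" using \<open>fundamental P C\<close> by (simp add: fundamental_def)
    then obtain k where k: "k \<in> P" "x + k \<in> C" and u: "\<And>k'. k' \<in> P \<and> x + k' \<in> C \<Longrightarrow> k' = k"
      by (elim ex1E) blast
    have iff1: "x + k' \<in> C \<longleftrightarrow> k' = k" if "k' \<in> P" for k'
      using u[of k'] k that by blast
    have iff2: "x - k' \<in> C \<longleftrightarrow> k' = - k" if "k' \<in> P" for k'
      using iff1[of "- k'"] P(2)[OF that] by (auto simp: minus_equation_iff[of k])
    have "(\<integral>\<^sup>+k'. indicator C (x + k') \<partial>count_space P) = (\<integral>\<^sup>+k'. indicator {k} k' \<partial>count_space P)"
      by (intro nn_integral_cong) (simp add: iff1 indicator_def)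
    also have "\<dots> = 1" using k(1) by (subst nn_integral_indicator) (auto simp: emeasure_count_space)
    finally show "(\<integral>\<^sup>+k. indicator C (x + k) \<partial>count_space P) = (1::ennreal)" .
    have "(\<integral>\<^sup>+k'. indicator C (x - k') \<partial>count_space P) = (\<integral>\<^sup>+k'. indicator {- k} k' \<partial>count_space P)"
      by (intro nn_integral_cong) (simp add: iff2 indicator_def)
    also have "\<dots> = 1" using k(1) P(2) by (subst nn_integral_indicator) (auto simp: emeasure_count_space)
    finally show "(\<integral>\<^sup>+k. indicator C (x - k) \<partial>count_space P) = (1::ennreal)" .
  qed
  have "(\<integral>\<^sup>+x\<in>C1. g x \<partial>lborel)
      = (\<integral>\<^sup>+x. (\<integral>\<^sup>+k. g x * indicator C1 x * indicator C2 (x + k) \<partial>count_space P) \<partial>lborel)"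
    by (simp add: nn_integral_cmult one(1)[OF C(2)])
  also have "\<dots> = (\<integral>\<^sup>+k. (\<integral>\<^sup>+x. g x * indicator C1 x * indicator C2 (x + k) \<partial>lborel) \<partial>count_space P)"
    using P(1) by (intro nn_integral_count_space_nn_integral) measurable
  also have "\<dots> = (\<integral>\<^sup>+k. (\<integral>\<^sup>+x. g x * indicator C2 x * indicator C1 (x - k) \<partial>lborel) \<partial>count_space P)"
  proof (rule nn_integral_cong)
    fix k assume "k \<in> space (count_space P)"
    then have k: "k \<in> P" by simp
    have "(\<integral>\<^sup>+x. g x * indicator C2 x * indicator C1 (x - k) \<partial>lborel)
        = (\<integral>\<^sup>+x. g x * indicator C2 x * indicator C1 (x - k) \<partial>distr lborel borel ((+) k))"
      by (simp add: lborel_distr_plus)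
    also have "\<dots> = (\<integral>\<^sup>+x. g (x + k) * indicator C2 (x + k) * indicator C1 x \<partial>lborel)"
      by (subst nn_integral_distr) (auto simp: add.commute)
    finally show "(\<integral>\<^sup>+x. g x * indicator C1 x * indicator C2 (x + k) \<partial>lborel)
        = (\<integral>\<^sup>+x. g x * indicator C2 x * indicator C1 (x - k) \<partial>lborel)"
      using g(2)[OF k] by (simp add: mult_ac)
  qed
  also have "\<dots> = (\<integral>\<^sup>+x. (\<integral>\<^sup>+k. g x * indicator C2 x * indicator C1 (x - k) \<partial>count_space P) \<partial>lborel)"
    using P(1) by (intro nn_integral_count_space_nn_integral[symmetric]) measurable
  also have "\<dots> = (\<integral>\<^sup>+x\<in>C2. g x \<partial>lborel)"
    by (simp add: nn_integral_cmult one(2)[OF C(1)])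
  finally show ?thesis .
qed

lemma integral_fundamental:
  fixes g :: "'a::euclidean_space \<Rightarrow> real"
  assumes P: "countable P" "\<And>k. k \<in> P \<Longrightarrow> - k \<in> P"
    and C: "fundamental P C1" "fundamental P C2"
    and g: "g \<in> borel_measurable borel" "\<And>x k. k \<in> P \<Longrightarrow> g (x + k) = g x"
  shows "(LINT x:C1|lborel. g x) = (LINT x:C2|lborel. g x)"
proof -
  have [measurable]: "C1 \<in> sets borel" "C2 \<in> sets borel" using C by (auto simp: fundamental_def)
  note [measurable] = g(1)
  \<comment> \<open>The values \<open>s = 1\<close> and \<open>s = -1\<close> give the positive and
    the negative part, as \<open>ennreal\<close> sends negative numbers to 0.\<close>
  have nn: "(\<integral>\<^sup>+x. ennreal (s * (indicator C1 x * g x)) \<partial>lborel)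
      = (\<integral>\<^sup>+x. ennreal (s * (indicator C2 x * g x)) \<partial>lborel)" for s :: real
  proof -
    have "(\<integral>\<^sup>+x. ennreal (s * g x) * indicator C1 x \<partial>lborel)
        = (\<integral>\<^sup>+x. ennreal (s * g x) * indicator C2 x \<partial>lborel)"
      by (rule nn_integral_fundamental[OF P C]) (simp_all add: g(2))
    moreover have "ennreal (s * (indicator C x * g x)) = ennreal (s * g x) * indicator C x" for C x
      by (auto split: split_indicator)
    ultimately show ?thesis by simp
  qed
  have nnn: "(\<integral>\<^sup>+x. ennreal (norm (indicator C1 x *\<^sub>R g x)) \<partial>lborel)
      = (\<integral>\<^sup>+x. ennreal (norm (indicator C2 x *\<^sub>R g x)) \<partial>lborel)"
  proof -
    have "(\<integral>\<^sup>+x. ennreal \<bar>g x\<bar> * indicator C1 x \<partial>lborel)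
        = (\<integral>\<^sup>+x. ennreal \<bar>g x\<bar> * indicator C2 x \<partial>lborel)"
      by (rule nn_integral_fundamental[OF P C]) (simp_all add: g(2))
    moreover have "ennreal (norm (indicator C x *\<^sub>R g x)) = ennreal \<bar>g x\<bar> * indicator C x" for C x
      by (auto split: split_indicator)
    ultimately show ?thesis by simp
  qed
  have i: "integrable lborel (\<lambda>x. indicator C1 x *\<^sub>R g x) \<longleftrightarrow> integrable lborel (\<lambda>x. indicator C2 x *\<^sub>R g x)"
    unfolding integrable_iff_bounded nnn by auto
  show ?thesis
  proof (cases "integrable lborel (\<lambda>x. indicator C1 x *\<^sub>R g x)")
    case True
    with i show ?thesis
      using nn[of 1] nn[of "-1"] by (simp add: set_lebesgue_integral_def real_lebesgue_integral_def)
  next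
    \<comment> \<open>Integrability fails on both cells at once, and both integrals take the default
      value 0.\<close>
    case False
    with i show ?thesis by (simp add: set_lebesgue_integral_def not_integrable_integral_eq)
  qed
qed

section \<open>The integer lattice, its period cells, and recentring\<close>

definition lattice :: "(real ^ 'n) set" where
  "lattice = {k. \<forall>i. k $ i \<in> \<int>}"

definition cube :: "real \<Rightarrow> (real ^ 'n) set" where
  "cube \<epsilon> = {y. \<forall>i. \<bar>y $ i\<bar> < \<epsilon>}"

lemma periods_torus: "periods torus = lattice"
  by (simp add: torus_def lattice_def)

lemma countable_lattice: "countable (lattice :: (real ^ 'n) set)"
proof -
  have "lattice \<subseteq> range (\<lambda>f. \<chi> i::'n. real_of_int (f i))"
  proof
    fix k :: "real ^ 'n" assume "k \<in> lattice"
    then have "k = (\<chi> i. real_of_int \<lfloor>k $ i\<rfloor>)"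
      by (auto simp: lattice_def vec_eq_iff of_int_floor)
    then show "k \<in> range (\<lambda>f. \<chi> i::'n. real_of_int (f i))"
      by (rule range_eqI[where x = "\<lambda>i. \<lfloor>k $ i\<rfloor>"])
  qed
  moreover have "countable (range (\<lambda>f. \<chi> i::'n. real_of_int (f i)))"
    by (rule countable_image) simp
  ultimately show ?thesis by (rule countable_subset)
qed

lemma uminus_lattice: "k \<in> lattice \<Longrightarrow> - k \<in> lattice"
  by (simp add: lattice_def)

lemma sets_half_open_box: "{x::real ^ 'n. \<forall>i. c $ i \<le> x $ i \<and> x $ i < d $ i} \<in> sets borel"
proof -
  have "{x::real ^ 'n. \<forall>i. c $ i \<le> x $ i \<and> x $ i < d $ i}
      = (\<Inter>i. {x. c $ i \<le> x $ i} \<inter> {x. x $ i < d $ i})" by auto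
  also have "\<dots> \<in> sets borel"
    by (intro sets.countable_INT'' sets.Int borel_closed borel_open
        closed_halfspace_component_ge_cart open_halfspace_component_lt_cart) auto
  finally show ?thesis .
qed

lemma floor_unique_shift: "k \<in> \<int> \<and> a \<le> x + k \<and> x + k < a + 1 \<longleftrightarrow> k = - of_int \<lfloor>x - a\<rfloor>"
  for x a k :: real
proof
  assume *: "k \<in> \<int> \<and> a \<le> x + k \<and> x + k < a + 1"
  then obtain m where m: "k = of_int m" by (auto elim: Ints_cases)
  have "\<lfloor>x - a\<rfloor> = - m" using * unfolding m by (intro floor_unique) auto
  then show "k = - of_int \<lfloor>x - a\<rfloor>" by (simp add: m)
next
  assume *: "k = - of_int \<lfloor>x - a\<rfloor>"
  show "k \<in> \<int> \<and> a \<le> x + k \<and> x + k < a + 1"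
    unfolding * by (intro conjI) (simp, linarith+)
qed

lemma fundamental_half_open_box:
  fixes c :: "real ^ 'n"
  shows "fundamental lattice {x. \<forall>i. c $ i \<le> x $ i \<and> x $ i < c $ i + 1}"
proof -
  have 1: "k \<in> lattice \<and> x + k \<in> {x. \<forall>i. c $ i \<le> x $ i \<and> x $ i < c $ i + 1}
      \<longleftrightarrow> k = (\<chi> i. - of_int \<lfloor>x $ i - c $ i\<rfloor>)" for x k :: "real ^ 'n"
  proof -
    have "k \<in> lattice \<and> x + k \<in> {x. \<forall>i. c $ i \<le> x $ i \<and> x $ i < c $ i + 1}
        \<longleftrightarrow> (\<forall>i. k $ i \<in> \<int> \<and> c $ i \<le> x $ i + k $ i \<and> x $ i + k $ i < c $ i + 1)"
      by (auto simp: lattice_def)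
    then show ?thesis unfolding floor_unique_shift vec_eq_iff by simp
  qed
  show ?thesis
    unfolding fundamental_def 1 using sets_half_open_box[of c "c + 1"] by auto
qed

lemma fundamental_torus: "fundamental lattice (cell torus)"
  using fundamental_half_open_box[of 0] by (simp add: torus_def)

lemma fundamental_times:
  assumes "fundamental P C"
  shows "fundamental (P \<times> {0}) (C \<times> (UNIV :: 'b::euclidean_space set))"
proof -
  have "C \<times> (UNIV :: 'b set) \<in> sets (borel \<Otimes>\<^sub>M borel)"
    using assms by (intro pair_measureI) (auto simp: fundamental_def)
  then have 1: "C \<times> (UNIV :: 'b set) \<in> sets borel" unfolding borel_prod .
  have "\<exists>!k. k \<in> P \<times> {0} \<and> x + k \<in> C \<times> (UNIV :: 'b set)" for x
  proof -
    have "\<exists>!k. k \<in> P \<and> fst x + k \<in> C" using assms by (auto simp: fundamental_def)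
    then obtain k where k: "k \<in> P" "fst x + k \<in> C" and u: "\<And>k'. k' \<in> P \<and> fst x + k' \<in> C \<Longrightarrow> k' = k"
      by (elim ex1E) blast
    show ?thesis
    proof (rule ex1I[of _ "(k, 0)"])
      fix k' assume "k' \<in> P \<times> {0} \<and> x + k' \<in> C \<times> (UNIV :: 'b set)"
      then show "k' = (k, 0)" using u[of "fst k'"] by (cases k') (simp add: plus_prod_def mem_Times_iff)
    qed (use k in \<open>simp add: plus_prod_def mem_Times_iff\<close>)
  qed
  with 1 show ?thesis by (simp add: fundamental_def)
qed

text \<open>The support of a periodic test function around \<open>c\<close> may straddle the faces
  of the standard cell. Passing to the unit cell centred at \<open>c\<close> avoids this, and since
  \<epsilon> is at most 1/2 the cube around \<open>c\<close> fits into it. On the torus the support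
  condition is asked only in that cell, because elsewhere the periodic copies live. Both domains
  then yield the same integral over a cube.\<close>

lemma integral_cell_recentre:
  fixes g :: "(real ^ 'n) \<times> real \<Rightarrow> real" and c :: "real ^ 'n"
  assumes \<Omega>: "\<Omega> = whole_space \<or> \<Omega> = torus" and \<epsilon>: "\<epsilon> \<le> 1 / 2"
    and g: "g \<in> borel_measurable borel"
    and per: "\<And>x t k. k \<in> periods \<Omega> \<Longrightarrow> g (x + k, t) = g (x, t)"
    and supp: "\<And>y t. y \<notin> cube \<epsilon> \<Longrightarrow> \<Omega> = torus \<Longrightarrow> (\<forall>i. - 1 / 2 \<le> y $ i \<and> y $ i < 1 / 2) \<Longrightarrow> g (c + y, t) = 0"
      "\<And>y t. y \<notin> cube \<epsilon> \<Longrightarrow> \<Omega> = whole_space \<Longrightarrow> g (c + y, t) = 0"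
  shows "(LINT z:cell \<Omega> \<times> UNIV|lborel. g z) = (\<integral>z. indicator (cube \<epsilon>) (fst z) * g (c + fst z, snd z) \<partial>lborel)"
proof -
  have shift: "(\<integral>z. h z \<partial>lborel) = (\<integral>z. h (c + fst z, snd z) \<partial>lborel)"
    if [measurable]: "h \<in> borel_measurable borel" for h :: "(real ^ 'n) \<times> real \<Rightarrow> real"
  proof -
    have "(\<integral>z. h z \<partial>lborel) = (\<integral>z. h z \<partial>distr lborel borel ((+) (c, 0)))"
      by (simp add: lborel_distr_plus)
    also have "\<dots> = (\<integral>z. h ((c, 0) + z) \<partial>lborel)"
      by (rule integral_distr) auto
    finally show ?thesis by (simp add: plus_prod_def)
  qed
  show ?thesis
  proof (cases "\<Omega> = torus")
    case True
    define B where "B = {x. \<forall>i. (c - (\<chi> i. 1 / 2)) $ i \<le> x $ i \<and> x $ i < (c - (\<chi> i. 1 / 2)) $ i + 1}"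
    have B: "fundamental lattice B" unfolding B_def by (rule fundamental_half_open_box)
    have [measurable]: "B \<times> (UNIV :: real set) \<in> sets borel"
      using fundamental_times[OF B, where 'b = real] by (simp add: fundamental_def)
    note [measurable] = g
    have "(LINT z:cell \<Omega> \<times> UNIV|lborel. g z) = (LINT z:B \<times> UNIV|lborel. g z)"
    proof (rule integral_fundamental[of "lattice \<times> {0}"])
      show "countable (lattice \<times> {0 :: real})" using countable_lattice by auto
      show "fundamental (lattice \<times> {0}) (cell \<Omega> \<times> (UNIV :: real set))"
        unfolding True by (rule fundamental_times[OF fundamental_torus])
      show "fundamental (lattice \<times> {0}) (B \<times> (UNIV :: real set))"
        by (rule fundamental_times[OF B])
      show "g (x + k) = g x" if "k \<in> lattice \<times> {0}" for x k
        using per[of "fst k" "fst x" "snd x"] that True by (cases x; cases k) (auto simp: periods_torus plus_prod_def)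
    qed (auto simp: g uminus_lattice)
    also have "\<dots> = (\<integral>z. indicator (B \<times> UNIV) (c + fst z, snd z) *\<^sub>R g (c + fst z, snd z) \<partial>lborel)"
      unfolding set_lebesgue_integral_def by (rule shift) measurable
    also have "\<dots> = (\<integral>z. indicator (cube \<epsilon>) (fst z) * g (c + fst z, snd z) \<partial>lborel)"
    proof (rule Bochner_Integration.integral_cong[OF refl])
      fix z :: "(real ^ 'n) \<times> real"
      have 1: "c + fst z \<in> B \<longleftrightarrow> (\<forall>i. - 1 / 2 \<le> fst z $ i \<and> fst z $ i < 1 / 2)"
      proof -
        have "c $ i - 1 / 2 \<le> c $ i + a \<and> c $ i + a < c $ i - 1 / 2 + 1 \<longleftrightarrow> - 1 / 2 \<le> a \<and> a < 1 / 2" for i a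
          by linarith
        then show ?thesis unfolding B_def by simp
      qed
      show "indicator (B \<times> UNIV) (c + fst z, snd z) *\<^sub>R g (c + fst z, snd z)
          = indicator (cube \<epsilon>) (fst z) * g (c + fst z, snd z)"
      proof (cases "fst z \<in> cube \<epsilon>")
        case True
        have "- 1 / 2 \<le> fst z $ i \<and> fst z $ i < 1 / 2" for i
        proof -
          have "\<bar>fst z $ i\<bar> < \<epsilon>" using True by (simp add: cube_def)
          with \<epsilon> show ?thesis by linarith
        qed
        then have "c + fst z \<in> B" unfolding 1 by blast
        with True show ?thesis by simp
      next
        case False
        have "g (c + fst z, snd z) = 0" if "c + fst z \<in> B"
          using that unfolding 1 by (rule supp(1)[OF False \<open>\<Omega> = torus\<close>])
        with False show ?thesis by (auto split: split_indicator)
      qed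
    qed
    finally show ?thesis .
  next
    case False
    with \<Omega> have w: "\<Omega> = whole_space" by simp
    have "(LINT z:cell \<Omega> \<times> UNIV|lborel. g z) = (\<integral>z. g (c + fst z, snd z) \<partial>lborel)"
      using shift[OF g] by (simp add: w whole_space_def set_lebesgue_integral_def)
    also have "\<dots> = (\<integral>z. indicator (cube \<epsilon>) (fst z) * g (c + fst z, snd z) \<partial>lborel)"
      using supp(2)[OF _ w] by (intro Bochner_Integration.integral_cong refl) (auto split: split_indicator)
    finally show ?thesis .
  qed
qed


section \<open>A mollifier for the whole space and the torus\<close>

text \<open>
  A bump function of \<open>sin (pi * s)\<close> instead of \<open>s\<close> is periodic and smooth without any periodization;
  on a period cell centred at the origin both have their support near the origin.
\<close>

definition wave :: "bool \<Rightarrow> real \<Rightarrow> real" where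
  "wave per s = (if per then sin (pi * s) else s)"

definition wave' :: "bool \<Rightarrow> real \<Rightarrow> real" where
  "wave' per s = (if per then pi * cos (pi * s) else 1)"

text \<open>The classical profile \<open>exp (- 1 / (1 - r\<^sup>2))\<close> for |r| < 1, extended
  by zero, with \<open>r\<close> the quotient of the wave by \<epsilon>. Over an integer shift
  \<open>sin (pi * s)\<close> may change sign; its square does not, so the periodic version has
  period 1. The square also makes the profile even.\<close>

definition bump :: "bool \<Rightarrow> real \<Rightarrow> real \<Rightarrow> real" where
  "bump per \<epsilon> s = flat 0 (1 - (wave per s / \<epsilon>)\<^sup>2)"

definition bump' :: "bool \<Rightarrow> real \<Rightarrow> real \<Rightarrow> real" where
  "bump' per \<epsilon> s = - flat 2 (1 - (wave per s / \<epsilon>)\<^sup>2) * (2 * wave per s * wave' per s / \<epsilon>\<^sup>2)"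

lemma wave_deriv: "(wave per has_real_derivative wave' per s) (at s)"
proof (cases per)
  case True
  then have "wave per = (\<lambda>s. sin (pi * s))" by (simp add: wave_def fun_eq_iff)
  then show ?thesis using True by (auto intro!: derivative_eq_intros simp: wave'_def)
next
  case False
  then have "wave per = (\<lambda>s. s)" by (simp add: wave_def fun_eq_iff)
  then show ?thesis using False by (simp add: wave'_def)
qed

lemma abs_wave'_le: "\<bar>wave' per s\<bar> \<le> pi"
  using pi_ge_two abs_cos_le_one[of "pi * s"] by (auto simp: wave'_def abs_mult)

lemma abs_wave_le: "\<bar>wave per s\<bar> \<le> pi * \<bar>s\<bar>"
  using pi_ge_two abs_sin_x_le_abs_x[of "pi * s"] mult_right_mono[of 1 pi "\<bar>s\<bar>"]
  by (auto simp: wave_def abs_mult)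

text \<open>This places the support of the periodic bump, as seen in a centred period cell, inside
  |s| < \<epsilon>. The crude estimate \<open>x / 2 \<le> sin x\<close> on [0, pi / 2] is enough,
  since pi / 2 is at least 1.\<close>

lemma abs_wave_ge:
  assumes "per \<Longrightarrow> \<bar>s\<bar> \<le> 1 / 2"
  shows "\<bar>s\<bar> \<le> \<bar>wave per s\<bar>"
proof (cases per)
  case True
  have nonneg: "s \<le> sin (pi * s)" if "0 \<le> s" "s \<le> 1 / 2" for s :: real
  proof -
    have "pi * s / 2 \<le> sin (pi * s)"
    proof (cases "s = 0")
      case False
      have "sin x \<ge> x / 2" if "0 \<le> x" "x \<le> pi / 2" for x :: real
      proof -
        have "x * cos x \<le> sin x"
        proof -
          have "((\<lambda>x. sin x - x * cos x) has_real_derivative y * sin y) (at y)" for y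
            by (auto intro!: derivative_eq_intros)
          then have "sin 0 - 0 * cos 0 \<le> sin x - x * cos x"
            using that by (intro DERIV_nonneg_imp_nondecreasing[of 0 x "\<lambda>x. sin x - x * cos x"])
              (auto intro!: exI mult_nonneg_nonneg sin_ge_zero)
          then show ?thesis by simp
        qed
        show ?thesis
        \<comment> \<open>Up to pi / 3 the cosine is at least 1/2. Beyond it, monotonicity gives sin
          x at least sqrt 3 / 2, hence at least 0.85, while x / 2 is at most 0.8.\<close>
        proof (cases "x \<le> pi / 3")
          case True
          then have "cos (pi / 3) \<le> cos x" using that pi_gt_zero by (intro cos_monotone_0_pi_le) auto
          then have "x * (1 / 2) \<le> x * cos x" using that by (intro mult_left_mono) (auto simp: cos_60)
          with \<open>x * cos x \<le> sin x\<close> show ?thesis by simp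
        next
          case False
          then have "sin (pi / 3) \<le> sin x" using that pi_gt_zero by (intro sin_monotone_2pi_le) auto
          moreover have "sqrt 3 \<ge> 1.7" by (rule real_le_rsqrt) (simp add: power2_eq_square)
          moreover have "x \<le> 1.6" using that pi_less_4 pi_approx by (simp add: power2_eq_square)
          ultimately show ?thesis by (simp add: sin_60)
        qed
      qed
      from this[of "pi * s"] that show ?thesis by (simp add: mult_left_le)
    qed simp
    moreover have "s \<le> pi * s / 2" using that pi_ge_two mult_right_mono[of 2 pi s] by simp
    ultimately show ?thesis by linarith
  qed
  show ?thesis
  proof (cases "0 \<le> s")
    case True
    then show ?thesis using nonneg[of s] assms \<open>per\<close> by (simp add: wave_def)
  next
    case False
    then show ?thesis using nonneg[of "- s"] assms \<open>per\<close> by (simp add: wave_def)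
  qed
qed (simp add: wave_def)

lemma bump_deriv:
  assumes "\<epsilon> \<noteq> 0" shows "(bump per \<epsilon> has_real_derivative bump' per \<epsilon> s) (at s)"
proof -
  have 1: "((\<lambda>s. 1 - (wave per s / \<epsilon>)\<^sup>2) has_real_derivative - (2 * wave per s * wave' per s / \<epsilon>\<^sup>2)) (at s)"
    using assms by (auto intro!: derivative_eq_intros wave_deriv simp: power2_eq_square)
  have 2: "(flat 0 has_real_derivative flat 2 (1 - (wave per s / \<epsilon>)\<^sup>2)) (at (1 - (wave per s / \<epsilon>)\<^sup>2))"
    using flat_deriv[of 0] by (simp add: numeral_2_eq_2)
  show ?thesis
    using DERIV_chain2[OF 2 1] unfolding bump_def[abs_def] bump'_def by simp
qed

lemma bump_bounds: "0 \<le> bump per \<epsilon> s" "bump per \<epsilon> s \<le> 1"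
  by (auto simp: bump_def flat_def)

lemma bump_eq_0:
  assumes "0 < \<epsilon>" "\<epsilon> \<le> \<bar>s\<bar>" "per \<Longrightarrow> \<bar>s\<bar> \<le> 1 / 2"
  shows "bump per \<epsilon> s = 0" "bump' per \<epsilon> s = 0"
proof -
  have "\<epsilon> \<le> \<bar>wave per s\<bar>" using abs_wave_ge[of per s] assms by linarith
  then have "1 \<le> \<bar>wave per s / \<epsilon>\<bar>" using assms(1) by (simp add: abs_divide)
  then have "1 \<le> (wave per s / \<epsilon>)\<^sup>2" by (metis one_le_power power2_abs)
  then show "bump per \<epsilon> s = 0" "bump' per \<epsilon> s = 0" by (auto simp: bump_def bump'_def flat_def)
qed

text \<open>The constant is 24 * 2 * pi: on [0, 1] the factor \<open>flat 2\<close> is at most 4! by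
  \<open>flat_bound\<close>, and where the bump is supported the wave is at most \<epsilon> and its
  derivative at most pi. Outside, \<open>flat 2\<close> is evaluated at a nonpositive argument and
  vanishes.\<close>

lemma abs_bump'_le:
  assumes "0 < \<epsilon>" shows "\<bar>bump' per \<epsilon> s\<bar> \<le> 48 * pi / \<epsilon>"
proof (cases "\<bar>wave per s\<bar> \<le> \<epsilon>")
  case True
  define r where "r = 1 - (wave per s / \<epsilon>)\<^sup>2"
  have "\<bar>wave per s / \<epsilon>\<bar> \<le> 1" using True assms by (simp add: abs_divide)
  then have "(wave per s / \<epsilon>)\<^sup>2 \<le> 1" by (simp add: abs_square_le_1)
  then have r: "0 \<le> r" "r \<le> 1" by (auto simp: r_def)
  have "\<bar>flat 2 r\<bar> \<le> 24 * r\<^sup>2" using flat_bound[of 2 r] by (simp add: fact_numeral)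
  also have "\<dots> \<le> 24" using r by (simp add: power_le_one)
  finally have f: "\<bar>flat 2 r\<bar> \<le> 24" .
  have "\<bar>wave per s\<bar> * \<bar>wave' per s\<bar> \<le> \<epsilon> * pi"
    using True abs_wave'_le[of per s] assms by (intro mult_mono) auto
  then have "2 * (\<bar>wave per s\<bar> * \<bar>wave' per s\<bar>) / \<epsilon>\<^sup>2 \<le> 2 * (\<epsilon> * pi) / \<epsilon>\<^sup>2"
    by (intro divide_right_mono mult_left_mono) auto
  also have "\<dots> = 2 * pi / \<epsilon>" using assms by (simp add: power2_eq_square)
  finally have "\<bar>flat 2 r\<bar> * (2 * (\<bar>wave per s\<bar> * \<bar>wave' per s\<bar>) / \<epsilon>\<^sup>2) \<le> 24 * (2 * pi / \<epsilon>)"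
    using f by (intro mult_mono) auto
  then show ?thesis unfolding bump'_def r_def[symmetric] by (simp add: abs_mult mult.assoc)
next
  case False
  then have "1 \<le> \<bar>wave per s / \<epsilon>\<bar>" using assms by (simp add: abs_divide)
  then have "1 \<le> (wave per s / \<epsilon>)\<^sup>2" by (metis one_le_power power2_abs)
  then show ?thesis using assms by (auto simp: bump'_def flat_def)
qed

text \<open>In this range the wave is at most \<epsilon> / 2, so the argument of
  \<open>flat 0\<close> is at least 3/4, and \<open>exp (- (4 / 3))\<close> is the value there. The
  estimate feeds the lower bound on the mass of the kernel.\<close>

lemma bump_ge:
  assumes "0 < \<epsilon>" "\<bar>s\<bar> \<le> \<epsilon> / (2 * pi)" shows "exp (- (4 / 3)) \<le> bump per \<epsilon> s"
proof -
  have "\<bar>wave per s\<bar> \<le> pi * (\<epsilon> / (2 * pi))"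
    using abs_wave_le[of per s] mult_left_mono[OF assms(2), of pi] by simp
  then have "\<bar>wave per s / \<epsilon>\<bar> \<le> 1 / 2" using assms(1) by (simp add: abs_divide field_simps)
  then have "(wave per s / \<epsilon>)\<^sup>2 \<le> (1 / 2)\<^sup>2" by (metis abs_ge_zero power2_abs power_mono)
  then have "3 / 4 \<le> 1 - (wave per s / \<epsilon>)\<^sup>2" by (simp add: power2_eq_square)
  then have "1 / (1 - (wave per s / \<epsilon>)\<^sup>2) \<le> 4 / 3" "0 < 1 - (wave per s / \<epsilon>)\<^sup>2"
    by (auto simp: divide_simps)
  then show ?thesis by (simp add: bump_def flat_def)
qed

lemma bump_periodic: "k \<in> \<int> \<Longrightarrow> bump True \<epsilon> (s + k) = bump True \<epsilon> s"
proof (elim Ints_cases)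
  fix m :: int assume "k = of_int m"
  then have s0: "sin (pi * k) = 0"
    using sin_times_pi_eq_0[of k] by (simp add: mult.commute)
  then have "(cos (pi * k))\<^sup>2 = 1" using sin_cos_squared_add[of "pi * k"] by simp
  then have "(sin (pi * (s + k)))\<^sup>2 = (sin (pi * s))\<^sup>2"
    by (simp add: ring_distribs sin_add power_mult_distrib s0)
  then show ?thesis by (simp add: bump_def wave_def power_divide)
qed

lemma bump_minus: "bump per \<epsilon> (- s) = bump per \<epsilon> s" "bump' per \<epsilon> (- s) = - bump' per \<epsilon> s"
  by (auto simp: bump_def bump'_def wave_def wave'_def)

text \<open>The kernel is deliberately not normalized. In the periodic case its mass has no simple
  dependence on \<epsilon>, so the mass is divided out where the kernel is used and only estimated
  from below.\<close>

definition mollifier :: "bool \<Rightarrow> real \<Rightarrow> real ^ 'n \<Rightarrow> real" where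
  "mollifier per \<epsilon> y = (\<Prod>i\<in>UNIV. bump per \<epsilon> (y $ i))"

definition mollifier' :: "bool \<Rightarrow> real \<Rightarrow> real ^ 'n \<Rightarrow> 'n \<Rightarrow> real" where
  "mollifier' per \<epsilon> y i = bump' per \<epsilon> (y $ i) * (\<Prod>j\<in>UNIV - {i}. bump per \<epsilon> (y $ j))"

lemma smooth_bump:
  assumes "smooth f" shows "smooth (\<lambda>x. bump per \<epsilon> (f x))"
proof -
  have w: "smooth (\<lambda>x. wave per (f x))"
    using assms by (cases per) (auto simp: wave_def intro!: smooth_sin smooth_cmult)
  show ?thesis unfolding bump_def
    by (intro smooth_flat smooth_diff smooth_const smooth_power smooth_divide w)
qed

lemma mollifier_bounds: "0 \<le> mollifier per \<epsilon> y" "mollifier per \<epsilon> y \<le> 1"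
  unfolding mollifier_def by (auto intro!: prod_nonneg prod_le_1 bump_bounds)

lemma mollifier_deriv:
  fixes y :: "real ^ 'n"
  assumes "\<epsilon> \<noteq> 0"
  shows "(mollifier per \<epsilon> has_derivative (\<lambda>e. \<Sum>i\<in>UNIV. e $ i * mollifier' per \<epsilon> y i)) (at y)"
proof -
  have 1: "((\<lambda>y::real^'n. bump per \<epsilon> (y $ i)) has_derivative (\<lambda>e. e $ i * bump' per \<epsilon> (y $ i))) (at y)" for i
    by (intro DERIV_compose_FDERIV bump_deriv assms)
      (auto intro!: bounded_linear_imp_has_derivative bounded_linear_vec_nth)
  have "((\<lambda>y::real^'n. \<Prod>i\<in>UNIV. bump per \<epsilon> (y $ i)) has_derivative
      (\<lambda>e. \<Sum>i\<in>UNIV. (e $ i * bump' per \<epsilon> (y $ i)) * (\<Prod>j\<in>UNIV - {i}. bump per \<epsilon> (y $ j)))) (at y)"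
    by (intro has_derivative_prod 1)
  then show ?thesis unfolding mollifier_def[abs_def] mollifier'_def by (simp add: mult.assoc)
qed

lemma abs_mollifier'_le:
  assumes "0 < \<epsilon>" shows "\<bar>mollifier' per \<epsilon> y i\<bar> \<le> 48 * pi / \<epsilon>"
proof -
  have "\<bar>mollifier' per \<epsilon> y i\<bar> \<le> \<bar>bump' per \<epsilon> (y $ i)\<bar> * 1"
    unfolding mollifier'_def abs_mult
    by (intro mult_left_mono) (auto simp: abs_prod intro!: prod_le_1 bump_bounds, metis abs_of_nonneg bump_bounds)
  with abs_bump'_le[OF assms, of per "y $ i"] show ?thesis by simp
qed

lemma mollifier_eq_0:
  fixes y :: "real ^ 'n"
  assumes "0 < \<epsilon>" "y \<notin> cube \<epsilon>" "per \<Longrightarrow> (\<forall>i. - 1 / 2 \<le> y $ i \<and> y $ i < 1 / 2)"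
  shows "mollifier per \<epsilon> y = 0" "mollifier' per \<epsilon> y i = 0"
proof -
  obtain j where j: "\<epsilon> \<le> \<bar>y $ j\<bar>" using assms(2) by (auto simp: cube_def not_less)
  have "\<bar>y $ j\<bar> \<le> 1 / 2" if per
    using assms(3)[OF that, THEN spec[of _ j]] by linarith
  then have b: "bump per \<epsilon> (y $ j) = 0" "bump' per \<epsilon> (y $ j) = 0"
    using bump_eq_0[OF assms(1) j] by auto
  show "mollifier per \<epsilon> y = 0" unfolding mollifier_def using b by (intro prod_zero) auto
  show "mollifier' per \<epsilon> y i = 0"
  proof (cases "i = j")
    case False
    then have "(\<Prod>j\<in>UNIV - {i}. bump per \<epsilon> (y $ j)) = 0" using b by (intro prod_zero) auto
    then show ?thesis by (simp add: mollifier'_def)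
  qed (simp add: mollifier'_def b)
qed

lemma mollifier'_minus: "mollifier' per \<epsilon> (- y) i = - mollifier' per \<epsilon> y i"
  by (simp add: mollifier'_def bump_minus)

lemma mollifier_periodic: "k \<in> lattice \<Longrightarrow> mollifier True \<epsilon> (y + k) = mollifier True \<epsilon> y"
  by (simp add: mollifier_def lattice_def bump_periodic)

lemma mollifier_measurable [measurable]: "mollifier per \<epsilon> \<in> borel_measurable borel"
proof -
  have "smooth (mollifier per \<epsilon>)" unfolding mollifier_def[abs_def]
    by (intro smooth_prod smooth_bump smooth_linear bounded_linear_vec_nth) auto
  then show ?thesis by (intro borel_measurable_continuous_onI smooth_continuous)
qed

lemma flat_measurable [measurable]: "flat n \<in> borel_measurable borel"
  unfolding flat_def[abs_def] by measurable

lemma mollifier'_measurable [measurable]: "(\<lambda>y. mollifier' per \<epsilon> y i) \<in> borel_measurable borel"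
  unfolding mollifier'_def bump'_def bump_def wave_def wave'_def by measurable

section \<open>Volume of cubes, mass of the kernel, mean of its gradient\<close>

lemma cube_eq_box: "cube r = box (- (r *\<^sub>R One)) (r *\<^sub>R (One :: real ^ 'n))"
proof -
  have "y \<in> cube r \<longleftrightarrow> (\<forall>b\<in>Basis. \<bar>y \<bullet> b\<bar> < r)" for y :: "real ^ 'n"
    by (auto simp: cube_def Basis_vec_def inner_axis)
  then show ?thesis by (auto simp: box_def abs_less_iff inner_sum_left_Basis) (smt (verit) inner_sum_left_Basis)+
qed

lemma cube_measurable [measurable]: "cube r \<in> sets borel"
  by (simp add: cube_eq_box)

lemma emeasure_cube: "0 \<le> r \<Longrightarrow> emeasure lborel (cube r :: (real ^ 'n) set) = ennreal ((2 * r) ^ CARD('n))"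
  unfolding cube_eq_box
proof (subst emeasure_lborel_box)
  have "(\<Prod>b\<in>(Basis :: (real ^ 'n) set). (r *\<^sub>R One - - (r *\<^sub>R One)) \<bullet> b) = (\<Prod>b\<in>(Basis :: (real ^ 'n) set). 2 * r)"
    by (intro prod.cong refl)
      (simp only: inner_diff_left inner_minus_left inner_scaleR_left inner_sum_Basis)
  then show "ennreal (\<Prod>b\<in>(Basis :: (real ^ 'n) set). (r *\<^sub>R One - - (r *\<^sub>R One)) \<bullet> b)
      = ennreal ((2 * r) ^ CARD('n))"
    by (simp only: prod_constant) simp
qed (auto simp: inner_minus_left)

lemma norm_cube_le: "y \<in> cube \<epsilon> \<Longrightarrow> norm y \<le> real CARD('n) * \<epsilon>" for y :: "real ^ 'n"
  using norm_le_l1_cart[of y] sum_bounded_above[of UNIV "\<lambda>i. \<bar>y $ i\<bar>" \<epsilon>]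
  by (auto simp: cube_def less_imp_le)

text \<open>On the concentric cube of half side \<open>\<epsilon> / (2 * pi)\<close>, whose volume
  is the \<open>n\<close>-th power of \<open>\<epsilon> / pi\<close>, every factor of the product is
  at least \<open>exp (- (4 / 3))\<close> by \<open>bump_ge\<close>.\<close>

lemma integral_mollifier_ge:
  assumes "0 < \<epsilon>"
  shows "exp (- (4 / 3)) ^ CARD('n) * (\<epsilon> / pi) ^ CARD('n)
    \<le> (\<integral>y. indicator (cube \<epsilon>) y * mollifier per \<epsilon> (y :: real ^ 'n) \<partial>lborel)"
proof -
  let ?c = "cube (\<epsilon> / (2 * pi)) :: (real ^ 'n) set"
  have fin: "emeasure lborel (cube r :: (real ^ 'n) set) < \<infinity>" if "0 \<le> r" for r
    using that by (simp add: emeasure_cube)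
  have "exp (- (4 / 3)) ^ CARD('n) * (\<epsilon> / pi) ^ CARD('n) = (\<integral>y. indicator ?c y * exp (- (4 / 3)) ^ CARD('n) \<partial>lborel)"
    using assms by (simp add: emeasure_cube measure_def mult.commute)
  also have "\<dots> \<le> (\<integral>y. indicator (cube \<epsilon>) y * mollifier per \<epsilon> (y :: real ^ 'n) \<partial>lborel)"
  proof (rule integral_mono)
    show "integrable lborel (\<lambda>y::real^'n. indicator ?c y * exp (- (4 / 3) :: real) ^ CARD('n))"
      using fin[of "\<epsilon> / (2 * pi)"] assms
      by (intro integrable_mult_left integrable_real_indicator) auto
    have "integrable lborel (indicator (cube \<epsilon>) :: real ^ 'n \<Rightarrow> real)"
      using fin[of \<epsilon>] assms by auto
    then show "integrable lborel (\<lambda>y::real^'n. indicator (cube \<epsilon>) y * mollifier per \<epsilon> y)"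
      by (rule Bochner_Integration.integrable_bound)
        (auto simp: abs_mult mollifier_bounds split: split_indicator)
    fix y :: "real ^ 'n"
    show "indicator ?c y * exp (- (4 / 3)) ^ CARD('n) \<le> indicator (cube \<epsilon>) y * mollifier per \<epsilon> y"
    proof (cases "y \<in> ?c")
      case True
      have "\<epsilon> / (2 * pi) \<le> \<epsilon>" using assms pi_ge_two by (simp add: field_simps)
      with True have "y \<in> cube \<epsilon>" by (auto simp: cube_def intro: less_le_trans)
      moreover have "(\<Prod>i\<in>(UNIV :: 'n set). exp (- (4 / 3))) \<le> mollifier per \<epsilon> y"
        unfolding mollifier_def using True
        by (intro prod_mono conjI bump_ge assms) (auto simp: cube_def less_imp_le)
      ultimately show ?thesis using True by simp
    qed (simp add: mollifier_bounds split: split_indicator)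
  qed
  finally show ?thesis .
qed

text \<open>The integrand is odd and the cube symmetric. Consequently a constant flux contributes
  nothing to the mollified divergence, and only increments of the flux will matter.\<close>

lemma integral_mollifier'_eq_0:
  "(\<integral>y. indicator (cube \<epsilon>) y * mollifier' per \<epsilon> (y :: real ^ 'n) i \<partial>lborel) = 0"
proof -
  let ?f = "\<lambda>y :: real ^ 'n. indicator (cube \<epsilon>) y * mollifier' per \<epsilon> y i"
  have "(\<integral>y. ?f y \<partial>lborel) = (\<integral>y. ?f y \<partial>distr lborel borel (\<lambda>y. 0 + (- 1) *\<^sub>R y))"
    by (subst lborel_affine[of "-1" 0]) (auto simp: density_1 simp del: scaleR_minus1_left)
  also have "\<dots> = (\<integral>y. ?f (- y) \<partial>lborel)"
    by (subst integral_distr) auto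
  also have "\<dots> = - (\<integral>y. ?f y \<partial>lborel)"
    by (simp add: mollifier'_minus cube_def indicator_def flip: Bochner_Integration.integral_minus)
  finally show ?thesis by simp
qed


section \<open>Weak derivatives on an interval\<close>

text \<open>A smooth substitute for the positive part: the rescaled ramp
  \<open>d * r (t / d)\<close> tends to \<open>max 0 t\<close> as \<open>d\<close> tends to 0, with
  slopes bounded uniformly in \<open>d\<close>. Differences of such ramps are smooth stand-ins for
  piecewise linear test functions.\<close>

lemma smooth_ramp_exists:
  obtains r r' :: "real \<Rightarrow> real" and B :: real
  where "smooth r" "\<And>x. (r has_real_derivative r' x) (at x)" "continuous_on UNIV r'"
    "\<And>x. x \<le> 0 \<Longrightarrow> r x = 0" "\<And>x. x \<ge> 1 \<Longrightarrow> r x = x"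
    "\<And>x. x \<le> 0 \<Longrightarrow> r' x = 0" "\<And>x. x > 1 \<Longrightarrow> r' x = 1"
    "\<And>x. \<bar>r' x\<bar> \<le> B" "\<And>x. \<bar>r x\<bar> \<le> B * \<bar>x\<bar>"
proof -
  define c where "c = flat 0 (exp (- 1))"
  \<comment> \<open>A smooth step from 0 to 1. The usual quotient construction would need division
    by a function, which the class lacks, so \<open>flat\<close> is nested instead: for
    \<open>x \<le> 0\<close> the inner value is at least \<open>exp (- 1)\<close> and the outer
    argument is nonpositive; for \<open>x \<ge> 1\<close> the inner value is 0 and \<open>c\<close>
    normalizes the step to 1.\<close>
  define S where "S x = flat 0 (exp (- 1) - flat 0 (1 - x)) / c" for x
  have c: "c > 0" by (simp add: c_def flat_def)
  have S0: "S x = 0" if "x \<le> 0" for x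
  proof -
    have "exp (- 1) \<le> flat 0 (1 - x)" using that by (simp add: flat_def divide_simps)
    then show ?thesis by (simp add: S_def flat_def)
  qed
  have S1: "S x = 1" if "x \<ge> 1" for x
    using that c by (simp add: S_def c_def) (simp add: flat_def)
  define r where "r x = x * S x" for x
  have "smooth S" unfolding S_def[abs_def]
    by (intro smooth_divide smooth_flat smooth_diff smooth_const smooth_linear bounded_linear_ident)
  then have r: "smooth r" unfolding r_def[abs_def]
    by (intro smooth_mult[OF smooth_linear[OF bounded_linear_ident]])
  obtain r' where r': "\<And>x. (r has_real_derivative r' x) (at x)" "smooth r'"
    using smooth_real_derivative[OF r] by blast
  have cont: "continuous_on UNIV r'" by (rule smooth_continuous[OF r'(2)])
  have r0: "r x = 0" if "x \<le> 0" for x using S0[OF that] by (simp add: r_def)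
  have r1: "r x = x" if "x \<ge> 1" for x using S1[OF that] by (simp add: r_def)
  have r'0: "r' x = 0" if "x < 0" for x
  proof -
    have "(r has_real_derivative 0) (at x)"
      by (rule has_field_derivative_transform_within_open[of "\<lambda>x. 0" _ _ "{..<0}"])
        (use that r0 in auto)
    with r'(1) show ?thesis by (metis DERIV_unique)
  qed
  have r'1: "r' x = 1" if "x > 1" for x
  proof -
    have "(r has_real_derivative 1) (at x)"
      by (rule has_field_derivative_transform_within_open[of "\<lambda>x. x" _ _ "{1<..}"])
        (use that r1 in auto)
    with r'(1) show ?thesis by (metis DERIV_unique)
  qed
  have "r' 0 = 0"
  proof -
    have "(r' \<longlongrightarrow> r' 0) (at_left 0)"
      using cont by (meson UNIV_I continuous_on_def tendsto_within_subset subset_UNIV)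
    moreover have "(r' \<longlongrightarrow> 0) (at_left 0)"
      by (rule tendsto_eventually) (simp add: eventually_at_filter r'0)
    ultimately show ?thesis using tendsto_unique trivial_limit_at_left_real by blast
  qed
  with r'0 have r'0: "r' x = 0" if "x \<le> 0" for x using that by (cases "x = 0") auto
  have "compact (r' ` {0..1})"
    by (intro compact_continuous_image continuous_on_subset[OF cont]) auto
  then obtain B0 where B0: "\<And>x. x \<in> {0..1} \<Longrightarrow> \<bar>r' x\<bar> \<le> B0"
    using compact_imp_bounded bounded_iff by (metis imageI real_norm_def)
  \<comment> \<open>\<open>B0\<close> bounds the slope on the unit interval, 1 is the slope beyond
    it, and \<open>1 / c\<close> bounds the step \<open>S\<close>.\<close>
  define B where "B = max (max B0 1) (1 / c)"
  have "\<bar>r' x\<bar> \<le> B" for x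
    using B0[of x] r'0[of x] r'1[of x] by (cases "x \<in> {0..1}") (auto simp: B_def)
  moreover have "\<bar>r x\<bar> \<le> B * \<bar>x\<bar>" for x
  proof -
    have "\<bar>S x\<bar> \<le> 1 / c"
      unfolding S_def abs_divide using c by (intro frac_le) (auto simp: flat_def)
    then have "\<bar>S x\<bar> \<le> B" by (simp add: B_def)
    then have "\<bar>x\<bar> * \<bar>S x\<bar> \<le> \<bar>x\<bar> * B" by (rule mult_left_mono) simp
    then show ?thesis by (simp add: r_def abs_mult mult.commute)
  qed
  ultimately show ?thesis using that r r'(1) cont r0 r1 r'0 r'1 by blast
qed

text \<open>For \<open>h \<le> b - a\<close> this is the cut-off that climbs linearly from 0 to 1
  over [a, a + h], stays 1 up to \<open>b\<close>, and falls back to 0 over [b, b + h]. Written with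
  four positive parts it is the limit of a combination of four rescaled smooth ramps.\<close>

definition trapezoid :: "real \<Rightarrow> real \<Rightarrow> real \<Rightarrow> real \<Rightarrow> real" where
  "trapezoid h a b t = (max 0 (t - a) - max 0 (t - a - h) - max 0 (t - b) + max 0 (t - b - h)) / h"

text \<open>The identity \<open>W' = G\<close> on the open time interval, tested against the class
  \<open>smooth\<close>, whose members multiply with the kernel to admissible space-time test
  functions.\<close>

definition weak_derivative :: "ereal \<Rightarrow> (real \<Rightarrow> real) \<Rightarrow> (real \<Rightarrow> real) \<Rightarrow> bool" where
  "weak_derivative T W G \<longleftrightarrow>
     (\<forall>\<theta> \<theta>' a b. smooth \<theta> \<longrightarrow> (\<forall>t. (\<theta> has_real_derivative \<theta>' t) (at t)) \<longrightarrow> 0 < a \<longrightarrow> ereal b < T \<longrightarrow>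
        (\<forall>t. t \<notin> {a..b} \<longrightarrow> \<theta> t = 0) \<longrightarrow> (\<integral>t. W t * \<theta>' t + G t * \<theta> t \<partial>lborel) = 0)"

text \<open>Each positive part is approximated by a rescaled ramp and the limit taken by dominated
  convergence. A ramp of width \<open>d\<close> agrees with the identity only past \<open>d\<close>,
  so the approximants may live up to \<open>b + h + e\<close>; the strict inequality with
  \<open>T\<close> leaves room for such an \<open>e\<close>.\<close>

lemma weak_derivative_trapezoid:
  fixes W G :: "real \<Rightarrow> real" and T :: ereal
  assumes W [measurable]: "W \<in> borel_measurable borel" and CW: "\<And>t. \<bar>W t\<bar> \<le> C"
    and G [measurable]: "G \<in> borel_measurable borel" and CG: "\<And>t. \<bar>G t\<bar> \<le> C"
    and weak: "weak_derivative T W G"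
    and t: "0 < a" "a < b" "ereal (b + h) < T" and h: "0 < h"
  shows "(\<integral>t. W t * ((indicator {a<..a + h} t - indicator {b<..b + h} t) / h) + G t * trapezoid h a b t \<partial>lborel) = 0"
proof -
  obtain r r' :: "real \<Rightarrow> real" and B where r: "smooth r" "\<And>x. (r has_real_derivative r' x) (at x)"
    "continuous_on UNIV r'" "\<And>x. x \<le> 0 \<Longrightarrow> r x = 0" "\<And>x. x \<ge> 1 \<Longrightarrow> r x = x"
    "\<And>x. x \<le> 0 \<Longrightarrow> r' x = 0" "\<And>x. x > 1 \<Longrightarrow> r' x = 1"
    "\<And>x. \<bar>r' x\<bar> \<le> B" "\<And>x. \<bar>r x\<bar> \<le> B * \<bar>x\<bar>"
    using smooth_ramp_exists by blast
  have B: "B \<ge> 0" using r(8)[of 0] by linarith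
  have C: "C \<ge> 0" using CW[of 0] by linarith
  have [measurable]: "r \<in> borel_measurable borel" "r' \<in> borel_measurable borel"
    using r(1,3) by (auto intro: borel_measurable_continuous_onI smooth_continuous)
  obtain e where e: "e > 0" "ereal (b + h + e) < T"
  proof -
    obtain m where "b + h < m" "ereal m < T" using ereal_dense2[OF t(3)] by auto
    then show ?thesis using that[of "m - (b + h)"] by simp
  qed
  define d where "d n = e / real (Suc n)" for n
  have d: "0 < d n" "d n \<le> e" for n using e by (auto simp: d_def divide_simps)
  have d0: "d \<longlonglongrightarrow> 0" unfolding d_def using LIMSEQ_Suc[OF lim_const_over_n[of e]] by simp
  define R where "R n t = d n * r (t / d n)" for n t
  define R' where "R' n t = r' (t / d n)" for n t
  have R_deriv: "(R n has_real_derivative R' n t) (at t)" for n t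
  proof -
    have "((\<lambda>t. d n * r (t / d n)) has_real_derivative d n * (r' (t / d n) * (1 / d n))) (at t)"
      using d(1)[of n] by (intro DERIV_cmult DERIV_chain2[OF r(2)] DERIV_cdivide DERIV_ident)
    then show ?thesis unfolding R_def[abs_def] R'_def using d[of n] by simp
  qed
  have R_lim: "(\<lambda>n. R n t) \<longlonglongrightarrow> max 0 t" and R'_lim: "(\<lambda>n. R' n t) \<longlonglongrightarrow> indicator {0<..} t" for t
  proof -
    have "\<forall>\<^sub>F n in sequentially. t > 0 \<longrightarrow> d n < t"
      using order_tendstoD(2)[OF d0, of t] by (cases "t > 0") auto
    then have "\<forall>\<^sub>F n in sequentially. R n t = max 0 t \<and> R' n t = indicator {0<..} t"
    proof eventually_elim
      case (elim n)
      show ?case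
      proof (cases "t > 0")
        case True
        then have "t / d n > 1" using elim d[of n] by simp
        then show ?thesis using True r(5,7) d[of n] by (simp add: R_def R'_def)
      next
        case False
        then have "t / d n \<le> 0" using d[of n] by (simp add: divide_nonpos_pos)
        then show ?thesis using False r(4,6) by (simp add: R_def R'_def)
      qed
    qed
    then show "(\<lambda>n. R n t) \<longlonglongrightarrow> max 0 t" "(\<lambda>n. R' n t) \<longlonglongrightarrow> indicator {0<..} t"
      by (auto intro: tendsto_eventually elim: eventually_mono)
  qed
  define X where "X n t = (R n (t - a) - R n (t - (a + h)) - R n (t - b) + R n (t - (b + h))) / h" for n t
  define X' where "X' n t = (R' n (t - a) - R' n (t - (a + h)) - R' n (t - b) + R' n (t - (b + h))) / h" for n t
  have "smooth (\<lambda>t. R n (t - c))" for n c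
  proof -
    have "smooth (\<lambda>t. d n * r (t / d n + - c / d n))"
      by (intro smooth_cmult smooth_compose_linear[OF r(1)] bounded_linear_divide)
    then show ?thesis by (simp add: R_def diff_divide_distrib)
  qed
  then have X_smooth: "smooth (X n)" for n unfolding X_def[abs_def]
    by (intro smooth_divide smooth_diff smooth_add)
  have X_deriv: "(X n has_real_derivative X' n t) (at t)" for n t
  proof -
    have "((\<lambda>t. R n (t - c)) has_real_derivative R' n (t - c)) (at t)" for c
    proof -
      have "((\<lambda>t. t - c) has_real_derivative 1) (at t)" by (auto intro!: derivative_eq_intros)
      from DERIV_chain2[OF R_deriv this] show ?thesis by simp
    qed
    then show ?thesis unfolding X_def[abs_def] X'_def
      by (intro DERIV_cdivide DERIV_add DERIV_diff)
  qed
  have R_small: "R n t = 0 \<and> R' n t = 0" if "t \<le> 0" for n t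
    using that d[of n] r(4,6)[of "t / d n"] by (simp add: R_def R'_def divide_nonpos_pos)
  have R_big: "R n t = t \<and> R' n t = 1" if "t > d n" for n t
    using that d[of n] r(5,7)[of "t / d n"] by (simp add: R_def R'_def)
  have supp: "X n t = 0 \<and> X' n t = 0" if "t \<notin> {a..b + h + e}" for n t
  proof (cases "t < a")
    case True
    then show ?thesis using R_small[of _ n] t h by (simp add: X_def X'_def)
  next
    case False
    with that have "t > b + h + e" by auto
    then show ?thesis using R_big[of n] d[of n] t h by (simp add: X_def X'_def)
  qed
  have z: "(\<integral>t. W t * X' n t + G t * X n t \<partial>lborel) = 0" for n
    using X_smooth X_deriv t(1) e(2) supp
    by (intro weak[unfolded weak_derivative_def, rule_format, of "X n" "X' n" a "b + h + e"]) auto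
  \<comment> \<open>Each approximant and its derivative is a sum of four ramp terms divided by
    \<open>h\<close>; the slopes are at most \<open>B\<close>, and the values at most
    \<open>B\<close> times the largest time in the support.\<close>
  define w where "w t = C * (4 * B / h) + C * (4 * (B * (b + h + e)) / h)" for t :: real
  have "(\<lambda>n. \<integral>t. W t * X' n t + G t * X n t \<partial>lborel)
      \<longlonglongrightarrow> (\<integral>t. W t * ((indicator {a<..a + h} t - indicator {b<..b + h} t) / h) + G t * trapezoid h a b t \<partial>lborel)"
  proof (rule integral_dominated_convergence[where w = "\<lambda>t. indicator {a..b + h + e} t * w t"])
    show "integrable lborel (\<lambda>t. indicator {a..b + h + e} t * w t)"
      unfolding w_def by (intro integrable_mult_left integrable_real_indicator) (auto simp: emeasure_lborel_Icc_eq)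
    show "(\<lambda>t. W t * X' n t + G t * X n t) \<in> borel_measurable lborel" for n
      unfolding X_def X'_def R_def R'_def by measurable
    show "AE t in lborel. (\<lambda>n. W t * X' n t + G t * X n t)
        \<longlonglongrightarrow> W t * ((indicator {a<..a + h} t - indicator {b<..b + h} t) / h) + G t * trapezoid h a b t"
    proof (rule AE_I2)
      fix t
      have 1: "(\<lambda>n. X n t) \<longlonglongrightarrow> trapezoid h a b t"
        unfolding X_def trapezoid_def diff_diff_eq by (intro tendsto_intros R_lim) (use h in auto)
      have "(\<lambda>n. X' n t) \<longlonglongrightarrow> (indicator {0<..} (t - a) - indicator {0<..} (t - (a + h))
          - indicator {0<..} (t - b) + indicator {0<..} (t - (b + h))) / h"
        unfolding X'_def by (intro tendsto_intros R'_lim) (use h in auto)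
      also have "(indicator {0<..} (t - a) - indicator {0<..} (t - (a + h))
          - indicator {0<..} (t - b) + indicator {0<..} (t - (b + h)) :: real)
          = indicator {a<..a + h} t - indicator {b<..b + h} t"
        using h by (auto simp: indicator_def)
      finally show "(\<lambda>n. W t * X' n t + G t * X n t)
        \<longlonglongrightarrow> W t * ((indicator {a<..a + h} t - indicator {b<..b + h} t) / h) + G t * trapezoid h a b t"
        using 1 by (intro tendsto_intros)
    qed
    show "AE t in lborel. norm (W t * X' n t + G t * X n t) \<le> indicator {a..b + h + e} t * w t" for n
    proof (rule AE_I2)
      fix t
      show "norm (W t * X' n t + G t * X n t) \<le> indicator {a..b + h + e} t * w t"
      proof (cases "t \<in> {a..b + h + e}")
        case True
        have RB: "\<bar>R n s\<bar> \<le> B * (b + h + e)" if "s \<le> b + h + e" for s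
        proof (cases "s \<le> 0")
          case True
          then show ?thesis using R_small[of s n] B t h e by simp
        next
          case False
          have "\<bar>R n s\<bar> \<le> d n * (B * \<bar>s / d n\<bar>)"
            unfolding R_def abs_mult using d[of n] mult_left_mono[OF r(9)[of "s / d n"], of "d n"] by simp
          also have "\<dots> = B * s" using d[of n] False by (simp add: abs_divide)
          also have "\<dots> \<le> B * (b + h + e)" using B that by (simp add: mult_left_mono)
          finally show ?thesis .
        qed
        have R'B: "\<bar>R' n s\<bar> \<le> B" for s by (simp add: R'_def r(8))
        have "\<bar>X n t\<bar> \<le> 4 * (B * (b + h + e)) / h"
          unfolding X_def abs_divide using h True t
            RB[of "t - a"] RB[of "t - (a + h)"] RB[of "t - b"] RB[of "t - (b + h)"]
          by (simp add: divide_right_mono)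
        moreover have "\<bar>X' n t\<bar> \<le> 4 * B / h"
          unfolding X'_def abs_divide using h
            R'B[of "t - a"] R'B[of "t - (a + h)"] R'B[of "t - b"] R'B[of "t - (b + h)"]
          by (simp add: divide_right_mono)
        ultimately have "\<bar>W t * X' n t\<bar> \<le> C * (4 * B / h)" "\<bar>G t * X n t\<bar> \<le> C * (4 * (B * (b + h + e)) / h)"
          unfolding abs_mult
          by - (rule mult_mono[OF CW _ C abs_ge_zero] mult_mono[OF CG _ C abs_ge_zero], assumption)+
        then show ?thesis using True by (simp add: w_def)
      qed (simp add: supp)
    qed
  qed (simp add: trapezoid_def)
  then show ?thesis unfolding z by (simp add: LIMSEQ_const_iff)
qed

section \<open>Limit of the trapezoids and increments at Lebesgue points\<close>

lemma trapezoid_bound: "0 < h \<Longrightarrow> \<bar>trapezoid h a b t\<bar> \<le> 1"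
  unfolding trapezoid_def abs_divide by (simp add: divide_simps abs_le_iff max_def)

lemma trapezoid_support: "0 < h \<Longrightarrow> a < b \<Longrightarrow> t \<notin> {a..b + h} \<Longrightarrow> trapezoid h a b t = 0"
  unfolding trapezoid_def by (auto simp: max_def)

lemma trapezoid_tendsto:
  assumes "a < b" "h \<longlonglongrightarrow> 0" "\<And>n. 0 < h n"
  shows "(\<lambda>n. trapezoid (h n) a b t) \<longlonglongrightarrow> indicator {a<..b} t"
proof -
  have "\<forall>\<^sub>F n in sequentially. t > a \<longrightarrow> h n < t - a"
    using order_tendstoD(2)[OF assms(2), of "t - a"] by (cases "t > a") auto
  moreover have "\<forall>\<^sub>F n in sequentially. t > b \<longrightarrow> h n < t - b"
    using order_tendstoD(2)[OF assms(2), of "t - b"] by (cases "t > b") auto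
  ultimately have "\<forall>\<^sub>F n in sequentially. trapezoid (h n) a b t = indicator {a<..b} t"
  proof eventually_elim
    case (elim n)
    then show ?case using assms(1) assms(3)[of n]
      by (auto simp: trapezoid_def indicator_def max_def)
  qed
  then show ?thesis by (rule tendsto_eventually)
qed

text \<open>The averages are one-sided because the edges of a trapezoid lie to the right of
  \<open>a\<close> and of \<open>b\<close>. One exceptional set serves all points and all sequences
  \<open>h\<close>. Half-open and closed intervals differ by a single point.\<close>

lemma Lebesgue_differentiation_real:
  fixes W :: "real \<Rightarrow> real"
  assumes W: "W \<in> borel_measurable borel" and CW: "\<And>t. \<bar>W t\<bar> \<le> C"
  obtains N where "negligible N"
    "\<And>t h. t \<notin> N \<Longrightarrow> h \<longlonglongrightarrow> 0 \<Longrightarrow> (\<And>n. 0 < h n)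
      \<Longrightarrow> (\<lambda>n. \<integral>s. W s * (indicator {t<..t + h n} s / h n) \<partial>lborel) \<longlonglongrightarrow> W t"
proof -
  note [measurable] = W
  have int: "set_integrable lborel {a..b} W" for a b
    unfolding set_integrable_def
  proof (rule Bochner_Integration.integrable_bound)
    show "integrable lborel (\<lambda>t. indicator {a..b} t * C)"
      by (intro integrable_mult_left integrable_real_indicator) (auto simp: emeasure_lborel_Icc_eq)
    show "AE x in lborel. norm (indicator {a..b} x *\<^sub>R W x) \<le> norm (indicator {a..b} x * C)"
      using order_trans[OF CW abs_ge_self] by (simp add: abs_mult indicator_def)
  qed measurable
  have eq: "(\<integral>s. W s * (indicator {t<..t + h} s / h) \<partial>lborel) = integral (cbox t (t + h)) W / h" if "h > 0" for t h
  proof -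
    have "(\<integral>s. W s * (indicator {t<..t + h} s / h) \<partial>lborel) = (\<integral>s. indicator {t..t + h} s *\<^sub>R W s / h \<partial>lborel)"
    proof (rule integral_cong_AE)
      show "AE s in lborel. W s * (indicator {t<..t + h} s / h) = indicator {t..t + h} s *\<^sub>R W s / h"
        using AE_lborel_singleton[of t] by eventually_elim (simp add: indicator_def)
    qed measurable
    also have "\<dots> = integral {t..t + h} W / h"
      using set_borel_integral_eq_integral(2)[OF int, of t "t + h"]
      by (simp add: set_lebesgue_integral_def)
    finally show ?thesis by simp
  qed
  have "W integrable_on cbox a b" for a b
    using set_borel_integral_eq_integral(1)[OF int, of a b] by simp
  then obtain N where N: "negligible N" "\<And>x e. x \<notin> N \<Longrightarrow> 0 < e \<Longrightarrow> \<exists>d>0. \<forall>h. 0 < h \<and> h < d \<longrightarrow>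
      norm (integral (cbox x (x + h *\<^sub>R One)) W /\<^sub>R h ^ DIM(real) - W x) < e"
    using integrable_ccontinuous_explicit by metis
  show ?thesis
  proof (rule that[OF N(1)])
    fix t and h :: "nat \<Rightarrow> real" assume t: "t \<notin> N" and h: "h \<longlonglongrightarrow> 0" "\<And>n. 0 < h n"
    show "(\<lambda>n. \<integral>s. W s * (indicator {t<..t + h n} s / h n) \<partial>lborel) \<longlonglongrightarrow> W t"
    proof (rule tendstoI)
      fix e :: real assume "e > 0"
      then obtain d where d: "d > 0" "\<And>h. 0 < h \<Longrightarrow> h < d \<Longrightarrow> \<bar>integral (cbox t (t + h)) W / h - W t\<bar> < e"
        using N(2)[OF t] by (force simp: divide_inverse_commute)
      from order_tendstoD(2)[OF h(1) d(1)]
      show "\<forall>\<^sub>F n in sequentially. dist (\<integral>s. W s * (indicator {t<..t + h n} s / h n) \<partial>lborel) (W t) < e"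
      proof eventually_elim
        case (elim n)
        from d(2)[OF h(2) elim] show ?case unfolding eq[OF h(2)] dist_real_def .
      qed
    qed
  qed
qed

text \<open>Testing with trapezoids of shrinking edge width turns the derivative of the test
  function into right averages of \<open>W\<close> at \<open>a\<close> and at \<open>b\<close>. Off
  the exceptional set they converge to the values of \<open>W\<close> itself, while the trapezoids
  converge to the indicator of the interval.\<close>

proposition weak_derivative_increment:
  fixes W G :: "real \<Rightarrow> real" and T :: ereal
  assumes W: "W \<in> borel_measurable borel" and CW: "\<And>t. \<bar>W t\<bar> \<le> C"
    and G: "G \<in> borel_measurable borel" and CG: "\<And>t. \<bar>G t\<bar> \<le> C"
    and weak: "weak_derivative T W G"
  obtains N where "negligible N"
    "\<And>a b. a \<notin> N \<Longrightarrow> b \<notin> N \<Longrightarrow> 0 < a \<Longrightarrow> a < b \<Longrightarrow> ereal b < T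
      \<Longrightarrow> W b - W a = (\<integral>t. G t * indicator {a<..b} t \<partial>lborel)"
proof -
  note [measurable] = W G
  obtain N where N: "negligible N"
    "\<And>t h. t \<notin> N \<Longrightarrow> h \<longlonglongrightarrow> 0 \<Longrightarrow> (\<And>n. 0 < h n)
      \<Longrightarrow> (\<lambda>n. \<integral>s. W s * (indicator {t<..t + h n} s / h n) \<partial>lborel) \<longlonglongrightarrow> W t"
    using Lebesgue_differentiation_real[OF W CW] by blast
  show ?thesis
  proof (rule that[OF N(1)])
    fix a b assume ab: "a \<notin> N" "b \<notin> N" "0 < a" "a < b" "ereal b < T"
    obtain e where e: "e > 0" "ereal (b + e) < T"
    proof -
      obtain m where "b < m" "ereal m < T" using ereal_dense2[OF ab(5)] by auto
      then show ?thesis using that[of "m - b"] by simp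
    qed
    define h where "h n = e / real (Suc n)" for n
    have h: "0 < h n" "h n \<le> e" for n using e by (auto simp: h_def divide_simps)
    have h0: "h \<longlonglongrightarrow> 0" unfolding h_def using LIMSEQ_Suc[OF lim_const_over_n[of e]] by simp
    have int: "integrable lborel (\<lambda>s. W s * (indicator {t<..t + h n} s / h n))" for t n
    proof (rule Bochner_Integration.integrable_bound)
      show "integrable lborel (\<lambda>s. indicator {t<..t + h n} s * (C / h n))"
        using h(1)[of n] by (intro integrable_mult_left integrable_real_indicator) auto
      have "0 \<le> C" using CW[of 0] by linarith
      then show "AE s in lborel. norm (W s * (indicator {t<..t + h n} s / h n)) \<le> norm (indicator {t<..t + h n} s * (C / h n))"
        using CW h(1)[of n] by (auto simp: abs_mult divide_right_mono split: split_indicator)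
    qed measurable
    have intG: "integrable lborel (\<lambda>s. G s * trapezoid (h n) a b s)" for n
    proof (rule Bochner_Integration.integrable_bound)
      show "integrable lborel (\<lambda>s. indicator {a..b + h n} s * C)"
        by (intro integrable_mult_left integrable_real_indicator) (auto simp: emeasure_lborel_Icc_eq)
      have "\<bar>G s\<bar> * \<bar>trapezoid (h n) a b s\<bar> \<le> \<bar>C\<bar> * 1" for s
        using CG[of s] trapezoid_bound[OF h(1)] by (intro mult_mono) auto
      then show "AE s in lborel. norm (G s * trapezoid (h n) a b s) \<le> norm (indicator {a..b + h n} s * C)"
        using trapezoid_support[OF h(1)[of n] ab(4)]
        by (auto simp: abs_mult split: split_indicator)
    qed (simp add: trapezoid_def)
    have "(\<integral>s. W s * (indicator {a<..a + h n} s / h n) \<partial>lborel) - (\<integral>s. W s * (indicator {b<..b + h n} s / h n) \<partial>lborel)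
        + (\<integral>s. G s * trapezoid (h n) a b s \<partial>lborel) = 0" for n
    proof -
      have "ereal (b + h n) < T" using e(2) h(2)[of n] by (meson add_left_mono ereal_less_eq(3) order.strict_trans1)
      from weak_derivative_trapezoid[OF W CW G CG weak ab(3,4) this h(1)]
      have "(\<integral>t. W t * ((indicator {a<..a + h n} t - indicator {b<..b + h n} t) / h n) + G t * trapezoid (h n) a b t \<partial>lborel) = 0" .
      also have "(\<lambda>t. W t * ((indicator {a<..a + h n} t - indicator {b<..b + h n} t) / h n) + G t * trapezoid (h n) a b t)
          = (\<lambda>t. W t * (indicator {a<..a + h n} t / h n) - W t * (indicator {b<..b + h n} t / h n) + G t * trapezoid (h n) a b t)"
        by (auto simp: fun_eq_iff diff_divide_distrib right_diff_distrib)
      finally show ?thesis using int intG by simp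
    qed
    moreover have "(\<lambda>n. \<integral>s. G s * trapezoid (h n) a b s \<partial>lborel) \<longlonglongrightarrow> (\<integral>s. G s * indicator {a<..b} s \<partial>lborel)"
    proof (rule integral_dominated_convergence[where w = "\<lambda>s. indicator {a..b + e} s * C"])
      show "integrable lborel (\<lambda>s. indicator {a..b + e} s * C)"
        by (intro integrable_mult_left integrable_real_indicator) (auto simp: emeasure_lborel_Icc_eq)
      show "AE s in lborel. (\<lambda>n. G s * trapezoid (h n) a b s) \<longlonglongrightarrow> G s * indicator {a<..b} s"
        using trapezoid_tendsto[OF ab(4) h0 h(1)] by (auto intro!: tendsto_intros)
      have "\<bar>G s\<bar> * \<bar>trapezoid (h n) a b s\<bar> \<le> C * 1" for s n
        using CG[of s] trapezoid_bound[OF h(1)] by (intro mult_mono) auto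
      then show "AE s in lborel. norm (G s * trapezoid (h n) a b s) \<le> indicator {a..b + e} s * C" for n
        using trapezoid_support[OF h(1)[of n] ab(4)] h(2)[of n]
        by (auto simp: abs_mult split: split_indicator)
    qed (auto simp: trapezoid_def)
    ultimately have "W a - W b + (\<integral>s. G s * indicator {a<..b} s \<partial>lborel) = 0"
      using N(2)[OF ab(1) h0 h(1)] N(2)[OF ab(2) h0 h(1)]
      by (intro LIMSEQ_unique[OF tendsto_add[OF tendsto_diff]]) auto
    then show "W b - W a = (\<integral>t. G t * indicator {a<..b} t \<partial>lborel)" by simp
  qed
qed


section \<open>Averages and mollification\<close>

lemma integrable_indicator_bounded:
  fixes f :: "'a::euclidean_space \<Rightarrow> real"
  assumes [measurable]: "S \<in> sets borel" "f \<in> borel_measurable borel"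
    and "emeasure lborel S < \<infinity>" "\<And>y. \<bar>f y\<bar> \<le> C"
  shows "integrable lborel (\<lambda>y. indicator S y * f y)"
proof (rule Bochner_Integration.integrable_bound)
  show "integrable lborel (\<lambda>y. indicator S y * C)"
    using assms(3) by (intro integrable_mult_left integrable_real_indicator) auto
  show "AE y in lborel. norm (indicator S y * f y) \<le> norm (indicator S y * C)"
    using order_trans[OF assms(4) abs_ge_self] by (simp add: abs_mult indicator_def)
qed measurable

text \<open>Jensen for the power \<open>q\<close>, without normalizing the measure: the graph of the
  power lies above its tangent at the mean \<open>c\<close>, and the linear term disappears on
  integration over \<open>S\<close>.\<close>

lemma powr_mean_le:
  fixes f :: "'a::euclidean_space \<Rightarrow> real"
  assumes q: "1 \<le> q" and S [measurable]: "S \<in> sets borel" and f [measurable]: "f \<in> borel_measurable borel"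
    and fin: "emeasure lborel S < \<infinity>" and f0: "\<And>y. 0 \<le> f y" and fC: "\<And>y. f y \<le> C"
  shows "ennreal ((\<integral>y. indicator S y * f y \<partial>lborel) powr q)
    \<le> ennreal (measure lborel S powr (q - 1)) * (\<integral>\<^sup>+y\<in>S. ennreal (f y powr q) \<partial>lborel)"
proof -
  let ?\<mu> = "measure lborel S" and ?I = "\<integral>y. indicator S y * f y \<partial>lborel"
  have int: "integrable lborel (\<lambda>y. indicator S y * f y)"
    using f0 fC by (intro integrable_indicator_bounded fin) auto
  have "f y powr q \<le> C powr q" for y using f0 fC q by (intro powr_mono2) auto
  then have intq: "integrable lborel (\<lambda>y. indicator S y * f y powr q)"
    by (intro integrable_indicator_bounded[where C = "C powr q"] fin) auto
  have int1: "integrable lborel (indicator S :: 'a \<Rightarrow> real)" using fin by auto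
  have I0: "0 \<le> ?I" using f0 by (intro integral_nonneg_AE) auto
  have eq: "(\<integral>\<^sup>+y\<in>S. ennreal (f y powr q) \<partial>lborel) = ennreal (\<integral>y. indicator S y * f y powr q \<partial>lborel)"
    by (subst nn_integral_eq_integral[OF intq, symmetric])
      (auto intro!: nn_integral_cong split: split_indicator)
  have "?I powr q \<le> ?\<mu> powr (q - 1) * (\<integral>y. indicator S y * f y powr q \<partial>lborel)"
  proof (cases "?I = 0")
    case True
    have "0 \<le> (\<integral>y. indicator S y * f y powr q \<partial>lborel)" by (intro integral_nonneg_AE) auto
    with True show ?thesis by simp
  next
    case False
    with I0 have I: "0 < ?I" by simp
    have "?\<mu> \<noteq> 0"
    proof
      assume "?\<mu> = 0"
      then have "AE y in lborel. y \<notin> S"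
        using fin by (intro AE_not_in) (auto simp: measure_def null_sets_def enn2real_eq_0_iff)
      then have "AE y in lborel. indicator S y * f y = 0" by eventually_elim simp
      then have "?I = 0" by (rule integral_eq_zero_AE)
      with False show False by simp
    qed
    then have \<mu>: "0 < ?\<mu>" by (simp add: zero_less_measure_iff)
    define c where "c = ?I / ?\<mu>"
    have c: "0 < c" using I \<mu> by (simp add: c_def)
    have tangent: "c powr q + q * c powr (q - 1) * (s - c) \<le> s powr q" if "0 \<le> s" for s
    \<comment> \<open>The point 0 lies outside the open half-line on which the tangent inequality is
      taken. There the left side is \<open>- ((q - 1) * c powr q)\<close>, and
      \<open>1 \<le> q\<close> decides.\<close>
    proof (cases "s = 0")
      case True
      have "c powr (q - 1) * c = c powr q" using c by (simp add: powr_diff)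
      then have "c powr q + q * c powr (q - 1) * (s - c) = - ((q - 1) * c powr q)"
        using True by (simp add: algebra_simps)
      moreover have "0 \<le> (q - 1) * c powr q" using q by simp
      ultimately show ?thesis using True by simp
    next
      case False
      with that have s: "0 < s" by simp
      have "((\<lambda>x. x powr q) has_real_derivative q * c powr (q - 1)) (at c within {0<..})"
        by (rule has_field_derivative_at_within[OF has_real_derivative_powr[OF c]])
      then have "s powr q - c powr q \<ge> q * c powr (q - 1) * (s - c)"
        using s c
        by (intro convex_on_imp_above_tangent[OF powr_convex[OF q], where c = c])
          (simp_all add: interior_open connected_Ioi)
      then show ?thesis by simp
    qed
    have "(\<integral>y. (c powr q - q * c powr (q - 1) * c) * indicator S y + q * c powr (q - 1) * (indicator S y * f y) \<partial>lborel)
        \<le> (\<integral>y. indicator S y * f y powr q \<partial>lborel)"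
    proof (rule integral_mono)
      show "(c powr q - q * c powr (q - 1) * c) * indicator S y + q * c powr (q - 1) * (indicator S y * f y)
          \<le> indicator S y * f y powr q" for y
        using tangent[OF f0[of y]] by (auto simp: algebra_simps split: split_indicator)
    qed (intro Bochner_Integration.integrable_add integrable_mult_right int int1 intq)+
    also have "(\<integral>y. (c powr q - q * c powr (q - 1) * c) * indicator S y + q * c powr (q - 1) * (indicator S y * f y) \<partial>lborel)
        = (c powr q - q * c powr (q - 1) * c) * ?\<mu> + q * c powr (q - 1) * ?I"
      using int int1 by simp
    also have "\<dots> = c powr q * ?\<mu>"
      using \<mu> by (simp add: c_def algebra_simps)
    finally have *: "c powr q * ?\<mu> \<le> (\<integral>y. indicator S y * f y powr q \<partial>lborel)" .
    have "?I powr q = ?\<mu> powr (q - 1) * (c powr q * ?\<mu>)"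
      using I \<mu> by (simp add: c_def powr_divide powr_diff)
    also have "\<dots> \<le> ?\<mu> powr (q - 1) * (\<integral>y. indicator S y * f y powr q \<partial>lborel)"
      by (intro mult_left_mono *) simp
    finally show ?thesis .
  qed
  then show ?thesis unfolding eq by (simp add: ennreal_mult[symmetric])
qed

text \<open>As \<open>N\<close> is the mass of the kernel, the value at \<open>x\<close> can be
  moved under the integral. What remains is a weighted integral of increments, and the weight lies
  between 0 and 1.\<close>

lemma mollified_close:
  fixes g :: "real ^ 'n \<Rightarrow> real"
  assumes \<epsilon>: "0 < \<epsilon>" and [measurable]: "g \<in> borel_measurable borel" and C: "\<And>y. \<bar>g y\<bar> \<le> C"
    and N_def: "N = (\<integral>y. indicator (cube \<epsilon>) y * mollifier per \<epsilon> (y :: real ^ 'n) \<partial>lborel)"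
  shows "\<bar>g x - (\<integral>y. indicator (cube \<epsilon>) y * (mollifier per \<epsilon> y * g (x + y)) \<partial>lborel) / N\<bar>
    \<le> (\<integral>y. indicator (cube \<epsilon>) y * \<bar>g (x + y) - g x\<bar> \<partial>lborel) / N"
proof -
  have N: "0 < N"
    unfolding N_def using \<epsilon> by (intro less_le_trans[OF _ integral_mollifier_ge]) auto
  have fin: "emeasure lborel (cube \<epsilon> :: (real ^ 'n) set) < \<infinity>" using \<epsilon> by (simp add: emeasure_cube)
  have m: "\<bar>mollifier per \<epsilon> y\<bar> \<le> 1" for y :: "real ^ 'n" using mollifier_bounds[of per \<epsilon> y] by simp
  have i0: "integrable lborel (\<lambda>y::real^'n. indicator (cube \<epsilon>) y * mollifier per \<epsilon> y)"
    by (rule integrable_indicator_bounded[where C = 1]) (use fin m in auto)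
  have i1: "integrable lborel (\<lambda>y. indicator (cube \<epsilon>) y * (mollifier per \<epsilon> y * g (x + y)))"
  proof (rule integrable_indicator_bounded[where C = "1 * C"])
    show "\<bar>mollifier per \<epsilon> y * g (x + y)\<bar> \<le> 1 * C" for y
      unfolding abs_mult by (intro mult_mono m C) auto
  qed (use fin in auto)
  have i2: "integrable lborel (\<lambda>y. indicator (cube \<epsilon>) y * \<bar>g (x + y) - g x\<bar>)"
  proof (rule integrable_indicator_bounded[where C = "C + C"])
    show "\<bar>\<bar>g (x + y) - g x\<bar>\<bar> \<le> C + C" for y
      using C[of x] C[of "x + y"] by linarith
  qed (use fin in auto)
  have i3: "integrable lborel (\<lambda>y. indicator (cube \<epsilon>) y * (mollifier per \<epsilon> y * (g (x + y) - g x)))"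
    using Bochner_Integration.integrable_diff[OF i1 integrable_mult_left[OF i0, of "g x"]]
    by (simp add: algebra_simps)
  have "g x * N - (\<integral>y. indicator (cube \<epsilon>) y * (mollifier per \<epsilon> y * g (x + y)) \<partial>lborel)
      = - (\<integral>y. indicator (cube \<epsilon>) y * (mollifier per \<epsilon> y * g (x + y)) - indicator (cube \<epsilon>) y * mollifier per \<epsilon> y * g x \<partial>lborel)"
    using i0 i1 by (simp add: N_def)
  also have "\<dots> = - (\<integral>y. indicator (cube \<epsilon>) y * (mollifier per \<epsilon> y * (g (x + y) - g x)) \<partial>lborel)"
    by (simp add: algebra_simps)
  finally have "\<bar>g x * N - (\<integral>y. indicator (cube \<epsilon>) y * (mollifier per \<epsilon> y * g (x + y)) \<partial>lborel)\<bar>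
      \<le> (\<integral>y. \<bar>indicator (cube \<epsilon>) y * (mollifier per \<epsilon> y * (g (x + y) - g x))\<bar> \<partial>lborel)"
    by simp
  also have "\<dots> \<le> (\<integral>y. indicator (cube \<epsilon>) y * \<bar>g (x + y) - g x\<bar> \<partial>lborel)"
  proof (rule integral_mono)
    show "\<bar>indicator (cube \<epsilon>) y * (mollifier per \<epsilon> y * (g (x + y) - g x))\<bar> \<le> indicator (cube \<epsilon>) y * \<bar>g (x + y) - g x\<bar>" for y
      using mult_right_mono[OF m[of y], of "\<bar>g (x + y) - g x\<bar>"] by (simp add: abs_mult indicator_def)
  qed (use i2 i3 in auto)
  finally have "\<bar>g x * N - (\<integral>y. indicator (cube \<epsilon>) y * (mollifier per \<epsilon> y * g (x + y)) \<partial>lborel)\<bar> / N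
      \<le> (\<integral>y. indicator (cube \<epsilon>) y * \<bar>g (x + y) - g x\<bar> \<partial>lborel) / N"
    using N by (simp add: divide_right_mono)
  moreover have "g x - J / N = (g x * N - J) / N" for J using N by (simp add: field_simps)
  ultimately show ?thesis using N by (simp add: abs_divide)
qed

text \<open>The derivatives of the kernel have mean zero, so \<open>g x\<close> may be subtracted
  under the integral. The mollified divergence is thereby bounded by increments of the flux at the
  price of one factor \<open>1 / \<epsilon>\<close>, summed over the coordinates.\<close>

lemma mollified_divergence:
  fixes g :: "real ^ 'n \<Rightarrow> real ^ 'n"
  assumes \<epsilon>: "0 < \<epsilon>" and [measurable]: "g \<in> borel_measurable borel" and C: "\<And>y. norm (g y) \<le> C"
  shows "\<bar>\<integral>y. indicator (cube \<epsilon>) y * (\<Sum>i\<in>UNIV. g (x + y) $ i * mollifier' per \<epsilon> y i) \<partial>lborel\<bar>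
    \<le> real CARD('n) * (48 * pi / \<epsilon>) * (\<integral>y. indicator (cube \<epsilon>) y * norm (g (x + y) - g x) \<partial>lborel)"
proof -
  have fin: "emeasure lborel (cube \<epsilon> :: (real ^ 'n) set) < \<infinity>" using \<epsilon> by (simp add: emeasure_cube)
  have [measurable]: "(\<lambda>y. g y $ i) \<in> borel_measurable borel" for i
    by (rule measurable_compose[of g borel borel]) auto
  note m = abs_mollifier'_le[OF \<epsilon>, of per]
  have K: "0 \<le> 48 * pi / \<epsilon>" using \<epsilon> by simp
  have i0: "integrable lborel (\<lambda>y::real^'n. indicator (cube \<epsilon>) y * mollifier' per \<epsilon> y i)" for i
    by (rule integrable_indicator_bounded[where C = "48 * pi / \<epsilon>"]) (use fin m in auto)
  have i1: "integrable lborel (\<lambda>y. indicator (cube \<epsilon>) y * (g (x + y) $ i * mollifier' per \<epsilon> y i))" for i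
  proof (rule integrable_indicator_bounded[where C = "C * (48 * pi / \<epsilon>)"])
    show "\<bar>g (x + y) $ i * mollifier' per \<epsilon> y i\<bar> \<le> C * (48 * pi / \<epsilon>)" for y
      unfolding abs_mult using order_trans[OF component_le_norm_cart C] order_trans[OF norm_ge_zero C]
      by (intro mult_mono m) auto
  qed (use fin in auto)
  have i2: "integrable lborel (\<lambda>y. indicator (cube \<epsilon>) y * norm (g (x + y) - g x))"
  proof (rule integrable_indicator_bounded[where C = "C + C"])
    show "\<bar>norm (g (x + y) - g x)\<bar> \<le> C + C" for y
      using norm_triangle_ineq4[of "g (x + y)" "g x"] C[of x] C[of "x + y"] by simp
  qed (use fin in auto)
  have i3: "integrable lborel (\<lambda>y. indicator (cube \<epsilon>) y * (\<Sum>i\<in>UNIV. (g (x + y) - g x) $ i * mollifier' per \<epsilon> y i))"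
    using Bochner_Integration.integrable_sum[of UNIV lborel "\<lambda>i y. indicator (cube \<epsilon>) y * (g (x + y) $ i * mollifier' per \<epsilon> y i)
        - indicator (cube \<epsilon>) y * mollifier' per \<epsilon> y i * g x $ i"] i0 i1
    by (simp add: algebra_simps sum_distrib_left sum_subtractf)
  have "(\<integral>y. indicator (cube \<epsilon>) y * (\<Sum>i\<in>UNIV. g (x + y) $ i * mollifier' per \<epsilon> y i) \<partial>lborel)
      = (\<Sum>i\<in>UNIV. \<integral>y. indicator (cube \<epsilon>) y * (g (x + y) $ i * mollifier' per \<epsilon> y i) \<partial>lborel)"
    unfolding sum_distrib_left using i1 by (intro Bochner_Integration.integral_sum) auto
  also have "\<dots> = (\<Sum>i\<in>UNIV. \<integral>y. indicator (cube \<epsilon>) y * (g (x + y) $ i * mollifier' per \<epsilon> y i)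
      - indicator (cube \<epsilon>) y * mollifier' per \<epsilon> y i * g x $ i \<partial>lborel)"
    using i0 i1 by (intro sum.cong refl) (simp add: integral_mollifier'_eq_0)
  also have "\<dots> = (\<integral>y. (\<Sum>i\<in>UNIV. indicator (cube \<epsilon>) y * (g (x + y) $ i * mollifier' per \<epsilon> y i)
      - indicator (cube \<epsilon>) y * mollifier' per \<epsilon> y i * g x $ i) \<partial>lborel)"
    using i0 i1 by (intro Bochner_Integration.integral_sum[symmetric]) auto
  also have "\<dots> = (\<integral>y. indicator (cube \<epsilon>) y * (\<Sum>i\<in>UNIV. (g (x + y) - g x) $ i * mollifier' per \<epsilon> y i) \<partial>lborel)"
    by (simp add: algebra_simps sum_distrib_left sum_subtractf)
  finally have "\<bar>\<integral>y. indicator (cube \<epsilon>) y * (\<Sum>i\<in>UNIV. g (x + y) $ i * mollifier' per \<epsilon> y i) \<partial>lborel\<bar>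
      \<le> (\<integral>y. \<bar>indicator (cube \<epsilon>) y * (\<Sum>i\<in>UNIV. (g (x + y) - g x) $ i * mollifier' per \<epsilon> y i)\<bar> \<partial>lborel)"
    by simp
  also have "\<dots> \<le> (\<integral>y. real CARD('n) * (48 * pi / \<epsilon>) * (indicator (cube \<epsilon>) y * norm (g (x + y) - g x)) \<partial>lborel)"
  proof (rule integral_mono)
    fix y
    have "\<bar>\<Sum>i\<in>UNIV. (g (x + y) - g x) $ i * mollifier' per \<epsilon> y i\<bar>
        \<le> (\<Sum>i\<in>(UNIV :: 'n set). norm (g (x + y) - g x) * (48 * pi / \<epsilon>))"
    proof (rule order_trans[OF sum_abs], rule sum_mono)
      fix i
      show "\<bar>(g (x + y) - g x) $ i * mollifier' per \<epsilon> y i\<bar> \<le> norm (g (x + y) - g x) * (48 * pi / \<epsilon>)"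
        unfolding abs_mult by (intro mult_mono m component_le_norm_cart) auto
    qed
    then show "\<bar>indicator (cube \<epsilon>) y * (\<Sum>i\<in>UNIV. (g (x + y) - g x) $ i * mollifier' per \<epsilon> y i)\<bar>
        \<le> real CARD('n) * (48 * pi / \<epsilon>) * (indicator (cube \<epsilon>) y * norm (g (x + y) - g x))"
      by (simp add: abs_mult indicator_def mult_ac)
  qed (use i2 i3 in auto)
  finally show ?thesis by simp
qed


section \<open>Increments in time\<close>

text \<open>Jensen in \<open>s\<close> and then Tonelli: a bound on the \<open>q\<close>-th power
  integrals that is uniform over the parameters \<open>s\<close> in \<open>S\<close> passes to the
  integral over \<open>S\<close>, at the price of the measure of \<open>S\<close> to the power
  \<open>q\<close>. It is applied with a cube of spatial shifts and with an interval of times as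
  parameter set.\<close>

lemma nn_integral_powr_average:
  fixes g :: "'a::euclidean_space \<Rightarrow> 'b::euclidean_space \<Rightarrow> real"
  assumes q: "1 \<le> q" and A [measurable]: "A \<in> sets borel" and S [measurable]: "S \<in> sets borel"
    and g [measurable]: "(\<lambda>(x, s). g x s) \<in> borel_measurable (borel \<Otimes>\<^sub>M borel)"
    and fin: "emeasure lborel S < \<infinity>" and g0: "\<And>x s. 0 \<le> g x s" and gC: "\<And>x s. g x s \<le> C"
    and D: "0 \<le> D" "\<And>s. s \<in> S \<Longrightarrow> (\<integral>\<^sup>+x\<in>A. ennreal (g x s powr q) \<partial>lborel) \<le> ennreal D"
  shows "(\<integral>\<^sup>+x\<in>A. ennreal ((\<integral>s. indicator S s * g x s \<partial>lborel) powr q) \<partial>lborel)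
    \<le> ennreal (measure lborel S powr q * D)" (is "?L \<le> _")
proof -
  let ?m = "measure lborel S"
  have "(\<integral>\<^sup>+x\<in>A. ennreal ((\<integral>s. indicator S s * g x s \<partial>lborel) powr q) \<partial>lborel)
      \<le> (\<integral>\<^sup>+x\<in>A. ennreal (?m powr (q - 1)) * (\<integral>\<^sup>+s\<in>S. ennreal (g x s powr q) \<partial>lborel) \<partial>lborel)"
  proof (rule nn_integral_mono)
    show "ennreal ((\<integral>s. indicator S s * g x s \<partial>lborel) powr q) * indicator A x
        \<le> ennreal (?m powr (q - 1)) * (\<integral>\<^sup>+s\<in>S. ennreal (g x s powr q) \<partial>lborel) * indicator A x" for x
    proof (rule mult_right_mono)
      show "ennreal ((\<integral>s. indicator S s * g x s \<partial>lborel) powr q)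
          \<le> ennreal (?m powr (q - 1)) * (\<integral>\<^sup>+s\<in>S. ennreal (g x s powr q) \<partial>lborel)"
        by (rule powr_mean_le[OF q S _ fin g0 gC]) measurable
    qed simp
  qed
  also have "\<dots> = ennreal (?m powr (q - 1)) * (\<integral>\<^sup>+x. (\<integral>\<^sup>+s. ennreal (g x s powr q) * indicator S s * indicator A x \<partial>lborel) \<partial>lborel)"
  proof -
    have "(\<integral>\<^sup>+s. ennreal (g x s powr q) * indicator S s * indicator A x \<partial>lborel)
        = (\<integral>\<^sup>+s\<in>S. ennreal (g x s powr q) \<partial>lborel) * indicator A x" for x
      by (rule nn_integral_multc) measurable
    then show ?thesis by (simp add: mult.assoc nn_integral_cmult)
  qed
  finally have 1: "?L \<le> \<dots>" .
  have "(\<integral>\<^sup>+x. (\<integral>\<^sup>+s. ennreal (g x s powr q) * indicator S s * indicator A x \<partial>lborel) \<partial>lborel)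
      = (\<integral>\<^sup>+s. (\<integral>\<^sup>+x. ennreal (g x s powr q) * indicator S s * indicator A x \<partial>lborel) \<partial>lborel)"
    by (rule lborel_pair.Fubini'[symmetric]) (simp add: split_def)
  also have "\<dots> \<le> (\<integral>\<^sup>+s\<in>S. ennreal D \<partial>lborel)"
  proof (rule nn_integral_mono)
    fix s :: 'b
    show "(\<integral>\<^sup>+x. ennreal (g x s powr q) * indicator S s * indicator A x \<partial>lborel) \<le> ennreal D * indicator S s"
      using D(2)[of s] by (cases "s \<in> S") auto
  qed
  also have "\<dots> = ennreal (D * ?m)"
    using fin D by (simp add: nn_integral_cmult_indicator emeasure_eq_ennreal_measure ennreal_mult)
  finally have 2: "(\<integral>\<^sup>+x. (\<integral>\<^sup>+s. ennreal (g x s powr q) * indicator S s * indicator A x \<partial>lborel) \<partial>lborel)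
      \<le> ennreal (D * ?m)" .
  note 1
  also have "ennreal (?m powr (q - 1)) * (\<integral>\<^sup>+x. (\<integral>\<^sup>+s. ennreal (g x s powr q) * indicator S s * indicator A x \<partial>lborel) \<partial>lborel)
      \<le> ennreal (?m powr (q - 1)) * ennreal (D * ?m)"
    by (rule mult_left_mono[OF 2]) simp
  also have "\<dots> = ennreal (?m powr q * D)"
  proof -
    have "?m powr (q - 1) * ?m = ?m powr q"
    proof (cases "?m = 0")
      case False
      then have "0 < ?m" by (simp add: zero_less_measure_iff)
      then show ?thesis by (simp add: powr_diff)
    qed simp
    then show ?thesis using D by (simp add: ennreal_mult[symmetric] mult_ac)
  qed
  finally show ?thesis .
qed

lemma powr_sum3_le:
  fixes a b c q :: real
  assumes "0 \<le> a" "0 \<le> b" "0 \<le> c" "0 \<le> q"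
  shows "(a + b + c) powr q \<le> 3 powr q * (a powr q + b powr q + c powr q)"
proof -
  define m where "m = max a (max b c)"
  have "(a + b + c) powr q \<le> (3 * m) powr q" using assms by (intro powr_mono2) (auto simp: m_def)
  also have "\<dots> = 3 powr q * m powr q" using assms by (simp add: powr_mult m_def)
  also have "m powr q \<le> a powr q + b powr q + c powr q" by (auto simp: m_def max_def)
  finally show ?thesis by simp
qed

text \<open>The factor \<open>3 powr q\<close> comes from splitting the increment into three terms.
  The base \<open>2 * pi * exp (4 / 3)\<close> is, per dimension, the bound on the volume of the
  cube over the mass of the kernel. In the last factor 2 counts the two mollification errors, and
  \<open>n * 48 * pi\<close> is the gradient bound with its \<open>1 / \<epsilon>\<close> cancelled
  by the length of the time interval.\<close>

definition mollifier_const :: "nat \<Rightarrow> real \<Rightarrow> real" where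
  "mollifier_const n q = 3 powr q * ((2 * pi * exp (4 / 3)) ^ n) powr q * (2 + (real n * 48 * pi) powr q)"

lemma abs_integral_indicator_le:
  fixes f :: "'a::euclidean_space \<Rightarrow> real"
  assumes [measurable]: "S \<in> sets borel" "f \<in> borel_measurable borel"
    and "emeasure lborel S < \<infinity>" "\<And>y. \<bar>f y\<bar> \<le> C"
  shows "\<bar>\<integral>y. indicator S y * f y \<partial>lborel\<bar> \<le> measure lborel S * C"
proof -
  have "\<bar>\<integral>y. indicator S y * f y \<partial>lborel\<bar> \<le> (\<integral>y. \<bar>indicator S y * f y\<bar> \<partial>lborel)"
    by simp
  also have "\<dots> \<le> (\<integral>y. indicator S y * C \<partial>lborel)"
  proof (rule integral_mono)
    show "integrable lborel (\<lambda>y. \<bar>indicator S y * f y\<bar>)"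
      using integrable_indicator_bounded[OF assms] by auto
    show "integrable lborel (\<lambda>y. indicator S y * C)"
      using assms(3) by (intro integrable_mult_left integrable_real_indicator) auto
    show "\<bar>indicator S y * f y\<bar> \<le> indicator S y * C" for y
      using assms(4)[of y] by (simp add: indicator_def)
  qed
  also have "\<dots> = measure lborel S * C" using assms(3) by simp
  finally show ?thesis .
qed

lemma AE_notin_negligible: "negligible N \<Longrightarrow> AE t in lborel. t \<notin> N"
  using AE_not_in[of N lebesgue] by (simp add: negligible_iff_null_sets AE_completion_iff)

text \<open>
  The spatial mollification at scale \<open>\<bar>\<tau>\<bar>\<close> trades the time increment over \<open>\<tau>\<close> for the flux:
  the divergence of the mollified flux costs a factor \<open>1 / \<bar>\<tau>\<bar>\<close>, which the length of the time
  interval compensates.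
\<close>

proposition time_increment_le:
  fixes w :: "(real ^ 'n) \<times> real \<Rightarrow> real" and F :: "(real ^ 'n) \<times> real \<Rightarrow> real ^ 'n"
  assumes q: "1 \<le> q" and w [measurable]: "w \<in> borel_measurable borel" and wC: "\<And>z. \<bar>w z\<bar> \<le> C"
    and F [measurable]: "F \<in> borel_measurable borel" and FC: "\<And>z. norm (F z) \<le> C"
    and A [measurable]: "A \<in> sets borel" and \<epsilon>: "0 < \<epsilon>" "\<bar>\<tau>\<bar> = \<epsilon>"
    and weak: "\<And>x. weak_derivative T
        (\<lambda>t. \<integral>y. indicator (cube \<epsilon>) y * (mollifier per \<epsilon> y * w (x + y, t)) \<partial>lborel)
        (\<lambda>t. \<integral>y. indicator (cube \<epsilon>) y * (\<Sum>i\<in>UNIV. F (x + y, t) $ i * mollifier' per \<epsilon> y i) \<partial>lborel)"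
    and D: "0 \<le> D"
      "\<And>t y. y \<in> cube \<epsilon> \<Longrightarrow> (\<integral>\<^sup>+x\<in>A. ennreal (\<bar>w (x + y, t) - w (x, t)\<bar> powr q) \<partial>lborel) \<le> ennreal D"
      "\<And>t y. y \<in> cube \<epsilon> \<Longrightarrow> (\<integral>\<^sup>+x\<in>A. ennreal (norm (F (x + y, t) - F (x, t)) powr q) \<partial>lborel) \<le> ennreal D"
    and ab: "\<epsilon> < a" "a \<le> b" "ereal (b + \<epsilon>) < T"
  shows "(\<integral>\<^sup>+t\<in>{a..b}. (\<integral>\<^sup>+x\<in>A. ennreal (\<bar>w (x, t + \<tau>) - w (x, t)\<bar> powr q) \<partial>lborel) \<partial>lborel)
    \<le> ennreal ((b - a) * mollifier_const CARD('n) q * D)"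
proof -
  let ?n = "CARD('n)"
  have C: "0 \<le> C" using wC[of undefined] by linarith
  have fin: "emeasure lborel (cube \<epsilon> :: (real ^ 'n) set) < \<infinity>" using \<epsilon> by (simp add: emeasure_cube)
  have [measurable]: "(\<lambda>z. F z $ i) \<in> borel_measurable borel" for i
    by (rule measurable_compose[OF F]) auto
  define \<mu> where "\<mu> = measure lborel (cube \<epsilon> :: (real ^ 'n) set)"
  have \<mu>: "\<mu> = (2 * \<epsilon>) ^ ?n" "0 < \<mu>" using \<epsilon> by (auto simp: \<mu>_def measure_def emeasure_cube)
  define N where "N = (\<integral>y. indicator (cube \<epsilon>) y * mollifier per \<epsilon> (y :: real ^ 'n) \<partial>lborel)"
  have N_ge: "exp (- (4 / 3)) ^ ?n * (\<epsilon> / pi) ^ ?n \<le> N"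
    unfolding N_def by (rule integral_mollifier_ge[OF \<epsilon>(1)])
  then have N: "0 < N" using \<epsilon> by (elim less_le_trans[rotated]) auto
  define L where "L = (2 * pi * exp (4 / 3)) ^ ?n"
  \<comment> \<open>Per dimension the factors \<open>2 * pi * exp (4 / 3)\<close>,
    \<open>exp (- (4 / 3))\<close> and \<open>\<epsilon> / pi\<close> multiply to
    \<open>2 * \<epsilon>\<close>, the side of the cube.\<close>
  have "L * (exp (- (4 / 3)) ^ ?n * (\<epsilon> / pi) ^ ?n) = \<mu>"
    unfolding L_def \<mu>(1) power_mult_distrib[symmetric]
    by (rule arg_cong[where f = "\<lambda>x. x ^ ?n"]) (simp add: exp_minus)
  moreover have "0 \<le> L" by (simp add: L_def)
  ultimately have \<mu>N: "\<mu> / N \<le> L" using N mult_left_mono[OF N_ge, of L] by (simp add: divide_le_eq)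
  define \<kappa> where "\<kappa> = real ?n * (48 * pi / \<epsilon>)"
  have \<kappa>: "0 \<le> \<kappa>" using \<epsilon> by (simp add: \<kappa>_def)
  define W where "W x t = (\<integral>y. indicator (cube \<epsilon>) y * (mollifier per \<epsilon> y * w (x + y, t)) \<partial>lborel)" for x t
  define G where "G x t = (\<integral>y. indicator (cube \<epsilon>) y * (\<Sum>i\<in>UNIV. F (x + y, t) $ i * mollifier' per \<epsilon> y i) \<partial>lborel)" for x t
  define P where "P x t = (\<integral>y. indicator (cube \<epsilon>) y * \<bar>w (x + y, t) - w (x, t)\<bar> \<partial>lborel)" for x t
  define Q where "Q x t = (\<integral>y. indicator (cube \<epsilon>) y * norm (F (x + y, t) - F (x, t)) \<partial>lborel)" for x t
  \<comment> \<open>The interval between \<open>t\<close> and \<open>t + \<tau>\<close> in either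
    order, so that both signs of \<tau> are treated together.\<close>
  define I where "I t = {min t (t + \<tau>)<..max t (t + \<tau>)}" for t
  define H where "H x t = (\<integral>s. indicator (I t) s * Q x s \<partial>lborel)" for x t
  have ind_I: "indicator (I t) s = (if min t (t + \<tau>) < s \<and> s \<le> max t (t + \<tau>) then 1 else 0 :: real)" for t s
    by (simp add: I_def indicator_def)
  have P_meas [measurable]: "(\<lambda>(x, t). P x t) \<in> borel_measurable (borel \<Otimes>\<^sub>M borel)"
    unfolding P_def by measurable
  have Q_meas [measurable]: "(\<lambda>(x, t). Q x t) \<in> borel_measurable (borel \<Otimes>\<^sub>M borel)"
    unfolding Q_def by measurable
  have H_meas [measurable]: "(\<lambda>(x, t). H x t) \<in> borel_measurable (borel \<Otimes>\<^sub>M borel)"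
    unfolding H_def ind_I by measurable
  have W_meas [measurable]: "W x \<in> borel_measurable borel" for x unfolding W_def by measurable
  have G_meas [measurable]: "G x \<in> borel_measurable borel" for x unfolding G_def by measurable
  have WC: "\<bar>W x t\<bar> \<le> \<mu> * C" for x t unfolding W_def \<mu>_def
  proof (rule abs_integral_indicator_le)
    have "\<bar>mollifier per \<epsilon> y * w (x + y, t)\<bar> \<le> 1 * C" for y
      unfolding abs_mult using mollifier_bounds[of per \<epsilon> y] by (intro mult_mono wC) auto
    then show "\<bar>mollifier per \<epsilon> y * w (x + y, t)\<bar> \<le> C" for y by simp
  qed (use fin in auto)
  have Fd: "norm (F (x + y, t) - F (x, t)) \<le> 2 * C" for x y t
    using norm_triangle_ineq4[of "F (x + y, t)" "F (x, t)"] FC[of "(x + y, t)"] FC[of "(x, t)"] by linarith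
  have P0: "0 \<le> P x t" and Q0: "0 \<le> Q x t" and H0: "0 \<le> H x t" for x t
    unfolding P_def Q_def H_def by (auto intro!: integral_nonneg_AE)
  have QC: "Q x t \<le> \<mu> * (2 * C)" for x t
  proof -
    have "\<bar>Q x t\<bar> \<le> \<mu> * (2 * C)" unfolding Q_def \<mu>_def
      by (rule abs_integral_indicator_le) (use fin Fd in auto)
    then show ?thesis by linarith
  qed
  have GQ: "\<bar>G x t\<bar> \<le> \<kappa> * Q x t" for x t
    unfolding G_def Q_def \<kappa>_def
    by (rule mollified_divergence[OF \<epsilon>(1), of "\<lambda>x. F (x, t)" C]) (use FC in auto)
  have GC: "\<bar>G x t\<bar> \<le> \<kappa> * (\<mu> * (2 * C))" for x t
    using GQ[of x t] mult_left_mono[OF QC[of x t] \<kappa>] by linarith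
  have finI: "emeasure lborel (I t) < \<infinity>" for t unfolding I_def by simp
  have mI: "measure lborel (I t) = \<epsilon>" for t unfolding I_def using \<epsilon> by simp
  have I_meas [measurable]: "I t \<in> sets borel" for t by (simp add: I_def)
  \<comment> \<open>The exceptional set of times is produced for one \<open>x\<close> at a time;
    nothing is claimed about joint measurability of these sets.\<close>
  have pw: "AE t in lborel. t \<in> {a..b} \<longrightarrow> \<bar>w (x, t + \<tau>) - w (x, t)\<bar> \<le> (P x (t + \<tau>) + P x t + \<kappa> * H x t) / N" for x
  proof -
    let ?B = "max (\<mu> * C) (\<kappa> * (\<mu> * (2 * C)))"
    obtain Z where Z: "negligible Z"
      "\<And>a b. a \<notin> Z \<Longrightarrow> b \<notin> Z \<Longrightarrow> 0 < a \<Longrightarrow> a < b \<Longrightarrow> ereal b < T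
        \<Longrightarrow> W x b - W x a = (\<integral>t. G x t * indicator {a<..b} t \<partial>lborel)"
    proof (rule weak_derivative_increment[of "W x" ?B "G x" T])
      show "weak_derivative T (W x) (G x)" using weak[of x] unfolding W_def[abs_def] G_def[abs_def] .
    qed (use WC GC in \<open>auto simp: le_max_iff_disj\<close>)
    have "AE t in lborel. t \<notin> Z" by (rule AE_notin_negligible[OF Z(1)])
    \<comment> \<open>Both endpoints of the increment must avoid \<open>Z\<close>: removing also the
      translate by \<open>- \<tau>\<close> takes care of \<open>t + \<tau>\<close>.\<close>
    moreover have "AE t in lborel. t \<notin> (+) (- \<tau>) ` Z"
      by (rule AE_notin_negligible[OF negligible_translation[OF Z(1)]])
    ultimately show ?thesis
    proof eventually_elim
      case (elim t)
      have tZ: "t + \<tau> \<notin> Z"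
      proof
        assume "t + \<tau> \<in> Z"
        then have "(- \<tau>) + (t + \<tau>) \<in> (+) (- \<tau>) ` Z" by (rule imageI)
        with elim(2) show False by simp
      qed
      show ?case
      proof
        assume t: "t \<in> {a..b}"
        have "\<bar>W x (t + \<tau>) - W x t\<bar> = \<bar>\<integral>s. G x s * indicator (I t) s \<partial>lborel\<bar>"
        proof (cases "0 < \<tau>")
          case True
          have "ereal (t + \<tau>) < T"
            using t \<epsilon> ab(3) True by (elim order.strict_trans1[rotated]) auto
          then show ?thesis
            using Z(2)[OF elim(1) tZ] t ab True \<epsilon> by (simp add: I_def)
        next
          case False
          then have \<tau>: "\<tau> < 0" using \<epsilon> by (cases "\<tau> = 0") auto
          have "ereal t < T"
            using t \<epsilon> ab(3) by (elim order.strict_trans1[rotated]) auto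
          then have "W x t - W x (t + \<tau>) = (\<integral>s. G x s * indicator (I t) s \<partial>lborel)"
            using Z(2)[OF tZ elim(1)] t ab \<tau> \<epsilon> by (simp add: I_def)
          then show ?thesis by (metis abs_minus_commute)
        qed
        also have "\<dots> \<le> (\<integral>s. \<bar>G x s * indicator (I t) s\<bar> \<partial>lborel)" by simp
        also have "\<dots> \<le> (\<integral>s. \<kappa> * (indicator (I t) s * Q x s) \<partial>lborel)"
        proof (rule integral_mono)
          show "integrable lborel (\<lambda>s. \<bar>G x s * indicator (I t) s\<bar>)"
            using integrable_indicator_bounded[OF I_meas G_meas finI GC] by (simp add: mult.commute)
          have "integrable lborel (\<lambda>s. indicator (I t) s * Q x s)"
            using Q0 QC by (intro integrable_indicator_bounded[where C = "\<mu> * (2 * C)"] finI) auto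
          then show "integrable lborel (\<lambda>s. \<kappa> * (indicator (I t) s * Q x s))" by simp
          show "\<bar>G x s * indicator (I t) s\<bar> \<le> \<kappa> * (indicator (I t) s * Q x s)" for s
            using GQ[of x s] by (simp add: indicator_def)
        qed
        also have "\<dots> = \<kappa> * H x t" by (simp add: H_def)
        finally have 1: "\<bar>W x (t + \<tau>) - W x t\<bar> / N \<le> \<kappa> * H x t / N" using N by (simp add: divide_right_mono)
        have 2: "\<bar>w (x, s) - W x s / N\<bar> \<le> P x s / N" for s
          unfolding W_def P_def
          by (rule mollified_close[OF \<epsilon>(1), of "\<lambda>x. w (x, s)" C]) (use wC N_def in auto)
        have "w (x, t + \<tau>) - w (x, t) = (w (x, t + \<tau>) - W x (t + \<tau>) / N) + (W x (t + \<tau>) - W x t) / N - (w (x, t) - W x t / N)"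
          by (simp add: diff_divide_distrib)
        then have "\<bar>w (x, t + \<tau>) - w (x, t)\<bar> \<le> P x (t + \<tau>) / N + \<bar>W x (t + \<tau>) - W x t\<bar> / N + P x t / N"
          using 2[of "t + \<tau>"] 2[of t] N
            abs_divide[of "W x (t + \<tau>) - W x t" N] by linarith
        also have "\<dots> \<le> (P x (t + \<tau>) + P x t + \<kappa> * H x t) / N"
          using 1 by (simp add: add_divide_distrib)
        finally show "\<bar>w (x, t + \<tau>) - w (x, t)\<bar> \<le> (P x (t + \<tau>) + P x t + \<kappa> * H x t) / N" .
      qed
    qed
  qed
  have nP: "(\<integral>\<^sup>+x\<in>A. ennreal (P x t powr q) \<partial>lborel) \<le> ennreal (\<mu> powr q * D)" for t
    unfolding P_def \<mu>_def
  proof (rule nn_integral_powr_average[OF q A _ _ fin, where C = "2 * C"])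
    show "\<bar>w (x + y, t) - w (x, t)\<bar> \<le> 2 * C" for x y
      using wC[of "(x + y, t)"] wC[of "(x, t)"] by linarith
  qed (use D in auto)
  have nQ: "(\<integral>\<^sup>+x\<in>A. ennreal (Q x t powr q) \<partial>lborel) \<le> ennreal (\<mu> powr q * D)" for t
    unfolding Q_def \<mu>_def
    by (rule nn_integral_powr_average[OF q A _ _ fin, where C = "2 * C"]) (use D Fd in auto)
  \<comment> \<open>Integrating over a time interval of length \<epsilon> gains the factor
    \<open>\<epsilon> powr q\<close>, exactly what the factor \<open>1 / \<epsilon>\<close> inside
    \<kappa> costs.\<close>
  have nH: "(\<integral>\<^sup>+x\<in>A. ennreal (H x t powr q) \<partial>lborel) \<le> ennreal (\<epsilon> powr q * (\<mu> powr q * D))" for t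
    unfolding H_def mI[of t, symmetric]
    by (rule nn_integral_powr_average[OF q A _ _ finI, where C = "\<mu> * (2 * C)"])
      (use D nQ Q0 QC in \<open>auto simp: mI\<close>)
  \<comment> \<open>A jointly measurable majorant of the increment. It has to be measurable in the
    pair, because the order of integration is exchanged once before and once after the pointwise
    bound.\<close>
  define R where "R x t = 3 powr q / N powr q * (P x (t + \<tau>) powr q + P x t powr q + \<kappa> powr q * H x t powr q)" for x t
  have R_meas [measurable]: "(\<lambda>(x, t). R x t) \<in> borel_measurable (borel \<Otimes>\<^sub>M borel)"
    unfolding R_def by measurable
  have R_ge: "((P x (t + \<tau>) + P x t + \<kappa> * H x t) / N) powr q \<le> R x t" for x t
  proof -
    have "((P x (t + \<tau>) + P x t + \<kappa> * H x t) / N) powr q = (P x (t + \<tau>) + P x t + \<kappa> * H x t) powr q / N powr q"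
      by (rule powr_divide)
    also have "\<dots> \<le> 3 powr q * (P x (t + \<tau>) powr q + P x t powr q + (\<kappa> * H x t) powr q) / N powr q"
      using P0 H0 \<kappa> q by (intro divide_right_mono powr_sum3_le) auto
    finally show ?thesis using \<kappa> H0 by (simp add: R_def powr_mult)
  qed
  have nR: "(\<integral>\<^sup>+x\<in>A. ennreal (R x t) \<partial>lborel) \<le> ennreal (mollifier_const ?n q * D)" for t
  proof -
    have "(\<integral>\<^sup>+x\<in>A. ennreal (R x t) \<partial>lborel)
        = ennreal (3 powr q / N powr q) * ((\<integral>\<^sup>+x\<in>A. ennreal (P x (t + \<tau>) powr q) \<partial>lborel) + (\<integral>\<^sup>+x\<in>A. ennreal (P x t powr q) \<partial>lborel)
          + ennreal (\<kappa> powr q) * (\<integral>\<^sup>+x\<in>A. ennreal (H x t powr q) \<partial>lborel))"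
    proof -
      have "ennreal (R x t) * indicator A x = ennreal (3 powr q / N powr q) * (ennreal (P x (t + \<tau>) powr q) * indicator A x
          + ennreal (P x t powr q) * indicator A x + ennreal (\<kappa> powr q) * (ennreal (H x t powr q) * indicator A x))" for x
        unfolding R_def by (subst ennreal_mult) (auto simp: ennreal_mult ennreal_plus indicator_def)
      then show ?thesis by (simp add: nn_integral_cmult nn_integral_add)
    qed
    also have "\<dots> \<le> ennreal (3 powr q / N powr q) * (ennreal (\<mu> powr q * D) + ennreal (\<mu> powr q * D)
        + ennreal (\<kappa> powr q) * ennreal (\<epsilon> powr q * (\<mu> powr q * D)))"
      by (intro mult_left_mono add_mono nP nH) auto
    also have "\<dots> = ennreal (3 powr q / N powr q * (\<mu> powr q * D + \<mu> powr q * D + \<kappa> powr q * (\<epsilon> powr q * (\<mu> powr q * D))))"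
      using D(1) by (simp flip: ennreal_mult ennreal_plus)
    also have "3 powr q / N powr q * (\<mu> powr q * D + \<mu> powr q * D + \<kappa> powr q * (\<epsilon> powr q * (\<mu> powr q * D)))
        = 3 powr q * (\<mu> / N) powr q * (2 + (\<kappa> * \<epsilon>) powr q) * D"
      using N \<mu>(2) \<kappa> \<epsilon> by (simp add: powr_divide powr_mult algebra_simps add_divide_distrib)
    also have "\<kappa> * \<epsilon> = real ?n * 48 * pi" using \<epsilon> by (simp add: \<kappa>_def)
    also have "ennreal (3 powr q * (\<mu> / N) powr q * (2 + (real ?n * 48 * pi) powr q) * D) \<le> ennreal (mollifier_const ?n q * D)"
      unfolding mollifier_const_def L_def[symmetric] using D(1) \<mu>N \<mu>(2) N q
      by (intro ennreal_leI mult_right_mono mult_left_mono powr_mono2) auto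
    finally show ?thesis .
  qed
  have "(\<integral>\<^sup>+t\<in>{a..b}. (\<integral>\<^sup>+x\<in>A. ennreal (\<bar>w (x, t + \<tau>) - w (x, t)\<bar> powr q) \<partial>lborel) \<partial>lborel)
      = (\<integral>\<^sup>+t. (\<integral>\<^sup>+x. ennreal (\<bar>w (x, t + \<tau>) - w (x, t)\<bar> powr q) * indicator A x * indicator {a..b} t \<partial>lborel) \<partial>lborel)"
    by (simp add: nn_integral_multc)
  \<comment> \<open>The null set of bad times depends on \<open>x\<close>, so the time integral has
    to be the inner one while the pointwise bound is applied.\<close>
  also have "\<dots> = (\<integral>\<^sup>+x. (\<integral>\<^sup>+t. ennreal (\<bar>w (x, t + \<tau>) - w (x, t)\<bar> powr q) * indicator A x * indicator {a..b} t \<partial>lborel) \<partial>lborel)"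
    by (rule lborel_pair.Fubini') measurable
  also have "\<dots> \<le> (\<integral>\<^sup>+x. (\<integral>\<^sup>+t. ennreal (R x t) * indicator A x * indicator {a..b} t \<partial>lborel) \<partial>lborel)"
  proof (rule nn_integral_mono, rule nn_integral_mono_AE)
    fix x
    show "AE t in lborel. ennreal (\<bar>w (x, t + \<tau>) - w (x, t)\<bar> powr q) * indicator A x * indicator {a..b} t
        \<le> ennreal (R x t) * indicator A x * indicator {a..b} t"
      using pw[of x]
    proof eventually_elim
      case (elim t)
      show ?case
      proof (cases "t \<in> {a..b}")
        case True
        with elim have "\<bar>w (x, t + \<tau>) - w (x, t)\<bar> powr q \<le> ((P x (t + \<tau>) + P x t + \<kappa> * H x t) / N) powr q"
          using q by (intro powr_mono2) auto
        also note R_ge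
        finally show ?thesis by (intro mult_right_mono ennreal_leI) auto
      qed simp
    qed
  qed
  also have "\<dots> = (\<integral>\<^sup>+t. (\<integral>\<^sup>+x. ennreal (R x t) * indicator A x * indicator {a..b} t \<partial>lborel) \<partial>lborel)"
    by (rule lborel_pair.Fubini'[symmetric]) measurable
  also have "\<dots> \<le> (\<integral>\<^sup>+t. ennreal (mollifier_const ?n q * D) * indicator {a..b} t \<partial>lborel)"
    using nR by (intro nn_integral_mono) (simp add: nn_integral_multc mult_right_mono)
  also have "\<dots> = ennreal ((b - a) * mollifier_const ?n q * D)"
    using ab D by (subst nn_integral_cmult_indicator)
      (auto simp: mollifier_const_def mult_ac simp flip: ennreal_mult)
  finally show ?thesis .
qed


section \<open>Test functions and balance laws\<close>

lemma smooth_mollifier: "smooth (mollifier per \<epsilon> :: real ^ 'n \<Rightarrow> real)"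
  unfolding mollifier_def[abs_def]
  by (intro smooth_prod smooth_bump smooth_linear bounded_linear_vec_nth) auto

lemma whole_space_neq_torus: "(whole_space :: (real ^ 'n) flat_domain) \<noteq> torus"
proof
  assume "(whole_space :: (real ^ 'n) flat_domain) = torus"
  then have "periods (whole_space :: (real ^ 'n) flat_domain) = lattice" by (simp add: periods_torus)
  moreover have "(1 :: real ^ 'n) \<in> lattice" by (simp add: lattice_def)
  moreover have "periods (whole_space :: (real ^ 'n) flat_domain) = {0}" by (simp add: whole_space_def)
  ultimately have "(1 :: real ^ 'n) \<in> {0}" by simp
  then have "(1 :: real ^ 'n) = 0" by (rule singletonD)
  then show False by (simp add: vec_eq_iff)
qed

lemma bounded_cube: "bounded (cube \<epsilon> :: (real ^ 'n) set)"
  using norm_cube_le bounded_iff by blast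

lemma bounded_cell_torus: "bounded (cell (torus :: (real ^ 'n) flat_domain))"
proof -
  have "cell torus \<subseteq> (cube 2 :: (real ^ 'n) set)"
  proof
    fix x :: "real ^ 'n" assume "x \<in> cell torus"
    then have x: "0 \<le> x $ i" "x $ i < 1" for i by (auto simp: torus_def)
    have "\<bar>x $ i\<bar> < 2" for i using x[of i] by linarith
    then show "x \<in> cube 2" by (simp add: cube_def)
  qed
  then show ?thesis using bounded_cube bounded_subset by blast
qed

text \<open>Compactness has two sources. On the torus the trace on the cell is bounded because the
  cell is; in the whole space the kernel itself confines \<open>x\<close> to a cube around
  \<open>x0\<close>. In time the support of \<theta> stays within [a, b] in both cases.\<close>

lemma test_function_product:
  fixes x0 :: "real ^ 'n"
  assumes \<Omega>: "\<Omega> = whole_space \<or> \<Omega> = torus" and \<epsilon>: "0 < \<epsilon>" "\<epsilon> \<le> 1 / 2"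
    and \<theta>: "smooth \<theta>" "0 < a" "ereal b < T" "\<And>t. t \<notin> {a..b} \<Longrightarrow> \<theta> t = 0"
  shows "(\<lambda>z. mollifier (\<Omega> = torus) \<epsilon> (fst z - x0) * \<theta> (snd z)) \<in> test_functions (spacetime \<Omega> T)" (is "?\<phi> \<in> _")
proof -
  have sm: "smooth ?\<phi>"
    using smooth_mult[OF smooth_compose_linear[OF smooth_mollifier bounded_linear_fst, of "\<Omega> = torus" \<epsilon> "- x0"]
        smooth_compose_linear[OF \<theta>(1) bounded_linear_snd, of 0]] by simp
  have per: "?\<phi> (x + k) = ?\<phi> x" if "k \<in> periods (spacetime \<Omega> T)" for x k
  proof (cases "\<Omega> = torus")
    case True
    with that have k: "fst k \<in> lattice" "snd k = 0" by (auto simp: spacetime_def periods_torus)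
    have "mollifier True \<epsilon> (fst x - x0 + fst k) = mollifier True \<epsilon> (fst x - x0)"
      by (rule mollifier_periodic[OF k(1)])
    then show ?thesis using True k(2) by (simp add: algebra_simps)
  next
    case False
    with \<Omega> that have "k = 0" by (auto simp: spacetime_def whole_space_def zero_prod_def)
    then show ?thesis by simp
  qed
  let ?S = "{z. ?\<phi> z \<noteq> 0}"
  have sub: "?S \<subseteq> UNIV \<times> {a..b}"
  proof
    fix z assume "z \<in> ?S"
    then have "snd z \<in> {a..b}" using \<theta>(4)[of "snd z"] by (cases "snd z \<in> {a..b}") simp_all
    then show "z \<in> UNIV \<times> {a..b}" by (simp add: mem_Times_iff)
  qed
  have "open ?S" by (intro open_Collect_neq smooth_continuous[OF sm] continuous_on_const)
  moreover have "periodic_set (periods (spacetime \<Omega> T)) ?S"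
    unfolding periodic_set_def by (intro allI ballI) (simp only: mem_Collect_eq per)
  moreover have "bounded (?S \<inter> cell (spacetime \<Omega> T))"
  proof (cases "\<Omega> = torus")
    case True
    have "?S \<inter> cell (spacetime \<Omega> T) \<subseteq> cell torus \<times> {a..b}"
      using sub by (auto simp: True spacetime_def)
    then show ?thesis
      by (rule bounded_subset[rotated]) (intro bounded_Times bounded_cell_torus bounded_closed_interval)
  next
    case False
    have "z \<in> ((+) x0 ` cube \<epsilon>) \<times> {a..b}" if "?\<phi> z \<noteq> 0" for z
    proof -
      have "fst z - x0 \<in> cube \<epsilon>"
        using mollifier_eq_0(1)[OF \<epsilon>(1), of "fst z - x0" False] that False by auto
      then have "fst z \<in> (+) x0 ` cube \<epsilon>" by (rule rev_image_eqI) simp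
      with sub that show ?thesis by (auto simp: mem_Times_iff)
    qed
    then have "?S \<inter> cell (spacetime \<Omega> T) \<subseteq> ((+) x0 ` cube \<epsilon>) \<times> {a..b}" by blast
    then show ?thesis
      by (rule bounded_subset[rotated]) (intro bounded_Times bounded_translation bounded_cube bounded_closed_interval)
  qed
  moreover have "closure ?S \<subseteq> region (spacetime \<Omega> T)"
  proof -
    have "closure ?S \<subseteq> UNIV \<times> {a..b}" by (intro closure_minimal sub closed_Times) auto
    also have "\<dots> \<subseteq> region (spacetime \<Omega> T)"
    proof -
      have "ereal t < T" if "t \<le> b" for t
        using \<theta>(3) that by (elim order.strict_trans1[rotated]) simp
      then show ?thesis using \<Omega> \<theta>(2) by (auto simp: spacetime_def whole_space_def torus_def)
    qed
    finally show ?thesis .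
  qed
  ultimately have "compactly_in (spacetime \<Omega> T) ?S" by (simp add: compactly_in_def compact_closure)
  then show ?thesis
    unfolding test_functions_def mem_Collect_eq
    by (intro conjI allI ballI smooth_Ck_on[OF sm] per)
qed

lemma cell_measurable:
  assumes "\<Omega> = whole_space \<or> \<Omega> = torus"
  shows "cell \<Omega> \<in> sets borel"
  using assms fundamental_torus by (auto simp: fundamental_def whole_space_def)

text \<open>The test function is the kernel centred at \<open>x0\<close> times \<theta>. Its spatial
  derivative produces \<open>mollifier'\<close>, recentring the cell turns the integral into one
  over a cube around \<open>x0\<close>, and Fubini separates the time variable. The balance law is
  given for \<open>w0\<close> and \<open>F0\<close>; the conclusion concerns their Borel
  versions.\<close>

lemma weak_balance_imp_weak_derivative:
  fixes x0 :: "real ^ 'n" and w w0 :: "(real ^ 'n) \<times> real \<Rightarrow> real" and F F0 :: "(real ^ 'n) \<times> real \<Rightarrow> real ^ 'n"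
  assumes \<Omega>: "\<Omega> = whole_space \<or> \<Omega> = torus" and \<epsilon>: "0 < \<epsilon>" "\<epsilon> \<le> 1 / 2"
    and bal: "weak_balance \<Omega> T w0 F0"
    and ae: "AE z in lebesgue. z \<in> region (spacetime \<Omega> T) \<longrightarrow> w0 z = w z \<and> F0 z = F z"
    and w [measurable]: "w \<in> borel_measurable borel" and wC: "\<And>z. \<bar>w z\<bar> \<le> C"
    and F [measurable]: "F \<in> borel_measurable borel" and FC: "\<And>z. norm (F z) \<le> C"
    and per: "\<And>x t k. k \<in> periods \<Omega> \<Longrightarrow> w (x + k, t) = w (x, t) \<and> F (x + k, t) = F (x, t)"
  shows "weak_derivative T
        (\<lambda>t. \<integral>y. indicator (cube \<epsilon>) y * (mollifier (\<Omega> = torus) \<epsilon> y * w (x0 + y, t)) \<partial>lborel)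
        (\<lambda>t. \<integral>y. indicator (cube \<epsilon>) y * (\<Sum>i\<in>UNIV. F (x0 + y, t) $ i * mollifier' (\<Omega> = torus) \<epsilon> y i) \<partial>lborel)"
  unfolding weak_derivative_def
proof (intro allI impI)
  fix \<theta> \<theta>' :: "real \<Rightarrow> real" and a b :: real
  assume \<theta>: "smooth \<theta>" "\<forall>t. (\<theta> has_real_derivative \<theta>' t) (at t)" "0 < a" "ereal b < T"
    "\<forall>t. t \<notin> {a..b} \<longrightarrow> \<theta> t = 0"
  let ?per = "\<Omega> = torus"
  let ?m = "mollifier ?per \<epsilon> :: real ^ 'n \<Rightarrow> real" and ?m' = "mollifier' ?per \<epsilon> :: real ^ 'n \<Rightarrow> 'n \<Rightarrow> real"
  have C: "0 \<le> C" using wC[of undefined] by linarith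
  have fin: "emeasure lborel (cube \<epsilon> :: (real ^ 'n) set) < \<infinity>" using \<epsilon> by (simp add: emeasure_cube)
  have [measurable]: "(\<lambda>z. F z $ i) \<in> borel_measurable borel" for i
    by (rule measurable_compose[OF F]) auto
  have \<theta>_cont: "continuous_on UNIV \<theta>" by (rule smooth_continuous[OF \<theta>(1)])
  \<comment> \<open>The derivative \<theta>' is given only pointwise; by uniqueness it coincides
    with the smooth derivative and is therefore continuous, which yields measurability and
    bounds.\<close>
  obtain \<theta>'' where "\<And>t. (\<theta> has_real_derivative \<theta>'' t) (at t)" "smooth \<theta>''"
    using smooth_real_derivative[OF \<theta>(1)] by blast
  moreover have "\<theta>'' = \<theta>'" using calculation(1) \<theta>(2) DERIV_unique by blast
  ultimately have \<theta>'_cont: "continuous_on UNIV \<theta>'" using smooth_continuous by blast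
  have [measurable]: "\<theta> \<in> borel_measurable borel" "\<theta>' \<in> borel_measurable borel"
    using \<theta>_cont \<theta>'_cont by (auto intro: borel_measurable_continuous_onI)
  have \<theta>'0: "\<theta>' t = 0" if "t \<notin> {a..b}" for t
  proof -
    have "(\<theta> has_real_derivative 0) (at t)"
      by (rule has_field_derivative_transform_within_open[of "\<lambda>x. 0" _ _ "- {a..b}"])
        (use that \<theta>(5) in auto)
    with \<theta>(2) show ?thesis using DERIV_unique by blast
  qed
  obtain B where B: "\<And>t. \<bar>\<theta> t\<bar> \<le> B" "\<And>t. \<bar>\<theta>' t\<bar> \<le> B" "0 \<le> B"
  proof -
    have "bounded (\<theta> ` {a..b})" "bounded (\<theta>' ` {a..b})"
      using \<theta>_cont \<theta>'_cont
      by (auto intro!: compact_imp_bounded compact_continuous_image intro: continuous_on_subset)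
    then obtain B1 B2 where "\<And>t. t \<in> {a..b} \<Longrightarrow> \<bar>\<theta> t\<bar> \<le> B1" "\<And>t. t \<in> {a..b} \<Longrightarrow> \<bar>\<theta>' t\<bar> \<le> B2"
      unfolding bounded_iff by (metis imageI real_norm_def)
    then have "\<bar>\<theta> t\<bar> \<le> max 0 (max B1 B2)" "\<bar>\<theta>' t\<bar> \<le> max 0 (max B1 B2)" for t
      using \<theta>(5) \<theta>'0[of t] by (cases "t \<in> {a..b}"; force simp: le_max_iff_disj)+
    then show ?thesis using that[of "max 0 (max B1 B2)"] by simp
  qed
  define \<phi> where "\<phi> z = ?m (fst z - x0) * \<theta> (snd z)" for z
  have test: "\<phi> \<in> test_functions (spacetime \<Omega> T)" unfolding \<phi>_def[abs_def]
    by (rule test_function_product[OF \<Omega> \<epsilon> \<theta>(1,3,4)]) (use \<theta>(5) in auto)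
  have fd: "frechet_derivative \<phi> (at z) e = ?m (fst z - x0) * (\<theta>' (snd z) * snd e)
      + (\<Sum>i\<in>UNIV. fst e $ i * ?m' (fst z - x0) i) * \<theta> (snd z)" for z e
  proof -
    have "((\<lambda>z. fst z - x0) has_derivative fst) (at z)"
      by (auto intro!: derivative_eq_intros)
    from has_derivative_compose[OF this mollifier_deriv] \<epsilon>
    have 1: "((\<lambda>z. ?m (fst z - x0)) has_derivative (\<lambda>e. \<Sum>i\<in>UNIV. fst e $ i * ?m' (fst z - x0) i)) (at z)"
      by auto
    have 2: "((\<lambda>z. \<theta> (snd z)) has_derivative (\<lambda>e. \<theta>' (snd z) * snd e)) (at z)"
      by (rule has_derivative_compose[OF bounded_linear_imp_has_derivative[OF bounded_linear_snd]
          \<theta>(2)[rule_format, unfolded has_field_derivative_def]])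
    have "frechet_derivative \<phi> (at z) = (\<lambda>e. ?m (fst z - x0) * (\<theta>' (snd z) * snd e)
        + (\<Sum>i\<in>UNIV. fst e $ i * ?m' (fst z - x0) i) * \<theta> (snd z))"
      unfolding \<phi>_def[abs_def]
      by (rule frechet_derivative_at[symmetric]) (rule has_derivative_mult[OF 1 2])
    then show ?thesis by simp
  qed
  define g where "g z = w z * (?m (fst z - x0) * \<theta>' (snd z))
      + (\<Sum>i\<in>UNIV. F z $ i * ?m' (fst z - x0) i) * \<theta> (snd z)" for z
  have [measurable]: "(\<lambda>z. ?m' (fst z - x0) i) \<in> borel_measurable borel" for i
    by (rule measurable_compose[OF _ mollifier'_measurable])
      (intro borel_measurable_continuous_onI continuous_intros)
  have [measurable]: "(\<lambda>z. ?m (fst z - x0)) \<in> borel_measurable borel"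
    by (rule measurable_compose[OF _ mollifier_measurable])
      (intro borel_measurable_continuous_onI continuous_intros)
  have [measurable]: "(\<lambda>z :: (real ^ 'n) \<times> real. \<theta> (snd z)) \<in> borel_measurable borel"
    "(\<lambda>z :: (real ^ 'n) \<times> real. \<theta>' (snd z)) \<in> borel_measurable borel"
    by (intro borel_measurable_continuous_onI continuous_on_compose2[OF \<theta>_cont] continuous_on_compose2[OF \<theta>'_cont]
        continuous_intros; simp)+
  have g_meas [measurable]: "g \<in> borel_measurable borel" unfolding g_def[abs_def]
    by (intro borel_measurable_add borel_measurable_times borel_measurable_sum; measurable)
  have g0: "g z = 0" if "snd z \<notin> {a..b}" for z using that \<theta>(5) \<theta>'0 by (simp add: g_def)
  have cell [measurable]: "cell \<Omega> \<times> (UNIV :: real set) \<in> sets borel"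
    using pair_measureI[OF cell_measurable[OF \<Omega>], of "UNIV :: real set" borel] unfolding borel_prod by simp
  have reg: "z \<in> region (spacetime \<Omega> T)" if "snd z \<in> {a..b}" for z :: "(real ^ 'n) \<times> real"
  proof -
    have "ereal (snd z) < T" using \<theta>(4) that by (elim order.strict_trans1[rotated]) simp
    then show ?thesis using \<Omega> \<theta>(3) that
      by (cases z) (auto simp: spacetime_def whole_space_def torus_def)
  qed
  define h where "h z = w0 z * frechet_derivative \<phi> (at z) (0, 1) + frechet_derivative \<phi> (at z) (F0 z, 0)" for z
  \<comment> \<open>This carries the vanishing integral from the given, merely Lebesgue measurable
    data to the Borel integrand \<open>g\<close>. Outside the region both sides are zero, since the
    support of \<theta> lies within the time interval.\<close>
  have ae': "AE z in lebesgue. indicator (cell \<Omega> \<times> UNIV) z *\<^sub>R g z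
      = indicator (region (spacetime \<Omega> T) \<inter> cell (spacetime \<Omega> T)) z *\<^sub>R h z"
    using ae
  proof eventually_elim
    case (elim z)
    show ?case
    proof (cases "z \<in> region (spacetime \<Omega> T)")
      case True
      then show ?thesis using elim
        by (simp add: spacetime_def indicator_def g_def h_def fd)
    next
      case False
      then have "snd z \<notin> {a..b}" using reg by blast
      then show ?thesis using False g0 by (simp add: indicator_def)
    qed
  qed
  have gm: "(\<lambda>z. indicator (cell \<Omega> \<times> UNIV) z *\<^sub>R g z) \<in> borel_measurable lborel" by measurable
  have "(LINT z:cell \<Omega> \<times> UNIV|lborel. g z) = (\<integral>z. indicator (cell \<Omega> \<times> UNIV) z *\<^sub>R g z \<partial>lebesgue)"
    unfolding set_lebesgue_integral_def by (rule integral_completion[OF gm, symmetric])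
  also have "\<dots> = (\<integral>z. indicator (region (spacetime \<Omega> T) \<inter> cell (spacetime \<Omega> T)) z *\<^sub>R h z \<partial>lebesgue)"
    by (intro integral_cong_AE ae' borel_measurable_AE[OF _ ae'] measurable_completion gm)
  also have "\<dots> = 0"
    using bal test unfolding weak_balance_def set_lebesgue_integral_def h_def by blast
  finally have "(LINT z:cell \<Omega> \<times> UNIV|lborel. g z) = 0" .
  moreover have "(LINT z:cell \<Omega> \<times> UNIV|lborel. g z)
      = (\<integral>z. indicator (cube \<epsilon>) (fst z) * g (x0 + fst z, snd z) \<partial>lborel)"
  proof (rule integral_cell_recentre[OF \<Omega> \<epsilon>(2) g_meas])
    show "g (x + k, t) = g (x, t)" if "k \<in> periods \<Omega>" for x t k
    proof -
      have "?m (x + k - x0) = ?m (x - x0) \<and> ?m' (x + k - x0) i = ?m' (x - x0) i" for i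
      proof (cases "\<Omega> = torus")
        case True
        with that have k: "k \<in> lattice" by (simp add: periods_torus)
        \<comment> \<open>The period of the derivative is read off from that of \<open>bump\<close>
          through uniqueness of derivatives.\<close>
        have "bump' True \<epsilon> (s + r) = bump' True \<epsilon> s" if "r \<in> \<int>" for s r
        proof -
          have "((\<lambda>s. bump True \<epsilon> (s + r)) has_real_derivative bump' True \<epsilon> (s + r)) (at s)"
            using bump_deriv[of \<epsilon> True "s + r"] \<epsilon> by (simp add: DERIV_shift)
          then have "(bump True \<epsilon> has_real_derivative bump' True \<epsilon> (s + r)) (at s)"
            using bump_periodic[OF that] by simp
          then show ?thesis using bump_deriv[of \<epsilon> True s] \<epsilon> DERIV_unique by blast
        qed
        then have "mollifier' True \<epsilon> (x - x0 + k) i = mollifier' True \<epsilon> (x - x0) i"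
          using k by (simp add: mollifier'_def lattice_def bump_periodic)
        with mollifier_periodic[OF k, of \<epsilon> "x - x0"] True show ?thesis by (simp add: algebra_simps)
      next
        case False
        with \<Omega> that show ?thesis by (simp add: whole_space_def)
      qed
      then show ?thesis using per[OF that, of x t] by (simp add: g_def)
    qed
  next
    fix y :: "real ^ 'n" and t assume y: "y \<notin> cube \<epsilon>" "\<Omega> = torus" "\<forall>i. - 1 / 2 \<le> y $ i \<and> y $ i < 1 / 2"
    show "g (x0 + y, t) = 0"
      using mollifier_eq_0[OF \<epsilon>(1) y(1), of ?per] y(3) by (simp add: g_def)
  next
    fix y :: "real ^ 'n" and t assume y: "y \<notin> cube \<epsilon>" "\<Omega> = whole_space"
    then have "\<not> ?per" using whole_space_neq_torus by simp
    then show "g (x0 + y, t) = 0"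
      using mollifier_eq_0[OF \<epsilon>(1) y(1), of ?per] by (simp add: g_def)
  qed
  ultimately have z: "(\<integral>z. indicator (cube \<epsilon>) (fst z) * g (x0 + fst z, snd z) \<partial>lborel) = 0" by simp
  \<comment> \<open>A uniform bound on \<open>g\<close>: together with the support in the cube times
    [a, b] it gives the integrability that Fubini asks for.\<close>
  let ?K = "C * B + real CARD('n) * (C * (48 * pi / \<epsilon>)) * B"
  have gb: "\<bar>g z\<bar> \<le> ?K" for z
  proof -
    have "\<bar>w z * (?m (fst z - x0) * \<theta>' (snd z))\<bar> \<le> C * (1 * B)"
      unfolding abs_mult using mollifier_bounds[of ?per \<epsilon> "fst z - x0"] C
      by (intro mult_mono wC B) auto
    moreover have "\<bar>\<Sum>i\<in>UNIV. F z $ i * ?m' (fst z - x0) i\<bar> \<le> (\<Sum>i\<in>(UNIV :: 'n set). C * (48 * pi / \<epsilon>))"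
    proof (rule order_trans[OF sum_abs], rule sum_mono)
      show "\<bar>F z $ i * ?m' (fst z - x0) i\<bar> \<le> C * (48 * pi / \<epsilon>)" for i
        unfolding abs_mult using order_trans[OF component_le_norm_cart FC] C
        by (intro mult_mono abs_mollifier'_le \<epsilon>) auto
    qed
    then have "\<bar>(\<Sum>i\<in>UNIV. F z $ i * ?m' (fst z - x0) i) * \<theta> (snd z)\<bar> \<le> real CARD('n) * (C * (48 * pi / \<epsilon>)) * B"
      unfolding abs_mult using C \<epsilon> by (intro mult_mono B) auto
    ultimately show ?thesis unfolding g_def by linarith
  qed
  have gx: "(\<lambda>z. g (x0 + fst z, snd z)) \<in> borel_measurable borel"
    by (rule measurable_compose[OF _ g_meas]) (intro borel_measurable_continuous_onI continuous_intros)
  have "integrable lborel (\<lambda>z. indicator (cube \<epsilon> \<times> {a..b}) z * g (x0 + fst z, snd z))"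
  proof (rule integrable_indicator_bounded[where C = ?K])
    show "cube \<epsilon> \<times> {a..b} \<in> sets (borel :: ((real ^ 'n) \<times> real) measure)"
      using pair_measureI[of "cube \<epsilon> :: (real ^ 'n) set" borel "{a..b}" borel] unfolding borel_prod by simp
    show "emeasure lborel (cube \<epsilon> \<times> {a..b} :: ((real ^ 'n) \<times> real) set) < \<infinity>"
      by (intro emeasure_bounded_finite bounded_Times bounded_cube bounded_closed_interval)
  qed (use gb gx in auto)
  also have "(\<lambda>z. indicator (cube \<epsilon> \<times> {a..b}) z * g (x0 + fst z, snd z))
      = (\<lambda>(y, t). indicator (cube \<epsilon>) y * g (x0 + y, t))"
  proof
    fix z
    show "indicator (cube \<epsilon> \<times> {a..b}) z * g (x0 + fst z, snd z) = (case z of (y, t) \<Rightarrow> indicator (cube \<epsilon>) y * g (x0 + y, t))"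
      using g0[of "(x0 + fst z, snd z)"]
      by (cases "snd z \<in> {a..b}") (auto simp: split_def indicator_def mem_Times_iff)
  qed
  finally have int: "integrable (lborel \<Otimes>\<^sub>M lborel) (\<lambda>(y, t). indicator (cube \<epsilon>) y * g (x0 + y, t))"
    by (simp add: lborel_prod)
  have "(\<integral>t. (\<integral>y. indicator (cube \<epsilon>) y * g (x0 + y, t) \<partial>lborel) \<partial>lborel) = 0"
    using lborel_pair.integral_snd[OF int] z by (simp add: lborel_prod split_def)
  moreover have "(\<integral>y. indicator (cube \<epsilon>) y * g (x0 + y, t) \<partial>lborel)
      = (\<integral>y. indicator (cube \<epsilon>) y * (?m y * w (x0 + y, t)) \<partial>lborel) * \<theta>' t
      + (\<integral>y. indicator (cube \<epsilon>) y * (\<Sum>i\<in>UNIV. F (x0 + y, t) $ i * ?m' y i) \<partial>lborel) * \<theta> t" for t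
  proof -
    have i1: "integrable lborel (\<lambda>y. indicator (cube \<epsilon>) y * (?m y * w (x0 + y, t)))"
    proof (rule integrable_indicator_bounded[where C = "1 * C"])
      show "\<bar>?m y * w (x0 + y, t)\<bar> \<le> 1 * C" for y
        unfolding abs_mult using mollifier_bounds[of ?per \<epsilon> y] by (intro mult_mono wC) auto
    qed (use fin in auto)
    have i2: "integrable lborel (\<lambda>y. indicator (cube \<epsilon>) y * (\<Sum>i\<in>UNIV. F (x0 + y, t) $ i * ?m' y i))"
    proof (rule integrable_indicator_bounded[where C = "\<Sum>i\<in>(UNIV :: 'n set). C * (48 * pi / \<epsilon>)"])
      show "\<bar>\<Sum>i\<in>UNIV. F (x0 + y, t) $ i * ?m' y i\<bar> \<le> (\<Sum>i\<in>(UNIV :: 'n set). C * (48 * pi / \<epsilon>))" for y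
      proof (rule order_trans[OF sum_abs], rule sum_mono)
        show "\<bar>F (x0 + y, t) $ i * ?m' y i\<bar> \<le> C * (48 * pi / \<epsilon>)" for i
          unfolding abs_mult using order_trans[OF component_le_norm_cart FC] C
          by (intro mult_mono abs_mollifier'_le \<epsilon>) auto
      qed
    qed (use fin in auto)
    have "(\<integral>y. indicator (cube \<epsilon>) y * g (x0 + y, t) \<partial>lborel)
        = (\<integral>y. indicator (cube \<epsilon>) y * (?m y * w (x0 + y, t)) * \<theta>' t
          + indicator (cube \<epsilon>) y * (\<Sum>i\<in>UNIV. F (x0 + y, t) $ i * ?m' y i) * \<theta> t \<partial>lborel)"
      by (intro Bochner_Integration.integral_cong refl) (simp add: g_def algebra_simps)
    also have "\<dots> = (\<integral>y. indicator (cube \<epsilon>) y * (?m y * w (x0 + y, t)) \<partial>lborel) * \<theta>' t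
      + (\<integral>y. indicator (cube \<epsilon>) y * (\<Sum>i\<in>UNIV. F (x0 + y, t) $ i * ?m' y i) \<partial>lborel) * \<theta> t"
      using i1 i2 by (subst Bochner_Integration.integral_add) auto
    finally show ?thesis .
  qed
  ultimately show "(\<integral>t. (\<integral>y. indicator (cube \<epsilon>) y * (?m y * w (x0 + y, t)) \<partial>lborel) * \<theta>' t
      + (\<integral>y. indicator (cube \<epsilon>) y * (\<Sum>i\<in>UNIV. F (x0 + y, t) $ i * ?m' y i) \<partial>lborel) * \<theta> t \<partial>lborel) = 0"
    by simp
qed


section \<open>Moduli of continuity in the mean\<close>

text \<open>
  Regularity is measured along a family \<open>J\<close> of pairs of a measure and a shift: spatial regularity
  uniform in time and temporal regularity are the instances \<open>space_shifts\<close> and \<open>time_shifts\<close>.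
\<close>

definition shift_reg ::
  "('z::euclidean_space measure \<times> 'z) set \<Rightarrow> real \<Rightarrow> real \<Rightarrow> ('z \<Rightarrow> 'b::euclidean_space) \<Rightarrow> bool" where
  "shift_reg J q \<sigma> f \<longleftrightarrow> (\<exists>C\<ge>0. \<forall>(M, h)\<in>J.
     (\<integral>\<^sup>+z. ennreal (norm (f (z + h) - f z) powr q) \<partial>M) \<le> ennreal (C * norm h powr (\<sigma> * q)))"

definition space_shifts :: "'a::euclidean_space set \<Rightarrow> (('a \<times> real) measure \<times> ('a \<times> real)) set" where
  "space_shifts A = {(distr (density lborel (indicator A)) borel (\<lambda>x. (x, t)), (k, 0)) |t k. norm k \<le> 1}"

definition time_shifts ::
  "'a::euclidean_space set \<Rightarrow> real \<Rightarrow> real \<Rightarrow> real \<Rightarrow> (('a \<times> real) measure \<times> ('a \<times> real)) set" where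
  "time_shifts A a b r = {(density lborel (indicator (A \<times> {a..b})), (0, \<tau>)) |\<tau>. \<bar>\<tau>\<bar> \<le> r}"

text \<open>For shifts of length at most 1 the quantity \<open>norm h powr \<sigma>\<close>
  decreases in \<sigma>, so a regularity exponent may be lowered and different quantities brought to
  a common one.\<close>

definition small_shifts :: "('z::euclidean_space measure \<times> 'z) set \<Rightarrow> bool" where
  "small_shifts J \<longleftrightarrow> (\<forall>(M, h)\<in>J. sets M = sets borel \<and> norm h \<le> 1)"

lemma small_space_shifts: "small_shifts (space_shifts A)"
  by (auto simp: small_shifts_def space_shifts_def)

lemma small_time_shifts: "r \<le> 1 \<Longrightarrow> small_shifts (time_shifts A a b r)"
  by (auto simp: small_shifts_def time_shifts_def)

lemma shift_reg_mono:
  assumes J: "small_shifts J" and f: "shift_reg J q \<sigma> f" and le: "\<sigma>' \<le> \<sigma>" and q: "0 \<le> q"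
  shows "shift_reg J q \<sigma>' f"
proof -
  obtain C where C: "C \<ge> 0" "\<And>M h. (M, h) \<in> J \<Longrightarrow>
      (\<integral>\<^sup>+z. ennreal (norm (f (z + h) - f z) powr q) \<partial>M) \<le> ennreal (C * norm h powr (\<sigma> * q))"
    using f by (auto simp: shift_reg_def)
  have "C * norm h powr (\<sigma> * q) \<le> C * norm h powr (\<sigma>' * q)" if "(M, h) \<in> J" for M h
  proof (intro mult_left_mono C(1))
    have "norm h \<le> 1" using J that by (auto simp: small_shifts_def)
    then show "norm h powr (\<sigma> * q) \<le> norm h powr (\<sigma>' * q)"
      using le q by (intro powr_mono') (auto simp: mult_right_mono)
  qed
  then have "(\<integral>\<^sup>+z. ennreal (norm (f (z + h) - f z) powr q) \<partial>M) \<le> ennreal (C * norm h powr (\<sigma>' * q))"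
    if "(M, h) \<in> J" for M h
    using C(2)[OF that] that by (meson ennreal_leI order_trans)
  with C(1) show ?thesis by (auto simp: shift_reg_def)
qed

lemma shift_reg_lipschitz:
  assumes J: "small_shifts J" and q: "0 \<le> q" and f_meas [measurable]: "f \<in> borel_measurable borel"
    and f: "shift_reg J q \<sigma> f" and L: "L-lipschitz_on X \<Phi>" and X: "\<And>z. f z \<in> X"
  shows "shift_reg J q \<sigma> (\<lambda>z. \<Phi> (f z))"
proof -
  obtain C where C: "C \<ge> 0" "\<And>M h. (M, h) \<in> J \<Longrightarrow>
      (\<integral>\<^sup>+z. ennreal (norm (f (z + h) - f z) powr q) \<partial>M) \<le> ennreal (C * norm h powr (\<sigma> * q))"
    using f by (auto simp: shift_reg_def)
  define K where "K = max L 0 + 1"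
  have K: "0 < K" by (simp add: K_def)
  have pw: "norm (\<Phi> (f x) - \<Phi> (f y)) powr q \<le> K powr q * norm (f x - f y) powr q" for x y
  proof -
    have "norm (\<Phi> (f x) - \<Phi> (f y)) \<le> L * norm (f x - f y)"
      using lipschitz_onD[OF L X X, of x y] by (simp add: dist_norm)
    also have "\<dots> \<le> K * norm (f x - f y)" by (intro mult_right_mono) (auto simp: K_def)
    finally show ?thesis using q K by (subst powr_mult[symmetric]) (auto intro: powr_mono2)
  qed
  have "(\<integral>\<^sup>+z. ennreal (norm (\<Phi> (f (z + h)) - \<Phi> (f z)) powr q) \<partial>M) \<le> ennreal (K powr q * C * norm h powr (\<sigma> * q))"
    if "(M, h) \<in> J" for M h
  proof -
    have [measurable_cong]: "sets M = sets borel" using J that by (auto simp: small_shifts_def)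
    let ?I = "\<integral>\<^sup>+z. ennreal (norm (f (z + h) - f z) powr q) \<partial>M"
    have "(\<integral>\<^sup>+z. ennreal (norm (\<Phi> (f (z + h)) - \<Phi> (f z)) powr q) \<partial>M)
        \<le> (\<integral>\<^sup>+z. ennreal (K powr q * norm (f (z + h) - f z) powr q) \<partial>M)"
      by (intro nn_integral_mono ennreal_leI pw)
    also have "\<dots> = ennreal (K powr q) * ?I"
      by (subst nn_integral_cmult[symmetric]) (auto simp: ennreal_mult)
    also have "\<dots> \<le> ennreal (K powr q) * ennreal (C * norm h powr (\<sigma> * q))"
      by (intro mult_left_mono C(2) that) simp
    finally show ?thesis using C(1) by (simp add: ennreal_mult mult.assoc)
  qed
  then show ?thesis using C(1) unfolding shift_reg_def by (intro exI[of _ "K powr q * C"]) auto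
qed

lemma shift_reg_Pair:
  assumes J: "small_shifts J" and q: "0 \<le> q"
    and f [measurable]: "f \<in> borel_measurable borel" and g [measurable]: "g \<in> borel_measurable borel"
    and fr: "shift_reg J q \<sigma> f" and gr: "shift_reg J q \<sigma> g"
  shows "shift_reg J q \<sigma> (\<lambda>z. (f z, g z))"
proof -
  obtain C where C: "C \<ge> 0" "\<And>M h. (M, h) \<in> J \<Longrightarrow>
      (\<integral>\<^sup>+z. ennreal (norm (f (z + h) - f z) powr q) \<partial>M) \<le> ennreal (C * norm h powr (\<sigma> * q))"
    using fr by (auto simp: shift_reg_def)
  obtain D where D: "D \<ge> 0" "\<And>M h. (M, h) \<in> J \<Longrightarrow>
      (\<integral>\<^sup>+z. ennreal (norm (g (z + h) - g z) powr q) \<partial>M) \<le> ennreal (D * norm h powr (\<sigma> * q))"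
    using gr by (auto simp: shift_reg_def)
  have pw: "norm (a, b) powr q \<le> 2 powr q * (norm a powr q + norm b powr q)" for a :: 'b and b :: 'c
  proof -
    have "norm (a, b) powr q \<le> (2 * max (norm a) (norm b)) powr q"
      using q norm_Pair_le[of a b] by (intro powr_mono2) auto
    also have "\<dots> = 2 powr q * max (norm a) (norm b) powr q" by (simp add: powr_mult)
    also have "max (norm a) (norm b) powr q \<le> norm a powr q + norm b powr q" by (auto simp: max_def)
    finally show ?thesis by simp
  qed
  have "(\<integral>\<^sup>+z. ennreal (norm ((f (z + h), g (z + h)) - (f z, g z)) powr q) \<partial>M)
      \<le> ennreal (2 powr q * (C + D) * norm h powr (\<sigma> * q))"
    if J': "(M, h) \<in> J" for M h
  proof -
    have [measurable_cong]: "sets M = sets borel" using J that by (auto simp: small_shifts_def)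
    have "(\<integral>\<^sup>+z. ennreal (norm ((f (z + h), g (z + h)) - (f z, g z)) powr q) \<partial>M)
        \<le> (\<integral>\<^sup>+z. ennreal (2 powr q) * (ennreal (norm (f (z + h) - f z) powr q) + ennreal (norm (g (z + h) - g z) powr q)) \<partial>M)"
      using pw by (intro nn_integral_mono) (simp flip: ennreal_mult ennreal_plus add: ennreal_leI)
    also have "\<dots> = ennreal (2 powr q) * ((\<integral>\<^sup>+z. ennreal (norm (f (z + h) - f z) powr q) \<partial>M)
        + (\<integral>\<^sup>+z. ennreal (norm (g (z + h) - g z) powr q) \<partial>M))"
      by (subst nn_integral_cmult; (subst nn_integral_add)?; measurable)
    also have "\<dots> \<le> ennreal (2 powr q) * (ennreal (C * norm h powr (\<sigma> * q)) + ennreal (D * norm h powr (\<sigma> * q)))"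
      by (intro mult_left_mono add_mono C D J') simp
    also have "\<dots> = ennreal (2 powr q * (C + D) * norm h powr (\<sigma> * q))"
      using C(1) D(1) by (simp flip: ennreal_mult ennreal_plus add: algebra_simps)
    finally show ?thesis .
  qed
  then show ?thesis using C(1) D(1) unfolding shift_reg_def
    by (intro exI[of _ "2 powr q * (C + D)"]) auto
qed

lemma shift_reg_vec:
  fixes f :: "'z::euclidean_space \<Rightarrow> real ^ 'n"
  assumes J: "small_shifts J" and q: "0 \<le> q"
    and f [measurable]: "f \<in> borel_measurable borel"
    and fr: "\<And>i. shift_reg J q \<sigma> (\<lambda>z. f z $ i)"
  shows "shift_reg J q \<sigma> f"
proof -
  have [measurable]: "(\<lambda>z. f z $ i) \<in> borel_measurable borel" for i
    by (rule measurable_compose[OF f]) auto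
  have "\<forall>i. \<exists>C\<ge>0. \<forall>(M, h)\<in>J.
      (\<integral>\<^sup>+z. ennreal (norm (f (z + h) $ i - f z $ i) powr q) \<partial>M) \<le> ennreal (C * norm h powr (\<sigma> * q))"
    using fr by (simp add: shift_reg_def)
  from choice[OF this] obtain C where C': "\<forall>i. C i \<ge> 0 \<and> (\<forall>(M, h)\<in>J.
      (\<integral>\<^sup>+z. ennreal (norm (f (z + h) $ i - f z $ i) powr q) \<partial>M) \<le> ennreal (C i * norm h powr (\<sigma> * q)))" ..
  have C: "C i \<ge> 0" "(M, h) \<in> J \<Longrightarrow>
      (\<integral>\<^sup>+z. ennreal (norm (f (z + h) $ i - f z $ i) powr q) \<partial>M) \<le> ennreal (C i * norm h powr (\<sigma> * q))" for i M h
    using C'[THEN spec[of _ i]] by auto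
  let ?n = "real CARD('n)"
  have pw: "norm a powr q \<le> ?n powr q * (\<Sum>i\<in>UNIV. norm (a $ i) powr q)" for a :: "real ^ 'n"
  proof -
    define m where "m = Max (range (\<lambda>i. norm (a $ i)))"
    have m: "norm (a $ i) \<le> m" for i by (simp add: m_def)
    have "m \<in> range (\<lambda>i. norm (a $ i))" unfolding m_def by (intro Max_in) auto
    then obtain j where j: "m = norm (a $ j)" by auto
    have "norm a \<le> (\<Sum>i\<in>UNIV. norm (a $ i))" using norm_le_l1_cart[of a] by simp
    also have "\<dots> \<le> ?n * m" using sum_bounded_above[of UNIV "\<lambda>i. norm (a $ i)" m] m by simp
    finally have "norm a powr q \<le> (?n * m) powr q" using q by (intro powr_mono2) auto
    also have "\<dots> = ?n powr q * norm (a $ j) powr q" by (simp add: powr_mult j)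
    also have "norm (a $ j) powr q \<le> (\<Sum>i\<in>UNIV. norm (a $ i) powr q)"
      by (rule member_le_sum) auto
    finally show ?thesis by simp
  qed
  have "(\<integral>\<^sup>+z. ennreal (norm (f (z + h) - f z) powr q) \<partial>M)
      \<le> ennreal (?n powr q * (\<Sum>i\<in>UNIV. C i) * norm h powr (\<sigma> * q))"
    if J': "(M, h) \<in> J" for M h
  proof -
    have [measurable_cong]: "sets M = sets borel" using J that by (auto simp: small_shifts_def)
    have "(\<integral>\<^sup>+z. ennreal (norm (f (z + h) - f z) powr q) \<partial>M)
        \<le> (\<integral>\<^sup>+z. ennreal (?n powr q) * (\<Sum>i\<in>UNIV. ennreal (norm (f (z + h) $ i - f z $ i) powr q)) \<partial>M)"
      using pw[of "f (_ + h) - f _"] by (intro nn_integral_mono) (simp add: ennreal_leI sum_nonneg flip: ennreal_mult)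
    also have "\<dots> = ennreal (?n powr q) * (\<Sum>i\<in>UNIV. \<integral>\<^sup>+z. ennreal (norm (f (z + h) $ i - f z $ i) powr q) \<partial>M)"
      by (subst nn_integral_cmult; (subst nn_integral_sum)?; measurable)
    also have "\<dots> \<le> ennreal (?n powr q) * (\<Sum>i\<in>UNIV. ennreal (C i * norm h powr (\<sigma> * q)))"
      by (intro mult_left_mono sum_mono C J') simp
    also have "\<dots> = ennreal (?n powr q * (\<Sum>i\<in>UNIV. C i) * norm h powr (\<sigma> * q))"
      using C(1) by (simp add: sum_nonneg mult.assoc sum_distrib_right flip: ennreal_mult)
    finally show ?thesis .
  qed
  then show ?thesis using C(1) unfolding shift_reg_def
    by (intro exI[of _ "?n powr q * (\<Sum>i\<in>UNIV. C i)"]) (auto intro!: mult_nonneg_nonneg sum_nonneg)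
qed

section \<open>Space and time shifts as iterated integrals; from balance laws to time
  regularity\<close>

lemma nn_integral_space_shift:
  fixes G :: "'a::euclidean_space \<times> real \<Rightarrow> ennreal"
  assumes [measurable]: "A \<in> sets borel" "G \<in> borel_measurable borel"
  shows "(\<integral>\<^sup>+z. G z \<partial>distr (density lborel (indicator A)) borel (\<lambda>x. (x, t))) = (\<integral>\<^sup>+x\<in>A. G (x, t) \<partial>lborel)"
  by (subst nn_integral_distr) (auto simp: nn_integral_density mult.commute)

lemma nn_integral_time_shift:
  fixes G :: "'a::euclidean_space \<times> real \<Rightarrow> ennreal"
  assumes [measurable]: "A \<in> sets borel" and G [measurable]: "G \<in> borel_measurable borel"
  shows "(\<integral>\<^sup>+z. G z \<partial>density lborel (indicator (A \<times> {a..b}))) = (\<integral>\<^sup>+t\<in>{a..b}. (\<integral>\<^sup>+x\<in>A. G (x, t) \<partial>lborel) \<partial>lborel)"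
proof -
  have [measurable]: "A \<times> {a..b} \<in> sets borel"
    using pair_measureI[OF assms(1), of "{a..b}" borel] unfolding borel_prod by simp
  have "(\<integral>\<^sup>+z. G z \<partial>density lborel (indicator (A \<times> {a..b})))
      = (\<integral>\<^sup>+z. (\<lambda>(x, t). G (x, t) * indicator A x * indicator {a..b} t) z \<partial>(lborel \<Otimes>\<^sub>M lborel))"
    by (subst nn_integral_density, measurable, unfold lborel_prod)
      (auto intro!: nn_integral_cong simp: indicator_def mem_Times_iff)
  also have "\<dots> = (\<integral>\<^sup>+t. (\<integral>\<^sup>+x. G (x, t) * indicator A x * indicator {a..b} t \<partial>lborel) \<partial>lborel)"
  proof -
    have "(\<lambda>(x, t). G (x, t) * indicator A x * indicator {a..b} t) \<in> borel_measurable (lborel \<Otimes>\<^sub>M lborel)"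
      by measurable
    from lborel_pair.nn_integral_snd[OF this] show ?thesis by simp
  qed
  also have "\<dots> = (\<integral>\<^sup>+t\<in>{a..b}. (\<integral>\<^sup>+x\<in>A. G (x, t) \<partial>lborel) \<partial>lborel)"
    by (simp add: nn_integral_multc)
  finally show ?thesis .
qed

text \<open>Mollification at width \<epsilon> = |\<tau>| involves spatial shifts from a cube of half
  side \<epsilon>, whose length is at most the dimension times \<epsilon>. This puts a power of the
  dimension into the constant, and the bound on dimension times \<open>r\<close> keeps these shifts
  among the small ones on which spatial regularity is known.\<close>

proposition weak_balance_time_shift_reg:
  fixes w w0 :: "(real ^ 'n) \<times> real \<Rightarrow> real" and F F0 :: "(real ^ 'n) \<times> real \<Rightarrow> real ^ 'n"
  assumes \<Omega>: "\<Omega> = whole_space \<or> \<Omega> = torus" and q: "1 \<le> q" and \<sigma>: "0 \<le> \<sigma>"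
    and bal: "weak_balance \<Omega> T w0 F0"
    and ae: "AE z in lebesgue. z \<in> region (spacetime \<Omega> T) \<longrightarrow> w0 z = w z \<and> F0 z = F z"
    and w [measurable]: "w \<in> borel_measurable borel" and wC: "\<And>z. \<bar>w z\<bar> \<le> C"
    and F [measurable]: "F \<in> borel_measurable borel" and FC: "\<And>z. norm (F z) \<le> C"
    and per: "\<And>x t k. k \<in> periods \<Omega> \<Longrightarrow> w (x + k, t) = w (x, t) \<and> F (x + k, t) = F (x, t)"
    and A [measurable]: "A \<in> sets borel"
    and wr: "shift_reg (space_shifts A) q \<sigma> w" and Fr: "shift_reg (space_shifts A) q \<sigma> F"
    and r: "0 < r" "real CARD('n) * r \<le> 1" "r \<le> 1 / 2" and ab: "r < a" "a \<le> b" "ereal (b + r) < T"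
  shows "shift_reg (time_shifts A a b r) q \<sigma> w"
proof -
  let ?n = "real CARD('n)"
  obtain Cw where Cw: "Cw \<ge> 0" "\<And>M h. (M, h) \<in> space_shifts A \<Longrightarrow>
      (\<integral>\<^sup>+z. ennreal (norm (w (z + h) - w z) powr q) \<partial>M) \<le> ennreal (Cw * norm h powr (\<sigma> * q))"
    using wr by (auto simp: shift_reg_def)
  obtain CF where CF: "CF \<ge> 0" "\<And>M h. (M, h) \<in> space_shifts A \<Longrightarrow>
      (\<integral>\<^sup>+z. ennreal (norm (F (z + h) - F z) powr q) \<partial>M) \<le> ennreal (CF * norm h powr (\<sigma> * q))"
    using Fr by (auto simp: shift_reg_def)
  define B where "B = max Cw CF"
  have B: "B \<ge> 0" using Cw by (simp add: B_def)
  have "(\<integral>\<^sup>+z. ennreal (norm (w (z + (0, \<tau>)) - w z) powr q) \<partial>density lborel (indicator (A \<times> {a..b})))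
      \<le> ennreal ((b - a) * mollifier_const CARD('n) q * B * ?n powr (\<sigma> * q) * norm (0 :: real ^ 'n, \<tau>) powr (\<sigma> * q))"
    if \<tau>: "\<bar>\<tau>\<bar> \<le> r" for \<tau>
  proof (cases "\<tau> = 0")
    case True
    then show ?thesis by (simp flip: zero_prod_def)
  next
    case False
    define \<epsilon> where "\<epsilon> = \<bar>\<tau>\<bar>"
    have \<epsilon>: "0 < \<epsilon>" "\<bar>\<tau>\<bar> = \<epsilon>" "\<epsilon> \<le> r" "\<epsilon> \<le> 1 / 2" using False \<tau> r by (auto simp: \<epsilon>_def)
    let ?D = "B * (?n * \<epsilon>) powr (\<sigma> * q)"
    have D: "0 \<le> ?D" using B by simp
    have sp: "(\<integral>\<^sup>+x\<in>A. ennreal (norm (f (x + y, t) - f (x, t)) powr q) \<partial>lborel) \<le> ennreal ?D"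
      if [measurable]: "f \<in> borel_measurable borel" and y: "y \<in> cube \<epsilon>" and K: "K \<le> B" "0 \<le> K"
        and f: "\<And>M h. (M, h) \<in> space_shifts A \<Longrightarrow>
      (\<integral>\<^sup>+z. ennreal (norm (f (z + h) - f z) powr q) \<partial>M) \<le> ennreal (K * norm h powr (\<sigma> * q))"
      for f :: "(real ^ 'n) \<times> real \<Rightarrow> 'b::euclidean_space" and y t K
    proof -
      have ny: "norm y \<le> ?n * \<epsilon>" by (rule norm_cube_le[OF y])
      have "?n * \<epsilon> \<le> ?n * r" using \<epsilon> by (intro mult_left_mono) auto
      then have "norm y \<le> 1" using ny r(2) by linarith
      then have "(distr (density lborel (indicator A)) borel (\<lambda>x. (x, t)), (y, 0)) \<in> space_shifts A"
        by (auto simp: space_shifts_def)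
      from f[OF this] have "(\<integral>\<^sup>+x\<in>A. ennreal (norm (f (x + y, t) - f (x, t)) powr q) \<partial>lborel) \<le> ennreal (K * norm y powr (\<sigma> * q))"
        by (subst (asm) nn_integral_space_shift) auto
      also have "\<dots> \<le> ennreal ?D"
        using ny q \<sigma> K by (intro ennreal_leI mult_mono powr_mono2) auto
      finally show ?thesis .
    qed
    have "(\<integral>\<^sup>+z. ennreal (norm (w (z + (0, \<tau>)) - w z) powr q) \<partial>density lborel (indicator (A \<times> {a..b})))
        = (\<integral>\<^sup>+t\<in>{a..b}. (\<integral>\<^sup>+x\<in>A. ennreal (\<bar>w (x, t + \<tau>) - w (x, t)\<bar> powr q) \<partial>lborel) \<partial>lborel)"
      by (subst nn_integral_time_shift) auto
    also have "\<dots> \<le> ennreal ((b - a) * mollifier_const CARD('n) q * ?D)"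
    proof (rule time_increment_le[OF q w wC F FC A \<epsilon>(1,2)])
      show "weak_derivative T
        (\<lambda>t. \<integral>y. indicator (cube \<epsilon>) y * (mollifier (\<Omega> = torus) \<epsilon> y * w (x + y, t)) \<partial>lborel)
        (\<lambda>t. \<integral>y. indicator (cube \<epsilon>) y * (\<Sum>i\<in>UNIV. F (x + y, t) $ i * mollifier' (\<Omega> = torus) \<epsilon> y i) \<partial>lborel)" for x
        by (rule weak_balance_imp_weak_derivative[OF \<Omega> \<epsilon>(1,4) bal ae w wC F FC per])
      show "ereal (b + \<epsilon>) < T" using ab(3) \<epsilon>(3) by (elim order.strict_trans1[rotated]) simp
      show "(\<integral>\<^sup>+x\<in>A. ennreal (\<bar>w (x + y, t) - w (x, t)\<bar> powr q) \<partial>lborel) \<le> ennreal ?D" if "y \<in> cube \<epsilon>" for t y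
        using sp[OF w that _ Cw] by (simp add: B_def)
      show "(\<integral>\<^sup>+x\<in>A. ennreal (norm (F (x + y, t) - F (x, t)) powr q) \<partial>lborel) \<le> ennreal ?D" if "y \<in> cube \<epsilon>" for t y
        using sp[OF F that _ CF] by (simp add: B_def)
    qed (use ab \<epsilon> D in auto)
    also have "(b - a) * mollifier_const CARD('n) q * ?D
        = (b - a) * mollifier_const CARD('n) q * B * ?n powr (\<sigma> * q) * norm (0 :: real ^ 'n, \<tau>) powr (\<sigma> * q)"
      using \<epsilon> by (simp add: powr_mult norm_Pair)
    finally show ?thesis .
  qed
  moreover have "0 \<le> (b - a) * mollifier_const CARD('n) q * B * ?n powr (\<sigma> * q)"
    using ab B by (simp add: mollifier_const_def)
  ultimately show ?thesis unfolding shift_reg_def time_shifts_def by blast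
qed


section \<open>Representatives and spatial regularity\<close>

lemma region_spacetime:
  assumes "\<Omega> = whole_space \<or> \<Omega> = torus"
  shows "region (spacetime \<Omega> T) = UNIV \<times> {t. 0 < t \<and> ereal t < T}"
  using assms by (auto simp: spacetime_def whole_space_def torus_def)

lemma open_times: "open {t. 0 < t \<and> ereal t < T}"
  by (intro open_Collect_conj open_Collect_less continuous_intros)

lemma countable_periods:
  assumes "\<Omega> = whole_space \<or> \<Omega> = torus" shows "countable (periods \<Omega>)"
  using assms countable_lattice by (auto simp: periods_torus) (simp add: whole_space_def)

text \<open>The representative of a point in the period cell. Composing with it makes a Borel
  function periodic at every point and not just almost everywhere.\<close>

definition reduce :: "(real ^ 'n) flat_domain \<Rightarrow> real ^ 'n \<Rightarrow> real ^ 'n" where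
  "reduce \<Omega> x = (if \<Omega> = torus then (\<chi> i. frac (x $ i)) else x)"

lemma reduce_measurable [measurable]: "reduce \<Omega> \<in> borel_measurable borel"
proof (cases "\<Omega> = torus")
  case True
  have "reduce \<Omega> = (\<lambda>x. \<Sum>i\<in>UNIV. frac (x $ i) *\<^sub>R axis i 1)"
  proof
    fix x
    show "reduce \<Omega> x = (\<Sum>i\<in>UNIV. frac (x $ i) *\<^sub>R axis i 1)"
      using True basis_expansion[of "reduce \<Omega> x"] by (simp add: reduce_def scalar_mult_eq_scaleR)
  qed
  moreover have "(\<lambda>x::real^'n. frac (x $ i)) \<in> borel_measurable borel" for i
    unfolding frac_def by (intro borel_measurable_diff measurable_compose[OF _ borel_measurable_real_floor]) auto
  ultimately show ?thesis by (auto intro!: borel_measurable_sum borel_measurable_scaleR)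
next
  case False
  then have "reduce \<Omega> = (\<lambda>x. x)" by (simp add: reduce_def fun_eq_iff)
  then show ?thesis by simp
qed

lemma reduce_periodic:
  assumes "\<Omega> = whole_space \<or> \<Omega> = torus" "k \<in> periods \<Omega>"
  shows "reduce \<Omega> (x + k) = reduce \<Omega> x"
proof (cases "\<Omega> = torus")
  case True
  have "frac (a + b) = frac a" if "b \<in> \<int>" for a b :: real
    using that by (elim Ints_cases) (simp add: frac_def)
  then show ?thesis using assms(2) True by (simp add: reduce_def periods_torus lattice_def vec_eq_iff)
next
  case False
  with assms show ?thesis by (simp add: whole_space_def)
qed

lemma reduce_eq:
  assumes "\<Omega> = whole_space \<or> \<Omega> = torus"
  shows "\<exists>k\<in>periods \<Omega>. reduce \<Omega> x = x + k"
proof (cases "\<Omega> = torus")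
  case True
  then have "reduce \<Omega> x = x + (\<chi> i. - of_int \<lfloor>x $ i\<rfloor>)" by (simp add: reduce_def frac_def vec_eq_iff)
  moreover have "(\<chi> i. - of_int \<lfloor>x $ i\<rfloor>) \<in> lattice" by (simp add: lattice_def)
  ultimately show ?thesis unfolding True periods_torus by blast
next
  case False
  with assms show ?thesis by (simp add: reduce_def whole_space_def)
qed

section \<open>Almost everywhere statements under translation; Borel versions\<close>

lemma AE_shift_notin:
  fixes N :: "'a::euclidean_space set"
  assumes "N \<in> null_sets lborel" shows "AE z in lborel. z + h \<notin> N"
proof -
  have "negligible N" using assms by (simp add: negligible_iff_null_sets null_sets_completionI)
  then have "AE z in lborel. z \<notin> (+) (- h) ` N" by (intro AE_notin_negligible negligible_translation)
  then show ?thesis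
  proof eventually_elim
    case (elim z)
    show ?case
    proof
      assume "z + h \<in> N"
      then have "- h + (z + h) \<in> (+) (- h) ` N" by (rule imageI)
      with elim show False by simp
    qed
  qed
qed

lemma AE_lborel_shift:
  fixes h :: "'a::euclidean_space"
  assumes "AE z in lborel. P z" shows "AE z in lborel. P (z + h)"
proof -
  obtain N where "N \<in> null_sets lborel" "{z \<in> space lborel. \<not> P z} \<subseteq> N"
    using assms unfolding eventually_ae_filter by blast
  then have N: "N \<in> null_sets lborel" "\<And>z. \<not> P z \<Longrightarrow> z \<in> N" by auto
  from AE_shift_notin[OF N(1), of h] show ?thesis
    by eventually_elim (use N(2) in blast)
qed

lemma completion_ex_borel_measurable_euclidean:
  fixes f :: "'a \<Rightarrow> 'b::euclidean_space"
  assumes f: "f \<in> borel_measurable (completion M)"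
  obtains g where "g \<in> borel_measurable M" "AE x in M. f x = g x"
proof -
  have "\<exists>g\<in>borel_measurable M. AE x in M. f x \<bullet> b = g x" for b
    using f by (intro completion_ex_borel_measurable_real) simp
  then obtain g where g: "\<And>b. g b \<in> borel_measurable M" "\<And>b. AE x in M. f x \<bullet> b = g b x" by metis
  have "AE x in M. \<forall>b\<in>Basis. f x \<bullet> b = g b x"
    using g(2) by (intro AE_finite_allI) auto
  then have "AE x in M. f x = (\<Sum>b\<in>Basis. g b x *\<^sub>R b)"
    by eventually_elim (metis (no_types, lifting) euclidean_representation sum.cong)
  moreover have "(\<lambda>x. \<Sum>b\<in>Basis. g b x *\<^sub>R b) \<in> borel_measurable M"
    using g(1) by (intro borel_measurable_sum borel_measurable_scaleR) auto
  ultimately show ?thesis using that by blast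
qed

text \<open>
  The exceptional time slices are replaced by constant ones, so that spatial regularity holds at
  every time.
\<close>

lemma Borel_representative:
  fixes f :: "(real ^ 'n) \<times> real \<Rightarrow> 'b::euclidean_space"
  assumes \<Omega>: "\<Omega> = whole_space \<or> \<Omega> = torus" and f: "measurable_fun (spacetime \<Omega> T) f"
    and X: "closed X" "c0 \<in> X" and fX: "AE z in lebesgue_on (region (spacetime \<Omega> T)). f z \<in> X"
  obtains g where "g \<in> borel_measurable borel" "\<And>z. g z \<in> X"
    "\<And>x t k. k \<in> periods \<Omega> \<Longrightarrow> g (x + k, t) = g (x, t)"
    "AE z in lborel. z \<in> region (spacetime \<Omega> T) \<longrightarrow> f z = g z"
    "\<And>t. (\<exists>c. \<forall>x. g (x, t) = c) \<or> (0 < t \<and> ereal t < T \<and> (AE x in lborel. f (x, t) = g (x, t)))"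
proof -
  let ?I = "{t. 0 < t \<and> ereal t < T}"
  define R where "R = region (spacetime \<Omega> T)"
  have R: "R = UNIV \<times> ?I" unfolding R_def by (rule region_spacetime[OF \<Omega>])
  have I_meas [measurable]: "?I \<in> sets borel" using open_times by auto
  have "open R" unfolding R by (intro open_Times open_UNIV open_times)
  then have Rl: "R \<in> sets lebesgue" by auto
  define f0 where "f0 z = (if z \<in> R then f z else 0)" for z
  have "f0 \<in> borel_measurable lebesgue"
    using f borel_measurable_if[OF Rl, of f] by (simp add: f0_def[abs_def] measurable_fun_def R_def)
  then obtain g1 where g1': "g1 \<in> borel_measurable lborel" and g1_eq: "AE z in lborel. f0 z = g1 z"
    by (rule completion_ex_borel_measurable_euclidean)
  from g1' have g1 [measurable]: "g1 \<in> borel_measurable borel" by simp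
  have f0_per: "f0 (z + (k, 0)) = f0 z" if "k \<in> periods \<Omega>" for z k
  proof -
    have "z + (k, 0) \<in> R \<longleftrightarrow> z \<in> R" by (cases z) (simp add: R)
    moreover have "f (z + (k, 0)) = f z" if "z \<in> R"
    proof -
      have "(k, 0) \<in> periods (spacetime \<Omega> T)" using \<open>k \<in> periods \<Omega>\<close> by (simp add: spacetime_def)
      then show ?thesis using f that unfolding measurable_fun_def R_def by blast
    qed
    ultimately show ?thesis by (simp add: f0_def)
  qed
  define g2 where "g2 z = g1 (reduce \<Omega> (fst z), snd z)" for z
  have "(\<lambda>z::(real ^ 'n) \<times> real. reduce \<Omega> (fst z)) \<in> borel_measurable borel"
    by (rule measurable_compose[OF _ reduce_measurable]) (intro borel_measurable_continuous_onI continuous_intros)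
  moreover have "(snd :: (real ^ 'n) \<times> real \<Rightarrow> real) \<in> borel_measurable borel"
    by (intro borel_measurable_continuous_onI continuous_intros)
  ultimately have g2 [measurable]: "g2 \<in> borel_measurable borel"
    unfolding g2_def[abs_def] by (intro measurable_compose[OF _ g1] borel_measurable_Pair)
  \<comment> \<open>The lattice translates of the exceptional set are countably many, so
    \<open>f0\<close> and \<open>g1\<close> agree almost everywhere at all translates at once, in
    particular at the reduced point.\<close>
  have "countable (periods \<Omega>)" by (rule countable_periods[OF \<Omega>])
  then have "AE z in lborel. \<forall>k\<in>periods \<Omega>. f0 (z + (k, 0)) = g1 (z + (k, 0))"
    by (subst AE_ball_countable) (auto intro: AE_lborel_shift[OF g1_eq])
  then have g2_eq: "AE z in lborel. f0 z = g2 z"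
  proof eventually_elim
    case (elim z)
    obtain k where k: "k \<in> periods \<Omega>" "reduce \<Omega> (fst z) = fst z + k" using reduce_eq[OF \<Omega>] by blast
    have "f0 z = g1 (z + (k, 0))" using elim k(1) f0_per[OF k(1)] by metis
    also have "z + (k, 0) = (reduce \<Omega> (fst z), snd z)" using k(2) by (cases z) simp
    finally show ?case by (simp add: g2_def)
  qed
  have fX': "AE z in lborel. z \<in> R \<longrightarrow> f z \<in> X"
    using fX Rl unfolding R_def[symmetric] by (subst (asm) AE_restrict_space_iff) (auto simp: AE_completion_iff)
  \<comment> \<open>Values outside \<open>X\<close> occur on a null part of the region only;
    replacing them by \<open>c0\<close> makes membership in \<open>X\<close> hold
    everywhere.\<close>
  define g3 where "g3 z = (if g2 z \<in> X then g2 z else c0)" for z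
  have Xb [measurable]: "X \<in> sets borel" using X by auto
  have g3 [measurable]: "g3 \<in> borel_measurable borel" unfolding g3_def by measurable
  have "AE z in lborel. z \<in> R \<longrightarrow> f z = g3 z"
    using g2_eq fX' by eventually_elim (auto simp: g3_def f0_def split: if_splits)
  then obtain B where B: "B \<in> null_sets lborel" "{z \<in> space lborel. \<not> (z \<in> R \<longrightarrow> f z = g3 z)} \<subseteq> B"
    unfolding eventually_ae_filter by blast
  then have B_eq: "f z = g3 z" if "z \<in> R" "z \<notin> B" for z using that by auto
  have [measurable]: "B \<in> sets borel" using B(1) by auto
  \<comment> \<open>The measure of the slice at time \<open>t\<close> of the exceptional set. It
    vanishes for almost every \<open>t\<close>; slices where it does not, and times outside the
    interval, become constant.\<close>
  define \<nu> where "\<nu> t = (\<integral>\<^sup>+x. indicator B (x, t) \<partial>(lborel :: (real ^ 'n) measure))" for t :: real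
  have \<nu> [measurable]: "\<nu> \<in> borel_measurable borel" unfolding \<nu>_def by measurable
  have "(\<integral>\<^sup>+t. \<nu> t \<partial>lborel) = (\<integral>\<^sup>+z. indicator B z \<partial>(lborel \<Otimes>\<^sub>M lborel))"
  proof -
    have "B \<in> sets (lborel \<Otimes>\<^sub>M lborel)" using B(1) unfolding lborel_prod by auto
    then have "(indicator B :: _ \<Rightarrow> ennreal) \<in> borel_measurable (lborel \<Otimes>\<^sub>M lborel)" by simp
    then show ?thesis unfolding \<nu>_def by (rule lborel_pair.nn_integral_snd)
  qed
  also have "\<dots> = 0" using null_setsD1[OF B(1)] null_setsD2[OF B(1)] by (simp add: lborel_prod)
  finally have \<nu>0: "AE t in lborel. \<nu> t = 0" by (subst (asm) nn_integral_0_iff_AE) auto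
  define G where "G = {t. t \<in> ?I \<and> \<nu> t = 0}"
  have [measurable]: "G \<in> sets borel" unfolding G_def by measurable
  define g where "g z = (if snd z \<in> G then g3 z else c0)" for z
  show ?thesis
  proof (rule that[of g])
    have "Measurable.pred borel (\<lambda>z :: (real ^ 'n) \<times> real. snd z \<in> G)"
    proof (rule pred_sets2[of G borel])
      show "(snd :: (real ^ 'n) \<times> real \<Rightarrow> real) \<in> borel_measurable borel"
        by (intro borel_measurable_continuous_onI continuous_intros)
    qed simp
    then show "g \<in> borel_measurable borel" unfolding g_def by measurable
    show "g z \<in> X" for z using X by (simp add: g_def g3_def)
    show "g (x + k, t) = g (x, t)" if "k \<in> periods \<Omega>" for x t k
      using reduce_periodic[OF \<Omega> that, of x] by (simp add: g_def g3_def g2_def)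
    show "(\<exists>c. \<forall>x. g (x, t) = c) \<or> (0 < t \<and> ereal t < T \<and> (AE x in lborel. f (x, t) = g (x, t)))" for t
    proof (cases "t \<in> G")
      case True
      then have t: "0 < t" "ereal t < T" "\<nu> t = 0" by (auto simp: G_def)
      from t(3) have "AE x in lborel. (x, t) \<notin> B"
        unfolding \<nu>_def by (subst (asm) nn_integral_0_iff_AE) (auto simp: indicator_eq_0_iff)
      then have "AE x in lborel. f (x, t) = g (x, t)"
        by eventually_elim (use True t B_eq in \<open>auto simp: g_def R\<close>)
      with t show ?thesis by blast
    next
      case False
      then show ?thesis by (simp add: g_def)
    qed
    let ?N = "{t. \<nu> t \<noteq> 0}"
    have N: "?N \<in> sets lborel" "emeasure lborel ?N = 0"
    proof -
      show N: "?N \<in> sets lborel" by measurable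
      show "emeasure lborel ?N = 0" using AE_iff_measurable[OF N, of "\<lambda>t. \<nu> t = 0"] \<nu>0 by simp
    qed
    have "emeasure (lborel \<Otimes>\<^sub>M lborel) ((UNIV :: (real ^ 'n) set) \<times> ?N) = 0"
      using N by (subst lborel.emeasure_pair_measure_Times) auto
    moreover have "(UNIV :: (real ^ 'n) set) \<times> ?N \<in> sets (lborel \<Otimes>\<^sub>M lborel)"
      using N by (intro pair_measureI) auto
    ultimately have "(UNIV :: (real ^ 'n) set) \<times> ?N \<in> null_sets lborel" unfolding lborel_prod by blast
    then have "AE z in lborel. z \<notin> (UNIV :: (real ^ 'n) set) \<times> ?N" by (rule AE_not_in)
    moreover have "AE z in lborel. z \<notin> B" by (rule AE_not_in[OF B(1)])
    ultimately show "AE z in lborel. z \<in> region (spacetime \<Omega> T) \<longrightarrow> f z = g z"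
      unfolding R_def[symmetric]
    proof eventually_elim
      case (elim z)
      then have "\<nu> (snd z) = 0" by (auto simp: mem_Times_iff)
      then show ?case using elim(2) B_eq[of z] by (auto simp: g_def G_def R mem_Times_iff)
    qed
  qed
qed

text \<open>On a slice where \<open>g\<close> is constant all spatial increments vanish; on every
  other slice \<open>g\<close> agrees with \<open>f\<close> almost everywhere and inherits its norm
  bound, which is uniform in time. The spatial domain has empty frontier, so each nonzero shift is
  admissible. The map \<open>h\<close> selects a component of the state.\<close>

lemma Linfty_besov_space_shift_reg:
  fixes f g :: "(real ^ 'n) \<times> real \<Rightarrow> 'b::euclidean_space" and h :: "'b \<Rightarrow> 'c::euclidean_space"
  assumes \<Omega>: "\<Omega> = whole_space \<or> \<Omega> = torus" and q: "1 \<le> q"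
    and f: "(\<lambda>z. h (f z)) \<in> Linfty_besov_loc \<Omega> T \<sigma> q"
    and h [measurable]: "h \<in> borel_measurable borel" and g [measurable]: "g \<in> borel_measurable borel"
    and slice: "\<And>t. (\<exists>c. \<forall>x. g (x, t) = c) \<or> (0 < t \<and> ereal t < T \<and> (AE x in lborel. f (x, t) = g (x, t)))"
    and S: "compactly_in \<Omega> S"
  shows "shift_reg (space_shifts (S \<inter> cell \<Omega>)) q \<sigma> (\<lambda>z. h (g z))"
proof -
  have [measurable]: "cell \<Omega> \<in> sets borel" by (rule cell_measurable[OF \<Omega>])
  have [measurable]: "S \<in> sets borel" using S by (auto simp: compactly_in_def)
  have "(SUP t\<in>{t. 0 < t \<and> ereal t < T}. besov_norm \<Omega> \<sigma> q S (\<lambda>x. h (f (x, t)))) < \<infinity>"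
    using f S by (auto simp: Linfty_besov_loc_def)
  then obtain B where B: "B \<ge> 0" "(SUP t\<in>{t. 0 < t \<and> ereal t < T}. besov_norm \<Omega> \<sigma> q S (\<lambda>x. h (f (x, t)))) = ennreal B"
    by (cases "SUP t\<in>{t. 0 < t \<and> ereal t < T}. besov_norm \<Omega> \<sigma> q S (\<lambda>x. h (f (x, t)))") auto
  have fr: "frontier (region \<Omega>) = {}" using \<Omega> by (auto simp: whole_space_def torus_def)
  have main: "(\<integral>\<^sup>+x\<in>S \<inter> cell \<Omega>. ennreal (norm (h (g (x + k, t)) - h (g (x, t))) powr q) \<partial>lborel)
      \<le> ennreal (B powr q * norm k powr (\<sigma> * q))" for t k
  proof -
    consider "k = 0" | "\<exists>c. \<forall>x. g (x, t) = c" | "k \<noteq> 0" "0 < t" "ereal t < T" "AE x in lborel. f (x, t) = g (x, t)"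
      using slice[of t] by blast
    then show ?thesis
    proof cases
      case 3
      let ?I = "\<integral>\<^sup>+x\<in>S \<inter> cell \<Omega>. ennreal (norm (h (f (x + k, t)) - h (f (x, t))) powr q) \<partial>lebesgue"
      have "AE x in lborel. f (x + k, t) = g (x + k, t)" by (rule AE_lborel_shift[OF 3(4)])
      with 3(4) have "(\<integral>\<^sup>+x\<in>S \<inter> cell \<Omega>. ennreal (norm (h (g (x + k, t)) - h (g (x, t))) powr q) \<partial>lborel)
          = (\<integral>\<^sup>+x\<in>S \<inter> cell \<Omega>. ennreal (norm (h (f (x + k, t)) - h (f (x, t))) powr q) \<partial>lborel)"
        by (intro nn_integral_cong_AE) auto
      also have "\<dots> = ?I" by (simp add: nn_integral_completion)
      finally have eq: "(\<integral>\<^sup>+x\<in>S \<inter> cell \<Omega>. ennreal (norm (h (g (x + k, t)) - h (g (x, t))) powr q) \<partial>lborel) = ?I" .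
      let ?Lq = "Lq_norm \<Omega> q S (\<lambda>x. h (f (x + k, t)) - h (f (x, t)))"
      have "?Lq / ennreal (norm k powr \<sigma>)
          \<le> (SUP h'\<in>admissible_shifts \<Omega> S. Lq_norm \<Omega> q S (\<lambda>x. h (f (x + h', t)) - h (f (x, t))) / ennreal (norm h' powr \<sigma>))"
        by (rule SUP_upper) (use 3 fr in \<open>simp add: admissible_shifts_def\<close>)
      also have "\<dots> \<le> besov_norm \<Omega> \<sigma> q S (\<lambda>x. h (f (x, t)))" by (simp add: besov_norm_def)
      also have "\<dots> \<le> ennreal B" unfolding B(2)[symmetric] by (rule SUP_upper) (use 3 in simp)
      finally have le: "?Lq / ennreal (norm k powr \<sigma>) \<le> ennreal B" .
      have k: "0 < norm k powr \<sigma>" using 3 by simp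
      have "?Lq = ?Lq / ennreal (norm k powr \<sigma>) * ennreal (norm k powr \<sigma>)"
        using k by (simp add: ennreal_divide_times)
      also have "\<dots> \<le> ennreal B * ennreal (norm k powr \<sigma>)" by (rule mult_right_mono[OF le]) simp
      finally have Lq: "?Lq \<le> ennreal (B * norm k powr \<sigma>)" using B(1) by (simp add: ennreal_mult)
      \<comment> \<open>\<open>Lq_norm\<close> is infinite whenever the integral is, so the finite
        bound excludes that case and the passage through \<open>enn2real\<close> loses
        nothing.\<close>
      then have fin: "?I \<noteq> \<infinity>" by (auto simp: Lq_norm_def Let_def top_unique)
      then have "ennreal (enn2real ?I powr (1 / q)) \<le> ennreal (B * norm k powr \<sigma>)"
        using Lq by (simp add: Lq_norm_def Let_def)
      then have "enn2real ?I powr (1 / q) \<le> B * norm k powr \<sigma>" using B(1) by (simp add: ennreal_le_iff)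
      then have "(enn2real ?I powr (1 / q)) powr q \<le> (B * norm k powr \<sigma>) powr q" using q by (intro powr_mono2) auto
      then have "enn2real ?I \<le> B powr q * norm k powr (\<sigma> * q)"
        using q B(1) by (simp add: powr_powr powr_mult)
      then have "ennreal (enn2real ?I) \<le> ennreal (B powr q * norm k powr (\<sigma> * q))" by (rule ennreal_leI)
      then show ?thesis unfolding eq
        by (subst (asm) ennreal_enn2real) (use fin in \<open>auto simp: top.not_eq_extremum\<close>)
    qed auto
  qed
  have "(\<integral>\<^sup>+z. ennreal (norm (h (g (z + (k, 0))) - h (g z)) powr q)
      \<partial>distr (density lborel (indicator (S \<inter> cell \<Omega>))) borel (\<lambda>x. (x, t))) \<le> ennreal (B powr q * norm (k, 0 :: real) powr (\<sigma> * q))"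
    for t k
    using main[of k t] by (subst nn_integral_space_shift) auto
  then show ?thesis unfolding shift_reg_def space_shifts_def by (intro exI[of _ "B powr q"]) auto
qed


section \<open>Regularity in space-time\<close>

lemma Lq_norm_le:
  assumes "(\<integral>\<^sup>+x\<in>O' \<inter> cell D. ennreal (norm (f x) powr q) \<partial>lebesgue) \<le> ennreal c" "0 \<le> c" "1 \<le> q"
  shows "Lq_norm D q O' f \<le> ennreal (c powr (1 / q))"
proof -
  let ?I = "\<integral>\<^sup>+x\<in>O' \<inter> cell D. ennreal (norm (f x) powr q) \<partial>lebesgue"
  have "?I \<noteq> \<infinity>" using assms(1) by (auto simp: top_unique)
  moreover have "enn2real ?I \<le> c" using assms by (simp add: enn2real_leI)
  ultimately show ?thesis
    using assms by (auto simp: Lq_norm_def Let_def intro!: ennreal_leI powr_mono2)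
qed

text \<open>If the shifted point left the region, the segment to it would meet the frontier at
  distance at most \<open>norm h\<close> from a point of \<open>O'\<close>. This matters because a
  function and its representative are compared only within the region.\<close>

lemma admissible_shift_in_region:
  fixes z :: "'a::euclidean_space"
  assumes "z \<in> O'" "O' \<subseteq> region D" "h \<in> admissible_shifts D O'"
  shows "z + h \<in> region D"
proof (rule ccontr)
  assume "z + h \<notin> region D"
  then have "closed_segment z (z + h) \<inter> frontier (region D) \<noteq> {}"
    using assms by (intro connected_Int_frontier) auto
  then obtain p where p: "p \<in> closed_segment z (z + h)" "p \<in> frontier (region D)" by blast
  have "setdist O' (frontier (region D)) \<le> dist z p" using assms(1) p(2) by (rule setdist_le_dist)
  also have "dist z p \<le> norm h" using segment_bound(1)[OF p(1)] by (simp add: dist_norm norm_minus_commute)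
  finally show False using assms(3) p(2) by (auto simp: admissible_shifts_def)
qed

lemma ereal_pos_ex_real: "0 < T \<Longrightarrow> \<exists>t. 0 < t \<and> ereal t < T"
  using ereal_dense2[of 0 T] by auto

text \<open>A nonempty compact set inside an open time interval attains its smallest and largest
  time, which leaves room for time shifts at both ends. In space the whole torus is itself compactly
  contained; in the whole space a ball is taken.\<close>

lemma compactly_in_spacetime_box:
  fixes O' :: "((real ^ 'n) \<times> real) set"
  assumes \<Omega>: "\<Omega> = whole_space \<or> \<Omega> = torus" and T: "0 < T" and O': "compactly_in (spacetime \<Omega> T) O'"
  obtains S a b where "compactly_in \<Omega> S" "0 < a" "a \<le> b" "ereal b < T"
    "O' \<inter> cell (spacetime \<Omega> T) \<subseteq> (S \<inter> cell \<Omega>) \<times> {a..b}" "bounded (S \<inter> cell \<Omega>)"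
proof -
  let ?O = "O' \<inter> cell (spacetime \<Omega> T)"
  have comp: "compact (closure ?O)" and sub: "closure ?O \<subseteq> UNIV \<times> {t. 0 < t \<and> ereal t < T}"
    using O' closure_mono[of ?O O'] region_spacetime[OF \<Omega>, of T] by (auto simp: compactly_in_def)
  have cell: "z \<in> ?O \<Longrightarrow> fst z \<in> cell \<Omega>" for z by (auto simp: spacetime_def)
  obtain a b where ab: "0 < a" "a \<le> b" "ereal b < T" "snd ` ?O \<subseteq> {a..b}"
  \<comment> \<open>An empty trace has no extreme times, so any admissible time serves as a
    degenerate interval.\<close>
  proof (cases "?O = {}")
    case True
    obtain t where "0 < t" "ereal t < T" using ereal_pos_ex_real[OF T] by blast
    then show ?thesis using that[of t t] True by auto
  next
    case False
    let ?J = "snd ` closure ?O"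
    have cJ: "compact ?J" by (intro compact_continuous_image comp continuous_intros)
    have nJ: "?J \<noteq> {}" using False closure_subset[of ?O] by blast
    obtain a where a: "a \<in> ?J" "\<forall>t\<in>?J. a \<le> t" using compact_attains_inf[OF cJ nJ] by (elim bexE)
    obtain b where b: "b \<in> ?J" "\<forall>t\<in>?J. t \<le> b" using compact_attains_sup[OF cJ nJ] by (elim bexE)
    note J = a b
    have "0 < t \<and> ereal t < T" if "t \<in> ?J" for t using sub that by auto
    then have "0 < a" "ereal b < T" using J by blast+
    moreover have "a \<le> b" using J by blast
    moreover have "snd ` ?O \<subseteq> {a..b}"
    proof
      fix t assume "t \<in> snd ` ?O"
      then have "t \<in> ?J" using image_mono[OF closure_subset[of ?O], of snd] by blast
      then have "a \<le> t" "t \<le> b" using J by blast+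
      then show "t \<in> {a..b}" by simp
    qed
    ultimately show ?thesis by (intro that[of a b])
  qed
  obtain S where S: "compactly_in \<Omega> S" "fst ` ?O \<subseteq> S" "bounded (S \<inter> cell \<Omega>)"
  proof (cases "\<Omega> = torus")
    case True
    have "compact (closure (cell (torus :: (real ^ 'n) flat_domain)))"
      using bounded_cell_torus by (simp add: compact_closure)
    then have "compactly_in \<Omega> UNIV"
      by (simp add: True compactly_in_def periodic_set_def) (simp add: torus_def)
    then show ?thesis using that[of UNIV] True bounded_cell_torus by simp
  next
    case False
    with \<Omega> have w: "\<Omega> = whole_space" by simp
    have "bounded (fst ` closure ?O)"
      by (intro compact_imp_bounded compact_continuous_image comp continuous_intros)
    then obtain r where r: "fst ` closure ?O \<subseteq> ball 0 r"
      using bounded_subset_ballD by blast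
    have "fst ` ?O \<subseteq> fst ` closure ?O" using closure_subset by blast
    moreover have "compactly_in \<Omega> (ball 0 r)"
      by (simp add: w compactly_in_def periodic_set_def whole_space_def compact_closure)
    ultimately show ?thesis using r that[of "ball 0 r"] by (auto intro: bounded_Int)
  qed
  have "?O \<subseteq> (S \<inter> cell \<Omega>) \<times> {a..b}"
  proof
    fix z assume "z \<in> ?O"
    then have "fst z \<in> S" "fst z \<in> cell \<Omega>" "snd z \<in> {a..b}" using S(2) ab(4) cell[of z] by blast+
    then show "z \<in> (S \<inter> cell \<Omega>) \<times> {a..b}" by (simp add: mem_Times_iff)
  qed
  with ab S show ?thesis using that by blast
qed

lemma norm_fst_snd_le: "norm (fst h) \<le> norm h" "norm (snd h) \<le> norm h"
  by (simp_all add: norm_prod_def real_le_rsqrt)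

text \<open>Short shifts are decomposed into a time shift followed by a spatial one. Admissible
  shifts may however be longer than those for which time regularity is known; for these the bound on
  \<open>g\<close> alone suffices, since \<open>norm h\<close> then stays away from 0 and the
  missing power costs only a constant.\<close>

proposition shift_reg_imp_besov_loc:
  fixes f g :: "(real ^ 'n) \<times> real \<Rightarrow> 'b::euclidean_space"
  assumes \<Omega>: "\<Omega> = whole_space \<or> \<Omega> = torus" and T: "0 < T" and q: "1 \<le> q" and \<sigma>: "0 \<le> \<sigma>"
    and f: "measurable_fun (spacetime \<Omega> T) f"
    and g [measurable]: "g \<in> borel_measurable borel" and gC: "\<And>z. norm (g z) \<le> C"
    and eq: "AE z in lborel. z \<in> region (spacetime \<Omega> T) \<longrightarrow> f z = g z"
    and space: "\<And>S. compactly_in \<Omega> S \<Longrightarrow> shift_reg (space_shifts (S \<inter> cell \<Omega>)) q \<sigma> g"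
    and time: "\<And>S a b. compactly_in \<Omega> S \<Longrightarrow> 0 < a \<Longrightarrow> a \<le> b \<Longrightarrow> ereal b < T
      \<Longrightarrow> \<exists>r>0. shift_reg (time_shifts (S \<inter> cell \<Omega>) a b r) q \<sigma> g"
  shows "f \<in> besov_loc (spacetime \<Omega> T) \<sigma> q"
proof -
  let ?D = "spacetime \<Omega> T"
  have "besov_norm ?D \<sigma> q O' f < \<infinity>" if O': "compactly_in ?D O'" for O'
  proof -
    obtain S a b where S: "compactly_in \<Omega> S" and ab: "0 < a" "a \<le> b" "ereal b < T"
      and sub: "O' \<inter> cell ?D \<subseteq> (S \<inter> cell \<Omega>) \<times> {a..b}" and bd: "bounded (S \<inter> cell \<Omega>)"
      using compactly_in_spacetime_box[OF \<Omega> T O'] by blast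
    define A where "A = S \<inter> cell \<Omega>"
    have [measurable]: "cell \<Omega> \<in> sets borel" by (rule cell_measurable[OF \<Omega>])
    have "S \<in> sets borel" using S by (auto simp: compactly_in_def)
    then have A [measurable]: "A \<in> sets borel" by (simp add: A_def)
    have Q [measurable]: "A \<times> {a..b} \<in> sets borel"
      using pair_measureI[OF A, of "{a..b}" borel] unfolding borel_prod by simp
    define m where "m = measure lborel (A \<times> {a..b})"
    have "emeasure lborel (A \<times> {a..b}) < \<infinity>"
      using bd by (intro emeasure_bounded_finite bounded_Times) (auto simp: A_def)
    then have m: "emeasure lborel (A \<times> {a..b}) = ennreal m" by (simp add: m_def emeasure_eq_ennreal_measure)
    have C: "0 \<le> C" using norm_ge_zero[of "g undefined"] gC[of undefined] by linarith
    obtain r where r: "r > 0" "shift_reg (time_shifts A a b r) q \<sigma> g"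
      using time[OF S ab] by (auto simp: A_def)
    obtain Ct where Ct: "Ct \<ge> 0" "\<And>M h. (M, h) \<in> time_shifts A a b r \<Longrightarrow>
        (\<integral>\<^sup>+z. ennreal (norm (g (z + h) - g z) powr q) \<partial>M) \<le> ennreal (Ct * norm h powr (\<sigma> * q))"
      using r(2) by (auto simp: shift_reg_def)
    obtain Cs where Cs: "Cs \<ge> 0" "\<And>M h. (M, h) \<in> space_shifts A \<Longrightarrow>
        (\<integral>\<^sup>+z. ennreal (norm (g (z + h) - g z) powr q) \<partial>M) \<le> ennreal (Cs * norm h powr (\<sigma> * q))"
      using space[OF S] by (auto simp: shift_reg_def A_def)
    define r0 where "r0 = min r 1"
    have r0: "0 < r0" "r0 \<le> r" "r0 \<le> 1" using r by (auto simp: r0_def)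
    have O_reg: "O' \<subseteq> region ?D" using O' closure_subset by (auto simp: compactly_in_def)
    \<comment> \<open>The sum of the constants for short and for long shifts. In the first,
      \<open>b - a\<close> arises from integrating the uniform spatial bound over time; in the
      second, division by a power of \<open>r0\<close> creates the power of
      \<open>norm h\<close>.\<close>
    define K where "K = 2 powr q * ((b - a) * Cs + Ct) + (2 * C) powr q * m / r0 powr (\<sigma> * q)"
    have m0: "0 \<le> m" by (simp add: m_def)
    have K: "0 \<le> K" using ab Cs Ct m0 by (simp add: K_def)
    have near: "(\<integral>\<^sup>+z\<in>A \<times> {a..b}. ennreal (norm (g (z + h) - g z) powr q) \<partial>lborel)
        \<le> ennreal (2 powr q * ((b - a) * Cs + Ct) * norm h powr (\<sigma> * q))" if h: "norm h \<le> r0" for h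
    proof -
      let ?k = "fst h" and ?\<tau> = "snd h"
      have k: "norm ?k \<le> 1" "\<bar>?\<tau>\<bar> \<le> r" using h r0 norm_fst_snd_le[of h] by auto
      have pw: "norm (c + d) powr q \<le> 2 powr q * (norm c powr q + norm d powr q)" for c d :: 'b
      proof -
        have "norm (c + d) powr q \<le> (2 * max (norm c) (norm d)) powr q"
          using q norm_triangle_ineq[of c d] by (intro powr_mono2) auto
        also have "\<dots> = 2 powr q * max (norm c) (norm d) powr q" by (simp add: powr_mult)
        also have "max (norm c) (norm d) powr q \<le> norm c powr q + norm d powr q" by (auto simp: max_def)
        finally show ?thesis by simp
      qed
      \<comment> \<open>The spatial increment is taken after the time shift, hence on the slice at
        \<open>t + \<tau>\<close>; the spatial bound is available there because it holds at every
        real time.\<close>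
      let ?f1 = "\<lambda>z. ennreal (norm (g (z + (0, ?\<tau>) + (?k, 0)) - g (z + (0, ?\<tau>))) powr q)"
      let ?f2 = "\<lambda>z. ennreal (norm (g (z + (0, ?\<tau>)) - g z) powr q)"
      have "(\<integral>\<^sup>+z\<in>A \<times> {a..b}. ennreal (norm (g (z + h) - g z) powr q) \<partial>lborel)
          \<le> (\<integral>\<^sup>+z. ennreal (2 powr q) * (?f1 z * indicator (A \<times> {a..b}) z + ?f2 z * indicator (A \<times> {a..b}) z) \<partial>lborel)"
      proof (rule nn_integral_mono)
        fix z
        have zh: "z + (0, ?\<tau>) + (?k, 0) = z + h" by (cases z; cases h) simp
        have "norm (g (z + h) - g z) powr q \<le> 2 powr q * (norm (g (z + (0, ?\<tau>) + (?k, 0)) - g (z + (0, ?\<tau>))) powr q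
            + norm (g (z + (0, ?\<tau>)) - g z) powr q)"
          using pw[of "g (z + h) - g (z + (0, ?\<tau>))" "g (z + (0, ?\<tau>)) - g z"] unfolding zh by simp
        then show "ennreal (norm (g (z + h) - g z) powr q) * indicator (A \<times> {a..b}) z
            \<le> ennreal (2 powr q) * (?f1 z * indicator (A \<times> {a..b}) z + ?f2 z * indicator (A \<times> {a..b}) z)"
          by (auto simp: indicator_def simp flip: ennreal_mult ennreal_plus intro: ennreal_leI)
      qed
      also have "\<dots> = ennreal (2 powr q) * ((\<integral>\<^sup>+z\<in>A \<times> {a..b}. ?f1 z \<partial>lborel) + (\<integral>\<^sup>+z\<in>A \<times> {a..b}. ?f2 z \<partial>lborel))"
      proof -
        have "(\<lambda>z. ?f1 z * indicator (A \<times> {a..b}) z) \<in> borel_measurable lborel"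
          "(\<lambda>z. ?f2 z * indicator (A \<times> {a..b}) z) \<in> borel_measurable lborel"
          by measurable
        then show ?thesis by (simp only: nn_integral_cmult nn_integral_add borel_measurable_add)
      qed
      finally have 1: "(\<integral>\<^sup>+z\<in>A \<times> {a..b}. ennreal (norm (g (z + h) - g z) powr q) \<partial>lborel)
          \<le> ennreal (2 powr q) * ((\<integral>\<^sup>+z\<in>A \<times> {a..b}. ?f1 z \<partial>lborel) + (\<integral>\<^sup>+z\<in>A \<times> {a..b}. ?f2 z \<partial>lborel))" .
      have 2: "(\<integral>\<^sup>+z\<in>A \<times> {a..b}. ?f2 z \<partial>lborel) \<le> ennreal (Ct * norm h powr (\<sigma> * q))"
      proof -
        have "(\<integral>\<^sup>+z\<in>A \<times> {a..b}. ?f2 z \<partial>lborel) = (\<integral>\<^sup>+z. ?f2 z \<partial>density lborel (indicator (A \<times> {a..b})))"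
          by (subst nn_integral_density) (auto simp: mult.commute)
        also have "\<dots> \<le> ennreal (Ct * norm (0 :: real ^ 'n, ?\<tau>) powr (\<sigma> * q))"
          by (rule Ct(2)) (use k in \<open>auto simp: time_shifts_def\<close>)
        also have "\<dots> \<le> ennreal (Ct * norm h powr (\<sigma> * q))"
          using Ct(1) q \<sigma> norm_fst_snd_le(2)[of h]
          by (intro ennreal_leI mult_left_mono powr_mono2) (auto simp: norm_Pair)
        finally show ?thesis .
      qed
      have 3: "(\<integral>\<^sup>+z\<in>A \<times> {a..b}. ?f1 z \<partial>lborel) \<le> ennreal ((b - a) * Cs * norm h powr (\<sigma> * q))"
      proof -
        have "(\<integral>\<^sup>+z\<in>A \<times> {a..b}. ?f1 z \<partial>lborel) = (\<integral>\<^sup>+z. ?f1 z \<partial>density lborel (indicator (A \<times> {a..b})))"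
          by (subst nn_integral_density) (auto simp: mult.commute)
        also have "\<dots> = (\<integral>\<^sup>+t\<in>{a..b}. (\<integral>\<^sup>+x\<in>A. ?f1 (x, t) \<partial>lborel) \<partial>lborel)"
          by (rule nn_integral_time_shift) measurable
        also have "\<dots> \<le> (\<integral>\<^sup>+t\<in>{a..b}. ennreal (Cs * norm h powr (\<sigma> * q)) \<partial>lborel)"
        proof (intro nn_integral_mono mult_right_mono)
          fix t
          have "(\<integral>\<^sup>+x\<in>A. ?f1 (x, t) \<partial>lborel)
              = (\<integral>\<^sup>+z. ennreal (norm (g (z + (?k, 0)) - g z) powr q) \<partial>distr (density lborel (indicator A)) borel (\<lambda>x. (x, t + ?\<tau>)))"
            by (subst nn_integral_space_shift) auto
          also have "\<dots> \<le> ennreal (Cs * norm (?k, 0 :: real) powr (\<sigma> * q))"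
            by (rule Cs(2)) (use k in \<open>auto simp: space_shifts_def\<close>)
          also have "\<dots> \<le> ennreal (Cs * norm h powr (\<sigma> * q))"
            using Cs(1) q \<sigma> norm_fst_snd_le(1)[of h]
            by (intro ennreal_leI mult_left_mono powr_mono2) (auto simp: norm_Pair)
          finally show "(\<integral>\<^sup>+x\<in>A. ?f1 (x, t) \<partial>lborel) \<le> ennreal (Cs * norm h powr (\<sigma> * q))" .
        qed simp
        also have "\<dots> = ennreal ((b - a) * Cs * norm h powr (\<sigma> * q))"
          using ab Cs(1) by (subst nn_integral_cmult_indicator) (auto simp: mult_ac simp flip: ennreal_mult)
        finally show ?thesis .
      qed
      note 1
      also have "ennreal (2 powr q) * ((\<integral>\<^sup>+z\<in>A \<times> {a..b}. ?f1 z \<partial>lborel) + (\<integral>\<^sup>+z\<in>A \<times> {a..b}. ?f2 z \<partial>lborel))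
          \<le> ennreal (2 powr q) * (ennreal ((b - a) * Cs * norm h powr (\<sigma> * q)) + ennreal (Ct * norm h powr (\<sigma> * q)))"
        by (intro mult_left_mono add_mono 2 3) simp
      also have "\<dots> = ennreal (2 powr q * ((b - a) * Cs + Ct) * norm h powr (\<sigma> * q))"
      proof -
        have nn: "0 \<le> (b - a) * Cs * norm h powr (\<sigma> * q)" "0 \<le> Ct * norm h powr (\<sigma> * q)"
          using ab Cs(1) Ct(1) by auto
        show ?thesis
          unfolding ennreal_plus[OF nn, symmetric] using nn
          by (subst ennreal_mult[symmetric]) (auto simp: algebra_simps)
      qed
      finally show ?thesis .
    qed
    have far: "(\<integral>\<^sup>+z\<in>A \<times> {a..b}. ennreal (norm (g (z + h) - g z) powr q) \<partial>lborel)
        \<le> ennreal ((2 * C) powr q * m / r0 powr (\<sigma> * q) * norm h powr (\<sigma> * q))" if h: "r0 \<le> norm h" for h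
    proof -
      have "norm (g (z + h) - g z) powr q \<le> (2 * C) powr q" for z
        using norm_triangle_ineq4[of "g (z + h)" "g z"] gC[of "z + h"] gC[of z] q by (intro powr_mono2) auto
      then have "(\<integral>\<^sup>+z\<in>A \<times> {a..b}. ennreal (norm (g (z + h) - g z) powr q) \<partial>lborel)
          \<le> (\<integral>\<^sup>+z\<in>A \<times> {a..b}. ennreal ((2 * C) powr q) \<partial>lborel)"
        by (intro nn_integral_mono mult_right_mono ennreal_leI) auto
      also have "\<dots> = ennreal ((2 * C) powr q * m)"
        using m0 by (subst nn_integral_cmult_indicator) (auto simp: m simp flip: ennreal_mult)
      also have "\<dots> \<le> ennreal ((2 * C) powr q * m / r0 powr (\<sigma> * q) * norm h powr (\<sigma> * q))"
      proof (rule ennreal_leI)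
        have "r0 powr (\<sigma> * q) \<le> norm h powr (\<sigma> * q)" using h r0 q \<sigma> by (intro powr_mono2) auto
        then have "1 \<le> norm h powr (\<sigma> * q) / r0 powr (\<sigma> * q)" using r0 by simp
        then have "(2 * C) powr q * m * 1 \<le> (2 * C) powr q * m * (norm h powr (\<sigma> * q) / r0 powr (\<sigma> * q))"
          using m0 by (intro mult_left_mono) auto
        then show "(2 * C) powr q * m \<le> (2 * C) powr q * m / r0 powr (\<sigma> * q) * norm h powr (\<sigma> * q)" by simp
      qed
      finally show ?thesis .
    qed
    have all: "(\<integral>\<^sup>+z\<in>A \<times> {a..b}. ennreal (norm (g (z + h) - g z) powr q) \<partial>lborel)
        \<le> ennreal (K * norm h powr (\<sigma> * q))" for h
    proof (cases "norm h \<le> r0")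
      case True
      have "2 powr q * ((b - a) * Cs + Ct) \<le> K" using m0 by (simp add: K_def)
      then show ?thesis by (intro order_trans[OF near[OF True]] ennreal_leI mult_right_mono) auto
    next
      case False
      have "(2 * C) powr q * m / r0 powr (\<sigma> * q) \<le> K" using ab Cs(1) Ct(1) by (simp add: K_def)
      then show ?thesis using False by (intro order_trans[OF far] ennreal_leI mult_right_mono) auto
    qed
    have diff: "Lq_norm ?D q O' (\<lambda>x. f (x + h) - f x) / ennreal (norm h powr \<sigma>) \<le> ennreal (K powr (1 / q))"
      if h: "h \<in> admissible_shifts ?D O'" for h
    proof -
      have h0: "h \<noteq> 0" using h by (simp add: admissible_shifts_def)
      have "(\<integral>\<^sup>+z\<in>O' \<inter> cell ?D. ennreal (norm (f (z + h) - f z) powr q) \<partial>lebesgue)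
          = (\<integral>\<^sup>+z\<in>O' \<inter> cell ?D. ennreal (norm (f (z + h) - f z) powr q) \<partial>lborel)"
        by (rule nn_integral_completion)
      also have "\<dots> \<le> (\<integral>\<^sup>+z\<in>A \<times> {a..b}. ennreal (norm (g (z + h) - g z) powr q) \<partial>lborel)"
      proof (rule nn_integral_mono_AE)
        show "AE z in lborel. ennreal (norm (f (z + h) - f z) powr q) * indicator (O' \<inter> cell ?D) z
            \<le> ennreal (norm (g (z + h) - g z) powr q) * indicator (A \<times> {a..b}) z"
          using eq AE_lborel_shift[OF eq, of h]
        proof eventually_elim
          case (elim z)
          show ?case
          proof (cases "z \<in> O' \<inter> cell ?D")
            case True
            then have "z \<in> A \<times> {a..b}" using sub by (auto simp: A_def)
            moreover have "f z = g z" using elim True O_reg by auto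
            moreover have "f (z + h) = g (z + h)" using elim admissible_shift_in_region[OF _ O_reg h, of z] True by auto
            ultimately show ?thesis using True by simp
          qed simp
        qed
      qed
      also note all
      finally have "Lq_norm ?D q O' (\<lambda>x. f (x + h) - f x) \<le> ennreal ((K * norm h powr (\<sigma> * q)) powr (1 / q))"
        using K q by (intro Lq_norm_le) auto
      also have "(K * norm h powr (\<sigma> * q)) powr (1 / q) = norm h powr \<sigma> * K powr (1 / q)"
        using K q by (simp add: powr_mult powr_powr mult.commute)
      finally have "Lq_norm ?D q O' (\<lambda>x. f (x + h) - f x) \<le> ennreal (norm h powr \<sigma>) * ennreal (K powr (1 / q))"
        by (simp add: ennreal_mult)
      then show ?thesis using h0 by (intro divide_le_posI_ennreal) auto
    qed
    have "Lq_norm ?D q O' f \<le> ennreal ((C powr q * m) powr (1 / q))"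
    proof (rule Lq_norm_le)
      have "(\<integral>\<^sup>+z\<in>O' \<inter> cell ?D. ennreal (norm (f z) powr q) \<partial>lebesgue)
          = (\<integral>\<^sup>+z\<in>O' \<inter> cell ?D. ennreal (norm (f z) powr q) \<partial>lborel)"
        by (rule nn_integral_completion)
      also have "\<dots> \<le> (\<integral>\<^sup>+z\<in>A \<times> {a..b}. ennreal (C powr q) \<partial>lborel)"
      proof (rule nn_integral_mono_AE)
        show "AE z in lborel. ennreal (norm (f z) powr q) * indicator (O' \<inter> cell ?D) z
            \<le> ennreal (C powr q) * indicator (A \<times> {a..b}) z"
          using eq
        proof eventually_elim
          case (elim z)
          show ?case
          proof (cases "z \<in> O' \<inter> cell ?D")
            case True
            then have "z \<in> A \<times> {a..b}" using sub by (auto simp: A_def)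
            moreover have "f z = g z" using elim True O_reg by auto
            ultimately show ?thesis using True gC[of z] q by (auto intro!: ennreal_leI powr_mono2)
          qed simp
        qed
      qed
      also have "\<dots> = ennreal (C powr q * m)"
        using m0 by (subst nn_integral_cmult_indicator) (auto simp: m simp flip: ennreal_mult)
      finally show "(\<integral>\<^sup>+z\<in>O' \<inter> cell ?D. ennreal (norm (f z) powr q) \<partial>lebesgue) \<le> ennreal (C powr q * m)" .
    qed (use m0 q in auto)
    moreover have "(SUP h\<in>admissible_shifts ?D O'. Lq_norm ?D q O' (\<lambda>x. f (x + h) - f x) / ennreal (norm h powr \<sigma>))
        \<le> ennreal (K powr (1 / q))"
      by (rule SUP_least[OF diff])
    ultimately have "besov_norm ?D \<sigma> q O' f \<le> ennreal ((C powr q * m) powr (1 / q)) + ennreal (K powr (1 / q))"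
      unfolding besov_norm_def by (rule add_mono)
    also have "\<dots> < \<infinity>" by (simp flip: ennreal_plus)
    finally show ?thesis .
  qed
  with f show ?thesis by (simp add: besov_loc_def)
qed


section \<open>Bounded Lipschitz functions and the equation of state\<close>

text \<open>Boundedness is part of the notion because products of Lipschitz functions are Lipschitz
  only when the factors are bounded. The one constant \<open>L\<close> serves both purposes.\<close>

definition bounded_lipschitz :: "'a::real_normed_vector set \<Rightarrow> ('a \<Rightarrow> 'b::real_normed_vector) \<Rightarrow> bool" where
  "bounded_lipschitz X f \<longleftrightarrow> (\<exists>L\<ge>0. \<forall>x\<in>X. norm (f x) \<le> L \<and> (\<forall>y\<in>X. norm (f x - f y) \<le> L * norm (x - y)))"

lemma blipI:
  assumes "\<And>x. x \<in> X \<Longrightarrow> norm (f x) \<le> B" "\<And>x y. x \<in> X \<Longrightarrow> y \<in> X \<Longrightarrow> norm (f x - f y) \<le> L * norm (x - y)"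
  shows "bounded_lipschitz X f"
  unfolding bounded_lipschitz_def
proof (intro exI[of _ "max 0 (max B L)"] conjI ballI)
  show "norm (f x) \<le> max 0 (max B L)" if "x \<in> X" for x using assms(1)[OF that] by simp
  show "norm (f x - f y) \<le> max 0 (max B L) * norm (x - y)" if "x \<in> X" "y \<in> X" for x y
    by (rule order_trans[OF assms(2)[OF that]]) (intro mult_right_mono; simp)
qed simp

lemma bounded_lipschitz_add:
  assumes "bounded_lipschitz X f" "bounded_lipschitz X g" shows "bounded_lipschitz X (\<lambda>x. f x + g x)"
proof -
  obtain L where L: "L \<ge> 0" "\<And>x. x \<in> X \<Longrightarrow> norm (f x) \<le> L" "\<And>x y. x \<in> X \<Longrightarrow> y \<in> X \<Longrightarrow> norm (f x - f y) \<le> L * norm (x - y)"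
    using assms(1) unfolding bounded_lipschitz_def by blast
  obtain K where K: "K \<ge> 0" "\<And>x. x \<in> X \<Longrightarrow> norm (g x) \<le> K" "\<And>x y. x \<in> X \<Longrightarrow> y \<in> X \<Longrightarrow> norm (g x - g y) \<le> K * norm (x - y)"
    using assms(2) unfolding bounded_lipschitz_def by blast
  show ?thesis
  proof (rule blipI)
    show "norm (f x + g x) \<le> L + K" if "x \<in> X" for x
      using norm_triangle_mono[OF L(2)[OF that] K(2)[OF that]] .
    show "norm (f x + g x - (f y + g y)) \<le> (L + K) * norm (x - y)" if "x \<in> X" "y \<in> X" for x y
    proof -
      have "norm (f x + g x - (f y + g y)) = norm ((f x - f y) + (g x - g y))" by (simp add: algebra_simps)
      also have "\<dots> \<le> L * norm (x - y) + K * norm (x - y)"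
        using norm_triangle_mono[OF L(3)[OF that] K(3)[OF that]] .
      finally show ?thesis by (simp add: distrib_right)
    qed
  qed
qed

lemma bounded_lipschitz_const: "bounded_lipschitz X (\<lambda>x. c)"
  by (rule blipI[where B = "norm c" and L = 0]) auto

lemma bounded_lipschitz_bounded_linear:
  assumes "bounded_linear l" "bounded X" shows "bounded_lipschitz X l"
proof -
  obtain K where K: "\<And>x. norm (l x) \<le> norm x * K" "0 \<le> K"
    using bounded_linear.nonneg_bounded[OF assms(1)] by blast
  obtain B where B: "\<And>x. x \<in> X \<Longrightarrow> norm x \<le> B" using assms(2) by (auto simp: bounded_iff)
  show ?thesis
  proof (rule blipI)
    show "norm (l x) \<le> B * K" if "x \<in> X" for x
      by (rule order_trans[OF K(1)]) (intro mult_right_mono B K that)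
    show "norm (l x - l y) \<le> K * norm (x - y)" for x y
      using K(1)[of "x - y"] assms(1) by (simp add: linear_simps mult.commute)
  qed
qed

text \<open>Changing one factor at a time, as in the product rule. Scaling of vectors,
  multiplication and the inner product are all instances, which covers every flux of the
  system.\<close>

lemma bounded_lipschitz_bilinear:
  assumes "bounded_bilinear pr" "bounded_lipschitz X f" "bounded_lipschitz X g" shows "bounded_lipschitz X (\<lambda>x. pr (f x) (g x))"
proof -
  interpret bounded_bilinear pr by fact
  obtain C where C: "\<And>a b. norm (pr a b) \<le> norm a * norm b * C" "0 \<le> C" using nonneg_bounded by blast
  obtain L where L: "L \<ge> 0" "\<And>x. x \<in> X \<Longrightarrow> norm (f x) \<le> L" "\<And>x y. x \<in> X \<Longrightarrow> y \<in> X \<Longrightarrow> norm (f x - f y) \<le> L * norm (x - y)"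
    using assms(2) unfolding bounded_lipschitz_def by blast
  obtain K where K: "K \<ge> 0" "\<And>x. x \<in> X \<Longrightarrow> norm (g x) \<le> K" "\<And>x y. x \<in> X \<Longrightarrow> y \<in> X \<Longrightarrow> norm (g x - g y) \<le> K * norm (x - y)"
    using assms(3) unfolding bounded_lipschitz_def by blast
  show ?thesis
  proof (rule blipI)
    show "norm (pr (f x) (g x)) \<le> L * K * C" if "x \<in> X" for x
      using that L K C by (intro order_trans[OF C(1)] mult_right_mono mult_mono) auto
    show "norm (pr (f x) (g x) - pr (f y) (g y)) \<le> (2 * L * K * C) * norm (x - y)" if x: "x \<in> X" and y: "y \<in> X" for x y
    proof -
      have "pr (f x) (g x) - pr (f y) (g y) = pr (f x - f y) (g x) + pr (f y) (g x - g y)"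
        by (simp add: diff_left diff_right)
      then have "norm (pr (f x) (g x) - pr (f y) (g y)) \<le> norm (pr (f x - f y) (g x)) + norm (pr (f y) (g x - g y))"
        by (simp add: norm_triangle_ineq)
      also have "norm (pr (f x - f y) (g x)) \<le> L * norm (x - y) * K * C"
        using x y L K C by (intro order_trans[OF C(1)] mult_right_mono mult_mono) auto
      also have "norm (pr (f y) (g x - g y)) \<le> L * (K * norm (x - y)) * C"
        using x y L K C by (intro order_trans[OF C(1)] mult_right_mono mult_mono) auto
      finally show ?thesis by (simp add: mult_ac)
    qed
  qed
qed

lemmas bounded_lipschitz_scaleR = bounded_lipschitz_bilinear[OF bounded_bilinear_scaleR]
lemmas bounded_lipschitz_mult = bounded_lipschitz_bilinear[OF bounded_bilinear_mult]
lemmas bounded_lipschitz_inner = bounded_lipschitz_bilinear[OF bounded_bilinear_inner]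

lemma bounded_lipschitz_compose:
  assumes "bounded_lipschitz Y g" "bounded_lipschitz X f" "f ` X \<subseteq> Y" shows "bounded_lipschitz X (\<lambda>x. g (f x))"
proof -
  obtain L where L: "L \<ge> 0" "\<And>x. x \<in> X \<Longrightarrow> norm (f x) \<le> L" "\<And>x y. x \<in> X \<Longrightarrow> y \<in> X \<Longrightarrow> norm (f x - f y) \<le> L * norm (x - y)"
    using assms(2) unfolding bounded_lipschitz_def by blast
  obtain K where K: "K \<ge> 0" "\<And>x. x \<in> Y \<Longrightarrow> norm (g x) \<le> K" "\<And>x y. x \<in> Y \<Longrightarrow> y \<in> Y \<Longrightarrow> norm (g x - g y) \<le> K * norm (x - y)"
    using assms(1) unfolding bounded_lipschitz_def by blast
  show ?thesis
  proof (rule blipI)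
    show "norm (g (f x)) \<le> K" if "x \<in> X" for x using K(2) assms(3) that by blast
    show "norm (g (f x) - g (f y)) \<le> (K * L) * norm (x - y)" if "x \<in> X" "y \<in> X" for x y
    proof -
      have "norm (g (f x) - g (f y)) \<le> K * norm (f x - f y)" using K(3) assms(3) that by blast
      also have "\<dots> \<le> K * (L * norm (x - y))" using L(3)[OF that] K(1) by (rule mult_left_mono)
      finally show ?thesis by simp
    qed
  qed
qed

text \<open>The difference of the inverses is the difference of the arguments divided by their
  product, and the product is bounded below. The lemma serves to recover the velocity from the
  momentum.\<close>

lemma bounded_lipschitz_inverse:
  fixes f :: "'a::real_normed_vector \<Rightarrow> real"
  assumes "bounded_lipschitz X f" "0 < \<delta>" "\<And>x. x \<in> X \<Longrightarrow> \<delta> \<le> f x" shows "bounded_lipschitz X (\<lambda>x. inverse (f x))"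
proof (rule bounded_lipschitz_compose[OF _ assms(1)])
  show "f ` X \<subseteq> {\<delta>..}" using assms(3) by auto
  show "bounded_lipschitz {\<delta>..} (inverse :: real \<Rightarrow> real)"
  proof (rule blipI)
    show "norm (inverse x) \<le> inverse \<delta>" if "x \<in> {\<delta>..}" for x
      using that assms(2) by (auto intro: le_imp_inverse_le)
    show "norm (inverse x - inverse y) \<le> (inverse \<delta> * inverse \<delta>) * norm (x - y)" if "x \<in> {\<delta>..}" "y \<in> {\<delta>..}" for x y
    proof -
      have pos: "0 < x" "0 < y" using that assms(2) by auto
      have "inverse x - inverse y = inverse x * inverse y * (y - x)" using pos by (simp add: field_simps)
      then have "norm (inverse x - inverse y) = inverse x * inverse y * norm (x - y)"
        using pos by (simp add: abs_mult abs_minus_commute)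
      also have "\<dots> \<le> inverse \<delta> * inverse \<delta> * norm (x - y)"
        using that assms(2) pos by (intro mult_right_mono mult_mono le_imp_inverse_le) auto
      finally show ?thesis .
    qed
  qed
qed

lemma bounded_lipschitz_measurable:
  fixes \<Phi> :: "'b::euclidean_space \<Rightarrow> 'c::euclidean_space"
  assumes "bounded_lipschitz X \<Phi>" "X \<in> sets borel" "g \<in> borel_measurable M" "\<And>z. g z \<in> X"
  shows "(\<lambda>z. \<Phi> (g z)) \<in> borel_measurable M"
proof -
  obtain L where L: "L \<ge> 0" "\<And>x y. x \<in> X \<Longrightarrow> y \<in> X \<Longrightarrow> norm (\<Phi> x - \<Phi> y) \<le> L * norm (x - y)"
    using assms(1) unfolding bounded_lipschitz_def by blast
  then have "L-lipschitz_on X \<Phi>" by (auto simp: lipschitz_on_def dist_norm)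
  then have "\<Phi> \<in> borel_measurable (restrict_space borel X)"
    by (intro borel_measurable_continuous_on_restrict lipschitz_on_continuous_on)
  moreover have "g \<in> M \<rightarrow>\<^sub>M restrict_space borel X"
    using assms by (intro measurable_restrict_space2) auto
  ultimately show ?thesis by (rule measurable_compose[rotated])
qed

lemma shift_reg_blip:
  assumes "small_shifts J" "1 \<le> q" "g \<in> borel_measurable borel" "shift_reg J q \<sigma> g" "bounded_lipschitz X \<Phi>" "\<And>z. g z \<in> X"
  shows "shift_reg J q \<sigma> (\<lambda>z. \<Phi> (g z))"
proof -
  obtain L where L: "L \<ge> 0" "\<And>x y. x \<in> X \<Longrightarrow> y \<in> X \<Longrightarrow> norm (\<Phi> x - \<Phi> y) \<le> L * norm (x - y)"
    using assms(5) unfolding bounded_lipschitz_def by blast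
  then have lip: "L-lipschitz_on X \<Phi>" by (auto simp: lipschitz_on_def dist_norm)
  have "0 \<le> q" using assms(2) by simp
  from shift_reg_lipschitz[OF assms(1) this assms(3,4) lip assms(6)] show ?thesis .
qed

text \<open>A point outside the essential range has a basic open neighbourhood with null preimage. A
  countable basis contains only countably many such sets, so together their preimages are
  null.\<close>

lemma AE_in_ess_range:
  fixes f :: "'a::euclidean_space \<Rightarrow> 'b::euclidean_space"
  assumes R: "region D \<in> sets lebesgue" and f: "f \<in> borel_measurable (lebesgue_on (region D))"
  shows "AE x in lebesgue_on (region D). f x \<in> ess_range D f"
proof -
  have meas: "{x \<in> region D. f x \<in> B} \<in> sets lebesgue" if "B \<in> sets borel" for B
  proof -
    have "f -` B \<inter> space (lebesgue_on (region D)) \<in> sets (lebesgue_on (region D))"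
      by (rule measurable_sets[OF f that])
    then have "f -` B \<inter> region D \<in> sets lebesgue"
      using R by (auto simp: sets_restrict_space)
    moreover have "f -` B \<inter> region D = {x \<in> region D. f x \<in> B}" by auto
    ultimately show ?thesis by simp
  qed
  obtain \<B> :: "'b set set" where \<B>: "countable \<B>" "topological_basis \<B>"
    using ex_countable_basis by blast
  define \<N> where "\<N> = {B \<in> \<B>. emeasure lebesgue {x \<in> region D. f x \<in> B} = 0}"
  have op: "B \<in> sets borel" if "B \<in> \<B>" for B using topological_basis_open[OF \<B>(2) that] by simp
  have "AE x in lebesgue. \<forall>B\<in>\<N>. \<not> (x \<in> region D \<and> f x \<in> B)"
  proof (subst AE_ball_countable)
    show "countable \<N>" using \<B>(1) by (simp add: \<N>_def)
    show "\<forall>B\<in>\<N>. AE x in lebesgue. \<not> (x \<in> region D \<and> f x \<in> B)"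
    proof
      fix B assume "B \<in> \<N>"
      then have "{x \<in> region D. f x \<in> B} \<in> null_sets lebesgue"
        using meas[OF op] by (auto simp: \<N>_def null_sets_def)
      from AE_not_in[OF this] show "AE x in lebesgue. \<not> (x \<in> region D \<and> f x \<in> B)" by simp
    qed
  qed
  moreover have "\<exists>B\<in>\<N>. y \<in> B" if y: "y \<notin> ess_range D f" for y
  proof -
    obtain \<epsilon> where \<epsilon>: "\<epsilon> > 0" "emeasure lebesgue {x \<in> region D. dist (f x) y < \<epsilon>} = 0"
      using y by (auto simp: ess_range_def not_less)
    obtain B where B: "B \<in> \<B>" "y \<in> B" "B \<subseteq> ball y \<epsilon>"
      using topological_basisE[OF \<B>(2) open_ball, of y y \<epsilon>] \<epsilon>(1) by auto
    have "emeasure lebesgue {x \<in> region D. f x \<in> B} \<le> emeasure lebesgue {x \<in> region D. f x \<in> ball y \<epsilon>}"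
      using B(3) by (intro emeasure_mono meas) auto
    also have "{x \<in> region D. f x \<in> ball y \<epsilon>} = {x \<in> region D. dist (f x) y < \<epsilon>}" by (auto simp: dist_commute)
    finally have "B \<in> \<N>" using B(1) \<epsilon>(2) by (simp add: \<N>_def)
    with B(2) show ?thesis by blast
  qed
  ultimately have "AE x in lebesgue. x \<in> region D \<longrightarrow> f x \<in> ess_range D f"
    by (auto elim!: eventually_mono)
  then show ?thesis using R by (subst AE_restrict_space_iff) auto
qed

text \<open>A point of norm larger than \<open>C\<close> is the centre of a ball of radius
  \<open>norm y - C\<close>, which the values of \<open>f\<close> miss almost everywhere.\<close>

lemma bounded_ess_range:
  fixes f :: "'a::euclidean_space \<Rightarrow> 'b::euclidean_space"
  assumes R: "region D \<in> sets lebesgue" and b: "AE x in lebesgue_on (region D). norm (f x) \<le> C"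
  shows "bounded (ess_range D f)"
proof -
  have ae: "AE x in lebesgue. x \<in> region D \<longrightarrow> norm (f x) \<le> C"
    using b R by (subst (asm) AE_restrict_space_iff) auto
  have "norm y \<le> C" if y: "y \<in> ess_range D f" for y
  proof (rule ccontr)
    assume "\<not> norm y \<le> C"
    then have "0 < norm y - C" by simp
    with y have pos: "0 < emeasure lebesgue {x \<in> region D. dist (f x) y < norm y - C}" by (auto simp: ess_range_def)
    have "AE x in lebesgue. x \<notin> {x \<in> region D. dist (f x) y < norm y - C}"
      using ae
    proof eventually_elim
      case (elim x)
      have "norm y - norm (f x) \<le> dist (f x) y" by (simp add: dist_norm norm_minus_commute norm_triangle_ineq2)
      with elim show ?case by auto
    qed
    then obtain N where N: "N \<in> null_sets lebesgue" "{x \<in> region D. dist (f x) y < norm y - C} \<subseteq> N"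
      unfolding eventually_ae_filter by auto
    then have "{x \<in> region D. dist (f x) y < norm y - C} \<in> null_sets lebesgue"
      using null_sets_completion_subset by blast
    with pos show False by (auto simp: null_sets_def)
  qed
  then show ?thesis by (auto simp: bounded_iff)
qed

section \<open>Lipschitz bound for the equation of state\<close>

lemma Ck_on_continuous: "Ck_on k U f \<Longrightarrow> continuous_on U f"
proof (cases k)
  case (Suc m)
  assume "Ck_on k U f"
  then obtain f' where "\<forall>x\<in>U. (f has_derivative f' x) (at x)" using Suc by auto
  then have "(f has_derivative f' x) (at x within U)" if "x \<in> U" for x
    using that has_derivative_at_withinI by blast
  then show ?thesis by (rule has_derivative_continuous_on)
qed simp

text \<open>The mean value inequality on a convex compact set. \<open>Ck_on\<close> gives continuity
  of the derivative one direction at a time, so the operator norm is bounded through the two partial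
  derivatives.\<close>

lemma bounded_lipschitz_C1:
  fixes p :: "real \<times> real \<Rightarrow> real"
  assumes p: "Ck_on (Suc k) U p" and K: "compact K" "convex K" "K \<subseteq> U"
  shows "bounded_lipschitz K p"
proof -
  obtain p' where p': "\<And>x. x \<in> U \<Longrightarrow> (p has_derivative p' x) (at x)" "\<And>h. Ck_on k U (\<lambda>x. p' x h)"
    using p by auto
  have "bounded ((\<lambda>x. p' x h) ` K)" for h
    by (intro compact_imp_bounded compact_continuous_image continuous_on_subset[OF Ck_on_continuous[OF p'(2)] K(3)] K(1))
  then have ex: "\<exists>B. \<forall>x\<in>K. \<bar>p' x h\<bar> \<le> B" for h by (auto simp: bounded_iff)
  obtain B1 where B1: "\<And>x. x \<in> K \<Longrightarrow> \<bar>p' x (1, 0)\<bar> \<le> B1" using ex[of "(1, 0)"] by blast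
  obtain B2 where B2: "\<And>x. x \<in> K \<Longrightarrow> \<bar>p' x (0, 1)\<bar> \<le> B2" using ex[of "(0, 1)"] by blast
  let ?L = "B1 + B2"
  have on: "onorm (p' x) \<le> ?L" if x: "x \<in> K" for x
  proof (rule onorm_le)
    fix h :: "real \<times> real"
    interpret bounded_linear "p' x" using p'(1) x K(3) has_derivative_bounded_linear by blast
    have "p' x h = p' x (fst h *\<^sub>R (1, 0) + snd h *\<^sub>R (0, 1))" by (cases h) simp
    also have "\<dots> = fst h * p' x (1, 0) + snd h * p' x (0, 1)" unfolding add scaleR by simp
    finally have "\<bar>p' x h\<bar> \<le> \<bar>fst h\<bar> * \<bar>p' x (1, 0)\<bar> + \<bar>snd h\<bar> * \<bar>p' x (0, 1)\<bar>"
      by (simp add: abs_triangle_ineq flip: abs_mult)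
    also have "\<dots> \<le> norm h * B1 + norm h * B2"
      using norm_fst_snd_le[of h] by (intro add_mono mult_mono B1 B2 x) auto
    finally show "norm (p' x h) \<le> ?L * norm h" by (simp add: algebra_simps)
  qed
  have "bounded (p ` K)"
    by (intro compact_imp_bounded compact_continuous_image continuous_on_subset[OF Ck_on_continuous[OF p] K(3)] K(1))
  then obtain C where C: "\<And>x. x \<in> K \<Longrightarrow> norm (p x) \<le> C" by (auto simp: bounded_iff)
  have "(p has_derivative p' x) (at x within K)" if "x \<in> K" for x
    using p'(1) that K(3) has_derivative_at_withinI by blast
  note bound = differentiable_bound[OF K(2) this on]
  show ?thesis
  proof (rule blipI[OF C])
    show "norm (p x - p y) \<le> ?L * norm (x - y)" if "x \<in> K" "y \<in> K" for x y
      by (rule bound[OF _ _ that]) simp_all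
  qed
qed


section \<open>Regularity of the solution\<close>

text \<open>Density and flux appear here as bounded Lipschitz functions of the state, so that
  bounds, Borel measurability and periodicity are all inherited from the one representative
  \<open>g\<close> of the state.\<close>

lemma balance_time_shift_reg:
  fixes f g :: "(real ^ 'n) \<times> real \<Rightarrow> 'b::euclidean_space" and \<Phi> :: "'b \<Rightarrow> real" and \<Psi> :: "'b \<Rightarrow> real ^ 'n"
  assumes \<Omega>: "\<Omega> = whole_space \<or> \<Omega> = torus" and q: "1 \<le> q" and \<sigma>: "0 \<le> \<sigma>"
    and g: "g \<in> borel_measurable borel" and gX: "\<And>z. g z \<in> X" and X: "X \<in> sets borel"
    and per: "\<And>x t k. k \<in> periods \<Omega> \<Longrightarrow> g (x + k, t) = g (x, t)"
    and eq: "AE z in lborel. z \<in> region (spacetime \<Omega> T) \<longrightarrow> f z = g z"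
    and \<Phi>: "bounded_lipschitz X \<Phi>" and \<Psi>: "bounded_lipschitz X \<Psi>"
    and bal: "weak_balance \<Omega> T (\<lambda>z. \<Phi> (f z)) (\<lambda>z. \<Psi> (f z))"
    and A: "A \<in> sets borel"
    and reg: "shift_reg (space_shifts A) q \<sigma> (\<lambda>z. \<Phi> (g z))" "shift_reg (space_shifts A) q \<sigma> (\<lambda>z. \<Psi> (g z))"
    and r: "0 < r" "real CARD('n) * r \<le> 1" "r \<le> 1 / 2" and ab: "r < a" "a \<le> b" "ereal (b + r) < T"
  shows "shift_reg (time_shifts A a b r) q \<sigma> (\<lambda>z. \<Phi> (g z))"
proof -
  obtain L1 where L1: "\<And>y. y \<in> X \<Longrightarrow> norm (\<Phi> y) \<le> L1" using \<Phi> unfolding bounded_lipschitz_def by blast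
  obtain L2 where L2: "\<And>y. y \<in> X \<Longrightarrow> norm (\<Psi> y) \<le> L2" using \<Psi> unfolding bounded_lipschitz_def by blast
  have 1: "\<bar>\<Phi> (g z)\<bar> \<le> max L1 L2" for z using L1[OF gX[of z]] by simp
  have 2: "norm (\<Psi> (g z)) \<le> max L1 L2" for z using L2[OF gX[of z]] by simp
  have ae: "AE z in lebesgue. z \<in> region (spacetime \<Omega> T) \<longrightarrow> \<Phi> (f z) = \<Phi> (g z) \<and> \<Psi> (f z) = \<Psi> (g z)"
    using AE_completion[OF eq] by eventually_elim simp
  have per': "\<Phi> (g (x + k, t)) = \<Phi> (g (x, t)) \<and> \<Psi> (g (x + k, t)) = \<Psi> (g (x, t))" if "k \<in> periods \<Omega>" for x t k
    using per[OF that] by simp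
  show ?thesis
    by (rule weak_balance_time_shift_reg[OF \<Omega> q \<sigma> bal ae bounded_lipschitz_measurable[OF \<Phi> X g gX] 1
          bounded_lipschitz_measurable[OF \<Psi> X g gX] 2 per' A reg r ab])
qed

lemma LinftyE:
  assumes "f \<in> Linfty D"
  obtains C where "measurable_fun D f" "0 \<le> C" "AE z in lebesgue_on (region D). norm (f z) \<le> C"
proof -
  obtain C where "AE z in lebesgue_on (region D). norm (f z) \<le> C" using assms by (auto simp: Linfty_def)
  then have "AE z in lebesgue_on (region D). norm (f z) \<le> max 0 C" by eventually_elim simp
  with assms show ?thesis by (intro that[of "max 0 C"]) (auto simp: Linfty_def)
qed

theorem theorem4:
  fixes \<Omega> :: "(real ^ 'n::finite) flat_domain"
    and T :: ereal
    and q \<sigma>u \<sigma>\<rho> \<sigma>v \<rho>0 :: real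
    and M :: nat
    and U :: "(real \<times> real) set"
    and p :: "real \<times> real \<Rightarrow> real"
    and u \<rho> :: "(real ^ 'n) \<times> real \<Rightarrow> real"
    and v :: "(real ^ 'n) \<times> real \<Rightarrow> real ^ 'n"
  assumes "\<Omega> = whole_space \<or> \<Omega> = torus"
    and "0 < T"
    and "q \<ge> 1"
    and "u \<in> Linfty (spacetime \<Omega> T)"
    and "\<rho> \<in> Linfty (spacetime \<Omega> T)"
    and "v \<in> Linfty (spacetime \<Omega> T)"
    and "M \<ge> 2" and "open U" and "Ck_on M U p"
    and "closure (convex hull (ess_range (spacetime \<Omega> T) (\<lambda>z. (u z, \<rho> z)))) \<subseteq> U"
    and "weak_euler_solution \<Omega> T p u \<rho> v"
    and "\<rho>0 > 0"
    and "AE z in lebesgue_on (region (spacetime \<Omega> T)). \<rho> z \<ge> \<rho>0"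
    and "0 \<le> \<sigma>u" "\<sigma>u \<le> 1" "0 \<le> \<sigma>\<rho>" "\<sigma>\<rho> \<le> 1" "0 \<le> \<sigma>v" "\<sigma>v \<le> 1"
    and "u \<in> Linfty_besov_loc \<Omega> T \<sigma>u q"
    and "\<rho> \<in> Linfty_besov_loc \<Omega> T \<sigma>\<rho> q"
    and "v \<in> Linfty_besov_loc \<Omega> T \<sigma>v q"
  shows "u \<in> besov_loc (spacetime \<Omega> T) (Min {\<sigma>\<rho>, \<sigma>v, \<sigma>u}) q
       \<and> \<rho> \<in> besov_loc (spacetime \<Omega> T) (min \<sigma>\<rho> \<sigma>v) q
       \<and> v \<in> besov_loc (spacetime \<Omega> T) (Min {\<sigma>\<rho>, \<sigma>v, \<sigma>u}) q"
proof -
  note \<Omega> = assms(1) and T = assms(2) and q = assms(3)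
  let ?D = "spacetime \<Omega> T"
  have R: "region ?D = UNIV \<times> {t. 0 < t \<and> ereal t < T}" by (rule region_spacetime[OF \<Omega>])
  have R_open: "open (region ?D)" unfolding R by (intro open_Times open_UNIV open_times)
  then have R_meas: "region ?D \<in> sets lebesgue" by auto
  define f where "f z = (u z, \<rho> z, v z)" for z
  obtain Cu where u: "measurable_fun ?D u" "0 \<le> Cu" "AE z in lebesgue_on (region ?D). norm (u z) \<le> Cu"
    using LinftyE[OF assms(4)] .
  obtain C\<rho> where \<rho>: "measurable_fun ?D \<rho>" "0 \<le> C\<rho>" "AE z in lebesgue_on (region ?D). norm (\<rho> z) \<le> C\<rho>"
    using LinftyE[OF assms(5)] .
  obtain Cv where v: "measurable_fun ?D v" "0 \<le> Cv" "AE z in lebesgue_on (region ?D). norm (v z) \<le> Cv"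
    using LinftyE[OF assms(6)] .
  have f_meas: "measurable_fun ?D f"
    using u(1) \<rho>(1) v(1) unfolding measurable_fun_def f_def by (auto intro: borel_measurable_Pair)
  define E where "E = ess_range ?D (\<lambda>z. (u z, \<rho> z))"
  \<comment> \<open>The values of the pair of internal energy and density lie here almost
    everywhere. Compactness and convexity are what the Lipschitz bound for the pressure asks
    for.\<close>
  define K where "K = closure (convex hull E)"
  have up_meas: "(\<lambda>z. (u z, \<rho> z)) \<in> borel_measurable (lebesgue_on (region ?D))"
    using u(1) \<rho>(1) by (auto simp: measurable_fun_def intro: borel_measurable_Pair)
  have "AE z in lebesgue_on (region ?D). norm (u z, \<rho> z) \<le> Cu + C\<rho>"
    using u(3) \<rho>(3)
  proof eventually_elim
    case (elim z)
    then show ?case using norm_Pair_le[of "u z" "\<rho> z"] by linarith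
  qed
  then have "bounded E" unfolding E_def by (rule bounded_ess_range[OF R_meas])
  then have K_comp: "compact K" unfolding K_def by (simp add: compact_closure bounded_convex_hull)
  have K_conv: "convex K" unfolding K_def by (intro convex_closure convex_convex_hull)
  have K_sub: "K \<subseteq> U" using assms(10) by (simp add: K_def E_def)
  have E_K: "E \<subseteq> K" unfolding K_def by (rule subset_trans[OF hull_subset closure_subset])
  have p_blip: "bounded_lipschitz K p"
  proof -
    obtain k where "M = Suc k" using assms(7) by (cases M) auto
    with assms(9) have "Ck_on (Suc k) U p" by simp
    then show ?thesis by (rule bounded_lipschitz_C1[OF _ K_comp K_conv K_sub])
  qed
  \<comment> \<open>The set of admissible states, on which every density and flux is bounded and
    Lipschitz. It is closed, so that the representative can be chosen to take all its values in
    it.\<close>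
  define X where "X = {y :: real \<times> real \<times> (real ^ 'n). (fst y, fst (snd y)) \<in> K \<and> \<rho>0 \<le> fst (snd y) \<and> norm (snd (snd y)) \<le> Cv}"
  have X_closed: "closed X"
  proof -
    have "closed ((\<lambda>y :: real \<times> real \<times> (real ^ 'n). (fst y, fst (snd y))) -` K)"
      using compact_imp_closed[OF K_comp] by (intro closed_vimage continuous_intros)
    moreover have "closed {y :: real \<times> real \<times> (real ^ 'n). \<rho>0 \<le> fst (snd y)}"
      "closed {y :: real \<times> real \<times> (real ^ 'n). norm (snd (snd y)) \<le> Cv}"
      by (intro closed_Collect_le continuous_intros)+
    ultimately show ?thesis
      unfolding X_def vimage_def Collect_conj_eq by (intro closed_Int) auto
  qed
  have X_meas: "X \<in> sets borel" using X_closed by auto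
  have X_bounded: "bounded X"
  proof -
    obtain B where B: "\<And>y. y \<in> K \<Longrightarrow> norm y \<le> B"
      using compact_imp_bounded[OF K_comp] by (auto simp: bounded_iff)
    have "norm y \<le> B + (B + Cv)" if y: "y \<in> X" for y
    proof -
      have "norm (fst y, fst (snd y)) \<le> B" "norm (snd (snd y)) \<le> Cv" using y B by (auto simp: X_def)
      moreover have "norm (fst y) \<le> norm (fst y, fst (snd y))" "norm (fst (snd y)) \<le> norm (fst y, fst (snd y))"
        using norm_fst_snd_le[of "(fst y, fst (snd y))"] by auto
      moreover have "norm y \<le> norm (fst y) + (norm (fst (snd y)) + norm (snd (snd y)))"
        using norm_Pair_le[of "fst y" "snd y"] norm_Pair_le[of "fst (snd y)" "snd (snd y)"] by simp
      ultimately show ?thesis by linarith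
    qed
    then show ?thesis unfolding bounded_iff by blast
  qed
  have fX: "AE z in lebesgue_on (region ?D). f z \<in> X"
    using AE_in_ess_range[OF R_meas up_meas] assms(13) v(3)
  proof eventually_elim
    case (elim z)
    then show ?case using E_K by (auto simp: X_def f_def E_def)
  qed
  \<comment> \<open>A default state is wanted for the replaced time slices. One exists because the
    region is open and nonempty, hence not null, and almost all of it is mapped into
    \<open>X\<close>.\<close>
  have "X \<noteq> {}"
  proof
    assume "X = {}"
    with fX have "AE z in lebesgue. z \<notin> region ?D" using R_meas by (subst (asm) AE_restrict_space_iff) auto
    then have "region ?D \<in> null_sets lebesgue"
      using R_meas by (subst (asm) AE_iff_null_sets[symmetric]) auto
    moreover obtain t where "0 < t" "ereal t < T" using ereal_pos_ex_real[OF T] by blast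
    then have "region ?D \<noteq> {}" unfolding R by auto
    ultimately show False using open_not_negligible[OF R_open] by (simp add: negligible_iff_null_sets)
  qed
  then obtain c0 where c0: "c0 \<in> X" by blast
  obtain g where g: "g \<in> borel_measurable borel" "\<And>z. g z \<in> X"
    "\<And>x t k. k \<in> periods \<Omega> \<Longrightarrow> g (x + k, t) = g (x, t)"
    "AE z in lborel. z \<in> region ?D \<longrightarrow> f z = g z"
    "\<And>t. (\<exists>c. \<forall>x. g (x, t) = c) \<or> (0 < t \<and> ereal t < T \<and> (AE x in lborel. f (x, t) = g (x, t)))"
    by (rule Borel_representative[OF \<Omega> f_meas X_closed c0 fX]) (rule that; assumption)
  obtain B where B: "\<And>y. y \<in> X \<Longrightarrow> norm y \<le> B" using X_bounded by (auto simp: bounded_iff)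
  have g_B: "norm (g z) \<le> B" for z by (rule B[OF g(2)])
  let ?u = "\<lambda>y :: real \<times> real \<times> (real ^ 'n). fst y" and ?\<rho> = "\<lambda>y :: real \<times> real \<times> (real ^ 'n). fst (snd y)"
    and ?v = "\<lambda>y :: real \<times> real \<times> (real ^ 'n). snd (snd y)"
  have lin: "bounded_linear ?u" "bounded_linear ?\<rho>" "bounded_linear ?v" "bounded_linear (\<lambda>y. ?v y $ i)" for i
    by (intro bounded_linear_intros bounded_linear_compose[OF bounded_linear_vec_nth])+
  have bu: "bounded_lipschitz X ?u" and b\<rho>: "bounded_lipschitz X ?\<rho>" and bv: "bounded_lipschitz X ?v" and bvi: "bounded_lipschitz X (\<lambda>y. ?v y $ i)" for i
    by (intro bounded_lipschitz_bounded_linear lin X_bounded)+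
  have bp: "bounded_lipschitz X (\<lambda>y. p (?u y, ?\<rho> y))"
  proof (rule bounded_lipschitz_compose[OF p_blip])
    show "bounded_lipschitz X (\<lambda>y. (?u y, ?\<rho> y))" by (intro bounded_lipschitz_bounded_linear bounded_linear_Pair lin X_bounded)
    show "(\<lambda>y. (?u y, ?\<rho> y)) ` X \<subseteq> K" by (auto simp: X_def)
  qed
  \<comment> \<open>Momentum and total energy as functions of the state; the inner product in the
    energy keeps it within the bilinear operations.\<close>
  define m where "m y = ?\<rho> y *\<^sub>R ?v y" for y
  define e where "e y = 1 / 2 * ?\<rho> y * (?v y \<bullet> ?v y) + ?u y" for y
  have bm: "bounded_lipschitz X m" unfolding m_def by (intro bounded_lipschitz_scaleR b\<rho> bv)
  have bmi: "bounded_lipschitz X (\<lambda>y. ?\<rho> y * ?v y $ i)" for i by (intro bounded_lipschitz_mult b\<rho> bvi)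
  have bFi: "bounded_lipschitz X (\<lambda>y. (?\<rho> y * ?v y $ i) *\<^sub>R ?v y + p (?u y, ?\<rho> y) *\<^sub>R axis i 1)" for i
    by (intro bounded_lipschitz_add bounded_lipschitz_scaleR bounded_lipschitz_const bp bv bmi)
  have be: "bounded_lipschitz X e" unfolding e_def by (intro bounded_lipschitz_add bounded_lipschitz_mult bounded_lipschitz_inner bounded_lipschitz_const b\<rho> bv bu)
  have bFe: "bounded_lipschitz X (\<lambda>y. (p (?u y, ?\<rho> y) + e y) *\<^sub>R ?v y)" by (intro bounded_lipschitz_scaleR bounded_lipschitz_add bp be bv)
  have bal\<rho>: "weak_balance \<Omega> T (\<lambda>z. ?\<rho> (f z)) (\<lambda>z. m (f z))"
    and balm: "\<And>i. weak_balance \<Omega> T (\<lambda>z. ?\<rho> (f z) * ?v (f z) $ i)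
      (\<lambda>z. (?\<rho> (f z) * ?v (f z) $ i) *\<^sub>R ?v (f z) + p (?u (f z), ?\<rho> (f z)) *\<^sub>R axis i 1)"
    and bale: "weak_balance \<Omega> T (\<lambda>z. e (f z)) (\<lambda>z. (p (?u (f z), ?\<rho> (f z)) + e (f z)) *\<^sub>R ?v (f z))"
    using assms(11)
    by (auto simp: weak_euler_solution_def f_def m_def e_def total_energy_def[abs_def] power2_norm_eq_inner)
  \<comment> \<open>\<open>\<sigma>2\<close> is the common spatial exponent of density and velocity,
    all that the mass balance involves; \<open>\<sigma>3\<close> is that of the full state.\<close>
  define \<sigma>2 where "\<sigma>2 = min \<sigma>\<rho> \<sigma>v"
  define \<sigma>3 where "\<sigma>3 = Min {\<sigma>\<rho>, \<sigma>v, \<sigma>u}"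
  have \<sigma>2: "0 \<le> \<sigma>2" "\<sigma>2 \<le> \<sigma>\<rho>" "\<sigma>2 \<le> \<sigma>v" and \<sigma>3: "0 \<le> \<sigma>3" "\<sigma>3 \<le> \<sigma>\<rho>" "\<sigma>3 \<le> \<sigma>v" "\<sigma>3 \<le> \<sigma>u" "\<sigma>3 \<le> \<sigma>2"
    using assms(14-19) by (auto simp: \<sigma>2_def \<sigma>3_def)
  have q0: "0 \<le> q" using q by simp
  have [measurable]: "g \<in> borel_measurable borel" by (rule g(1))
  have gm: "(\<lambda>z. \<Phi> (g z)) \<in> borel_measurable borel" if "bounded_lipschitz X \<Phi>" for \<Phi> :: "real \<times> real \<times> (real ^ 'n) \<Rightarrow> 'c::euclidean_space"
    by (rule bounded_lipschitz_measurable[OF that X_meas g(1,2)])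
  have sp: "shift_reg (space_shifts (S \<inter> cell \<Omega>)) q \<sigma>u (\<lambda>z. ?u (g z))"
      "shift_reg (space_shifts (S \<inter> cell \<Omega>)) q \<sigma>\<rho> (\<lambda>z. ?\<rho> (g z))"
      "shift_reg (space_shifts (S \<inter> cell \<Omega>)) q \<sigma>v (\<lambda>z. ?v (g z))" if S: "compactly_in \<Omega> S" for S
  proof -
    have "(\<lambda>z. ?u (f z)) \<in> Linfty_besov_loc \<Omega> T \<sigma>u q" "(\<lambda>z. ?\<rho> (f z)) \<in> Linfty_besov_loc \<Omega> T \<sigma>\<rho> q"
      "(\<lambda>z. ?v (f z)) \<in> Linfty_besov_loc \<Omega> T \<sigma>v q" using assms(20-22) by (simp_all add: f_def)
    from this[THEN Linfty_besov_space_shift_reg[OF \<Omega> q _ _ g(1,5) S]]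
    show "shift_reg (space_shifts (S \<inter> cell \<Omega>)) q \<sigma>u (\<lambda>z. ?u (g z))"
      "shift_reg (space_shifts (S \<inter> cell \<Omega>)) q \<sigma>\<rho> (\<lambda>z. ?\<rho> (g z))"
      "shift_reg (space_shifts (S \<inter> cell \<Omega>)) q \<sigma>v (\<lambda>z. ?v (g z))"
      using lin(1-3) by (auto intro: borel_measurable_continuous_onI linear_continuous_on)
  qed
  have time: "\<exists>r>0. shift_reg (time_shifts (S \<inter> cell \<Omega>) a b r) q \<sigma>2 (\<lambda>z. ?\<rho> (g z))
      \<and> shift_reg (time_shifts (S \<inter> cell \<Omega>) a b r) q \<sigma>3 (\<lambda>z. ?v (g z))
      \<and> shift_reg (time_shifts (S \<inter> cell \<Omega>) a b r) q \<sigma>3 (\<lambda>z. ?u (g z))"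
    if S: "compactly_in \<Omega> S" and ab: "0 < a" "a \<le> b" "ereal b < T" for S a b
  proof -
    define A where "A = S \<inter> cell \<Omega>"
    have "S \<in> sets borel" using S by (auto simp: compactly_in_def)
    then have A: "A \<in> sets borel" using cell_measurable[OF \<Omega>] by (simp add: A_def)
    obtain d where d: "b < d" "ereal d < T" using ereal_dense2[OF ab(3)] by auto
    \<comment> \<open>The bounds on \<open>r\<close> serve in turn: spatial shifts of length at most
      1, a kernel that fits into a centred period cell, positive times after a shift backwards, and
      times below \<open>T\<close> after a shift forwards.\<close>
    define r where "r = min (min (1 / real CARD('n)) (1 / 2)) (min (a / 2) (d - b))"
    have r: "0 < r" "r \<le> 1 / real CARD('n)" "r \<le> 1 / 2" "r < a" "r \<le> d - b"
    proof -
      have "r \<le> min (1 / real CARD('n)) (1 / 2)" "r \<le> min (a / 2) (d - b)"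
        unfolding r_def by (rule min.cobounded1, rule min.cobounded2)
      then show "r \<le> 1 / real CARD('n)" "r \<le> 1 / 2" "r < a" "r \<le> d - b" using ab by auto
      show "0 < r" using ab d by (simp add: r_def)
    qed
    have rn: "real CARD('n) * r \<le> 1" using r(2) by (simp add: field_simps)
    have rT: "ereal (b + r) < T" using d(2) r(5) by (elim order.strict_trans1[rotated]) simp
    note tail = r(1) rn r(3,4) ab(2) rT
    let ?SA = "space_shifts A" and ?TA = "time_shifts A a b r"
    have smS: "small_shifts ?SA" by (rule small_space_shifts)
    have smT: "small_shifts ?TA" using r(3) by (intro small_time_shifts) simp
    note spA = sp[OF S, folded A_def]
    have snd_g: "(\<lambda>z. snd (g z)) \<in> borel_measurable borel"
      by (intro gm bounded_lipschitz_bounded_linear X_bounded bounded_linear_snd)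
    have sp2: "shift_reg ?SA q \<sigma>2 (\<lambda>z. snd (g z))"
      using shift_reg_Pair[OF smS q0 gm[OF b\<rho>] gm[OF bv] shift_reg_mono[OF smS spA(2) \<sigma>2(2) q0]
          shift_reg_mono[OF smS spA(3) \<sigma>2(3) q0]] by simp
    have "shift_reg ?SA q \<sigma>3 (\<lambda>z. (fst (g z), snd (g z)))"
      by (rule shift_reg_Pair[OF smS q0 gm[OF bu] snd_g shift_reg_mono[OF smS spA(1) \<sigma>3(4) q0]
          shift_reg_mono[OF smS sp2 \<sigma>3(5) q0]])
    then have sp3: "shift_reg ?SA q \<sigma>3 g" by simp
    have sp3': "shift_reg ?SA q \<sigma>3 (\<lambda>z. \<Phi> (g z))" if "bounded_lipschitz X \<Phi>" for \<Phi> :: "real \<times> real \<times> (real ^ 'n) \<Rightarrow> 'c::euclidean_space"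
      by (rule shift_reg_blip[OF smS q g(1) sp3 that g(2)])
    \<comment> \<open>The mass flux is a product of density and velocity alone. Working with the
      pair \<open>snd (g z)\<close> on a ball, and not with the full state, preserves the exponent
      \<open>\<sigma>2\<close>.\<close>
    have m_sp: "shift_reg ?SA q \<sigma>2 (\<lambda>z. m (g z))"
    proof -
      have "shift_reg ?SA q \<sigma>2 (\<lambda>z. (\<lambda>y. fst y *\<^sub>R snd y) (snd (g z)))"
      proof (rule shift_reg_blip[OF smS q snd_g sp2])
        show "bounded_lipschitz (cball 0 B) (\<lambda>y :: real \<times> (real ^ 'n). fst y *\<^sub>R snd y)"
          by (intro bounded_lipschitz_scaleR bounded_lipschitz_bounded_linear bounded_linear_fst bounded_linear_snd bounded_cball)
        show "snd (g z) \<in> cball 0 B" for z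
          using norm_fst_snd_le(2)[of "g z"] g_B[of z] by simp
      qed
      then show ?thesis by (simp add: m_def)
    qed
    have t\<rho>: "shift_reg ?TA q \<sigma>2 (\<lambda>z. ?\<rho> (g z))"
      by (rule balance_time_shift_reg[OF \<Omega> q \<sigma>2(1) g(1,2) X_meas g(3,4) b\<rho> bm bal\<rho> A
            shift_reg_mono[OF smS spA(2) \<sigma>2(2) q0] m_sp tail])
    have tmi: "shift_reg ?TA q \<sigma>3 (\<lambda>z. ?\<rho> (g z) * ?v (g z) $ i)" for i
      by (rule balance_time_shift_reg[OF \<Omega> q \<sigma>3(1) g(1,2) X_meas g(3,4) bmi bFi balm A sp3'[OF bmi] sp3'[OF bFi] tail])
    have te: "shift_reg ?TA q \<sigma>3 (\<lambda>z. e (g z))"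
      by (rule balance_time_shift_reg[OF \<Omega> q \<sigma>3(1) g(1,2) X_meas g(3,4) be bFe bale A sp3'[OF be] sp3'[OF bFe] tail])
    have tm: "shift_reg ?TA q \<sigma>3 (\<lambda>z. m (g z))"
      by (rule shift_reg_vec[OF smT q0 gm[OF bm]]) (simp add: m_def tmi)
    have t\<rho>3: "shift_reg ?TA q \<sigma>3 (\<lambda>z. ?\<rho> (g z))"
      by (rule shift_reg_mono[OF smT t\<rho> \<sigma>3(5) q0])
    have tv: "shift_reg ?TA q \<sigma>3 (\<lambda>z. ?v (g z))"
    proof -
      obtain Bm where Bm: "\<And>y. y \<in> X \<Longrightarrow> norm (m y) \<le> Bm" using bm unfolding bounded_lipschitz_def by blast
      \<comment> \<open>Momentum over density is bounded and Lipschitz on this set of pairs: the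
        density is bounded below by \<open>\<rho>0\<close> and both entries are bounded.\<close>
      let ?Y = "{y :: real \<times> (real ^ 'n). \<rho>0 \<le> fst y} \<inter> cball 0 (B + Bm)"
      have Yb: "bounded ?Y" by (intro bounded_Int) simp
      have "shift_reg ?TA q \<sigma>3 (\<lambda>z. (\<lambda>y. inverse (fst y) *\<^sub>R snd y) (?\<rho> (g z), m (g z)))"
      proof (rule shift_reg_blip[OF smT q _ shift_reg_Pair[OF smT q0 gm[OF b\<rho>] gm[OF bm] t\<rho>3 tm]])
        show "(\<lambda>z. (?\<rho> (g z), m (g z))) \<in> borel_measurable borel"
          by (rule borel_measurable_Pair[OF gm[OF b\<rho>] gm[OF bm]])
        show "bounded_lipschitz ?Y (\<lambda>y. inverse (fst y) *\<^sub>R snd y)"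
          by (intro bounded_lipschitz_scaleR bounded_lipschitz_inverse[OF _ assms(12)] bounded_lipschitz_bounded_linear bounded_linear_fst bounded_linear_snd Yb) auto
        show "(?\<rho> (g z), m (g z)) \<in> ?Y" for z
        proof -
          have "\<rho>0 \<le> ?\<rho> (g z)" using g(2)[of z] by (simp add: X_def)
          moreover have "norm (?\<rho> (g z)) \<le> B"
            using norm_fst_snd_le(2)[of "g z"] norm_fst_snd_le(1)[of "snd (g z)"] g_B[of z] by linarith
          ultimately show ?thesis
            using norm_Pair_le[of "?\<rho> (g z)" "m (g z)"] Bm[OF g(2)[of z]] by simp
        qed
      qed
      moreover have "inverse (?\<rho> (g z)) *\<^sub>R m (g z) = ?v (g z)" for z
      proof -
        have "0 < ?\<rho> (g z)" using g(2)[of z] assms(12) by (simp add: X_def)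
        then show ?thesis by (simp add: m_def)
      qed
      ultimately show ?thesis by simp
    qed
    have tu: "shift_reg ?TA q \<sigma>3 (\<lambda>z. ?u (g z))"
    proof -
      obtain Be where Be: "\<And>y. y \<in> X \<Longrightarrow> norm (e y) \<le> Be" using be unfolding bounded_lipschitz_def by blast
      \<comment> \<open>The internal energy is the total energy minus the kinetic energy, so the
        time regularity of the velocity obtained just before enters here.\<close>
      have t2: "shift_reg ?TA q \<sigma>3 (\<lambda>z. (e (g z), snd (g z)))"
        using shift_reg_Pair[OF smT q0 gm[OF be] snd_g te]
          shift_reg_Pair[OF smT q0 gm[OF b\<rho>] gm[OF bv] t\<rho>3 tv] by simp
      have "shift_reg ?TA q \<sigma>3 (\<lambda>z. (\<lambda>y. ?u y + (- 1 / 2) * ?\<rho> y * (?v y \<bullet> ?v y)) (e (g z), snd (g z)))"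
      proof (rule shift_reg_blip[OF smT q _ t2])
        show "(\<lambda>z. (e (g z), snd (g z))) \<in> borel_measurable borel"
          by (rule borel_measurable_Pair[OF gm[OF be] snd_g])
        show "bounded_lipschitz (cball 0 (Be + B)) (\<lambda>y. ?u y + (- 1 / 2) * ?\<rho> y * (?v y \<bullet> ?v y))"
          by (intro bounded_lipschitz_add bounded_lipschitz_mult bounded_lipschitz_inner bounded_lipschitz_const bounded_lipschitz_bounded_linear lin bounded_cball)
        show "(e (g z), snd (g z)) \<in> cball 0 (Be + B)" for z
          using norm_Pair_le[of "e (g z)" "snd (g z)"] Be[OF g(2)[of z]]
            norm_fst_snd_le(2)[of "g z"] g_B[of z] by simp
      qed
      then show ?thesis by (simp add: e_def)
    qed
    show ?thesis using r(1) t\<rho> tv tu unfolding A_def by blast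
  qed
  have sp\<sigma>: "shift_reg (space_shifts (S \<inter> cell \<Omega>)) q \<sigma>3 (\<lambda>z. ?u (g z))"
      "shift_reg (space_shifts (S \<inter> cell \<Omega>)) q \<sigma>2 (\<lambda>z. ?\<rho> (g z))"
      "shift_reg (space_shifts (S \<inter> cell \<Omega>)) q \<sigma>3 (\<lambda>z. ?v (g z))" if "compactly_in \<Omega> S" for S
    using sp[OF that] \<sigma>2 \<sigma>3 by (auto intro: shift_reg_mono[OF small_space_shifts _ _ q0])
  have bd: "norm (?u (g z)) \<le> B" "norm (?\<rho> (g z)) \<le> B" "norm (?v (g z)) \<le> B" for z
    using norm_fst_snd_le[of "g z"] norm_fst_snd_le[of "snd (g z)"] g_B[of z] by linarith+
  have eq: "AE z in lborel. z \<in> region ?D \<longrightarrow> u z = ?u (g z)" "AE z in lborel. z \<in> region ?D \<longrightarrow> \<rho> z = ?\<rho> (g z)"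
    "AE z in lborel. z \<in> region ?D \<longrightarrow> v z = ?v (g z)"
    using g(4) by (eventually_elim, metis f_def fst_conv snd_conv)+
  have "u \<in> besov_loc ?D \<sigma>3 q"
    by (rule shift_reg_imp_besov_loc[OF \<Omega> T q \<sigma>3(1) u(1) gm[OF bu] bd(1) eq(1) sp\<sigma>(1)]) (use time in blast)+
  moreover have "\<rho> \<in> besov_loc ?D \<sigma>2 q"
    by (rule shift_reg_imp_besov_loc[OF \<Omega> T q \<sigma>2(1) \<rho>(1) gm[OF b\<rho>] bd(2) eq(2) sp\<sigma>(2)]) (use time in blast)+
  moreover have "v \<in> besov_loc ?D \<sigma>3 q"
    by (rule shift_reg_imp_besov_loc[OF \<Omega> T q \<sigma>3(1) v(1) gm[OF bv] bd(3) eq(3) sp\<sigma>(3)]) (use time in blast)+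
  ultimately show ?thesis by (simp add: \<sigma>2_def \<sigma>3_def)
qed

end
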